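(* Let $R=\mathcal{O}_{\mathbb{Q}(\sqrt{-2})}$ and $\omega=\sqrt{-2}$, $\alpha=1+\sqrt{-2}$. Every maximal connected cyclotomic $\mathcal{L}$-graph over $R$ that is not equivalent to a charged signed graph is equivalent to one of the following: (i) $S_2$: two uncharged vertices $1,2$ with one edge $\{1,2\}$ of label $2$; or $S_2'$: vertex $1$ of charge $+1$, vertex $2$ of charge $-1$, edge $\{1,2\}$ of label $\alpha$; (ii) $S_4'$: four uncharged vertices, edges $\{1,2\}$ label $\alpha$, $\{3,4\}$ label $-\alpha$, $\{1,3\}$ label $1$, $\{2,4\}$ label $1$; or $S_4$: charges $+1,-1,-1,+1$ on vertices $1,2,3,4$, edges $\{1,2\}$ label $\omega$, $\{3,4\}$ label $-\omega$, $\{1,3\}$ label $1$, $\{2,4\}$ label $1$; or $S_4^*$: four uncharged vertices, edges $\{1,2\}$ label $\omega$, $\{3,4\}$ label $-\omega$, $\{1,3\}$, $\{2,4\}$, $\{1,4\}$ label $1$, $\{2,3\}$ label $-1$; (iii) $S_8^*$: eight uncharged vertices, edges $\{1,2\},\{1,5\},\{2,6\},\{3,4\},\{3,7\},\{4,8\}$ of label $1$, edges $\{5,6\},\{7,8\}$ of label $-1$, and $\{1,4\}$ label $\omega$, $\{2,3\}$ label $-\omega$, $\{5,8\}$ label $-\omega$, $\{6,7\}$ label $\omega$; (iv) for some $k\ge 2$, $T_{2k}^4$: with $L=k-1$, uncharged vertices $1,\dots,2k$, edges for each $1\le i\le L-1$: $\{i,i+1\}$ label $1$, $\{L+i,L+i+1\}$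 label $-1$, $\{i,L+i+1\}$ label $1$, $\{i+1,L+i\}$ label $-1$; together with $\{1,2L+1\}$ label $\omega$, $\{L+1,2L+1\}$ label $\omega$, $\{L,2L+2\}$ label $\omega$, $\{2L,2L+2\}$ label $-\omega$; (v) for some $k\ge1$, $C_{2k}^{2+}$: vertices $1,\dots,2k+1$, vertices $1$ and $k+1$ of charge $+1$, all others uncharged, edges $\{1,k+1\}$ label $1$, for each $1\le i\le k-1$: $\{i,i+1\}$ label $1$, $\{k+i,k+i+1\}$ label $-1$, $\{i,k+i+1\}$ label $1$, $\{i+1,k+i\}$ label $-1$; together with $\{k,2k+1\}$ label $\omega$ and $\{2k,2k+1\}$ label $-\omega$.
   Context: Let $d<0$ be squarefree, $R=\mathcal{O}_{\mathbb{Q}(\sqrt{d})}$, and for $n\ge1$ let $\mathcal{L}_n=\{x\in R: x\bar x=n\}$, $\mathcal{L}=\{0\}\cup\mathcal{L}_1\cup\mathcal{L}_2\cup\mathcal{L}_3\cup\mathcal{L}_4$. A (charged) $\mathcal{L}$-graph on $n$ vertices is identified with an $n\times n$ Hermitian matrix $A$ whose diagonal entries (charges) lie in $\{0,1,-1\}$ and whose off-diagonal entries lie in $\mathcal{L}$; a vertex is charged if its diagonal entry is nonzero. An edge $\{i,j\}$ with $i<j$ and label $x$ means $A_{ij}=x$, $A_{ji}=\bar x$; unlisted off-diagonal entries are $0$; the weight of an edge is the norm $x\bar x$ of its label. The graph is cyclotomic if all eigenvalues of $A$ lie in $[-2,2]$, connected if $A$ is not permutation-similar to a block diagonal matrix with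 more than one block. $H$ is contained in $G$ if the matrix of $H$ is obtained from that of $G$ by deleting some rows and the corresponding columns. A connected cyclotomic $\mathcal{L}$-graph is maximal if it is not contained in a strictly larger connected cyclotomic $\mathcal{L}$-graph. Matrices $A,A'$ are equivalent if $A'=DPXP^{T}D$ for some $X\in\{A,-A,\bar A,-\bar A\}$, permutation matrix $P$ and diagonal matrix $D$ with diagonal entries $\pm1$. A charged signed graph is an $\mathcal{L}$-graph all of whose entries lie in $\{0,1,-1\}$. *)

theory Defs
  imports
    "Jordan_Normal_Form.Schur_Decomposition"
    "Jordan_Normal_Form.DL_Submatrix"
    "HOL-Computational_Algebra.Polynomial"
    "HOL-Combinatorics.Permutations"
begin

definition quadratic_field :: "int \<Rightarrow> complex set" where
  "quadratic_field d = {of_rat a + of_rat b * csqrt (of_int d) | a b :: rat. True}"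

definition quadratic_integers :: "int \<Rightarrow> complex set" where
  "quadratic_integers d = {x \<in> quadratic_field d. algebraic_int x}"

definition labels_of_norm :: "int \<Rightarrow> nat \<Rightarrow> complex set" where
  "labels_of_norm d n = {x \<in> quadratic_integers d. x * cnj x = of_nat n}"

definition labels :: "int \<Rightarrow> complex set" where
  "labels d = {0} \<union> labels_of_norm d 1 \<union> labels_of_norm d 2 \<union> labels_of_norm d 3 \<union> labels_of_norm d 4"

definition L_graph :: "int \<Rightarrow> complex mat \<Rightarrow> bool" where
  "L_graph d A \<longleftrightarrow> square_mat A \<and> mat_adjoint A = A \<and>
     (\<forall>i < dim_row A. A $$ (i, i) \<in> {0, 1, -1}) \<and>
     (\<forall>i < dim_row A. \<forall>j < dim_row A. i \<noteq> j \<longrightarrow> A $$ (i, j) \<in> labels d)"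

definition charged_signed_graph :: "int \<Rightarrow> complex mat \<Rightarrow> bool" where
  "charged_signed_graph d A \<longleftrightarrow> L_graph d A \<and>
     (\<forall>i < dim_row A. \<forall>j < dim_col A. A $$ (i, j) \<in> {0, 1, -1})"

definition cyclotomic :: "complex mat \<Rightarrow> bool" where
  "cyclotomic A \<longleftrightarrow> (\<forall>e. eigenvalue A e \<longrightarrow> e \<in> complex_of_real ` {-2..2})"

definition permutation_matrix :: "nat \<Rightarrow> complex mat \<Rightarrow> bool" where
  "permutation_matrix n P \<longleftrightarrow>
     (\<exists>p. p permutes {..<n} \<and> P = mat n n (\<lambda>(i, j). if j = p i then 1 else 0))"

definition sign_matrix :: "nat \<Rightarrow> complex mat \<Rightarrow> bool" where
  "sign_matrix n D \<longleftrightarrow> D \<in> carrier_mat n n \<and> diagonal_mat D \<and> (\<forall>i < n. D $$ (i, i) \<in> {1, -1})"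

(* Blocks of size 0 are excluded, as every matrix would otherwise be decomposable. *)
definition connected_graph :: "complex mat \<Rightarrow> bool" where
  "connected_graph A \<longleftrightarrow> \<not> (\<exists>P Bs. permutation_matrix (dim_row A) P \<and>
     P * A * transpose_mat P = diag_block_mat Bs \<and> length Bs > 1 \<and>
     (\<forall>B \<in> set Bs. square_mat B \<and> dim_row B > 0))"

definition contained_in :: "complex mat \<Rightarrow> complex mat \<Rightarrow> bool" where
  "contained_in H G \<longleftrightarrow> (\<exists>I. H = submatrix G I I)"

definition connected_cyclotomic :: "int \<Rightarrow> complex mat \<Rightarrow> bool" where
  "connected_cyclotomic d A \<longleftrightarrow> L_graph d A \<and> connected_graph A \<and> cyclotomic A"

definition maximal_connected_cyclotomic :: "int \<Rightarrow> complex mat \<Rightarrow> bool" where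
  "maximal_connected_cyclotomic d A \<longleftrightarrow> connected_cyclotomic d A \<and>
     \<not> (\<exists>G. connected_cyclotomic d G \<and> dim_row A < dim_row G \<and> contained_in A G)"

definition equivalent :: "complex mat \<Rightarrow> complex mat \<Rightarrow> bool" where
  "equivalent A A' \<longleftrightarrow> (\<exists>X P D. X \<in> {A, - A, map_mat cnj A, - map_mat cnj A} \<and>
     permutation_matrix (dim_row A) P \<and> sign_matrix (dim_row A) D \<and>
     A' = D * P * X * transpose_mat P * D)"

definition lookup :: "('a \<times> complex) list \<Rightarrow> 'a \<Rightarrow> complex" where
  "lookup ps x = (case map_of ps x of None \<Rightarrow> 0 | Some y \<Rightarrow> y)"

(* Vertices are numbered from 1 in the lists of charges and edges, matrix indices start at 0.
   An entry ((i, j), x) of the edge list must satisfy i < j. *)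
definition graph_matrix ::
    "nat \<Rightarrow> (nat \<times> complex) list \<Rightarrow> ((nat \<times> nat) \<times> complex) list \<Rightarrow> complex mat" where
  "graph_matrix n charges edges = mat n n (\<lambda>(i, j).
     if i = j then lookup charges (i + 1)
     else if i < j then lookup edges (i + 1, j + 1)
     else cnj (lookup edges (j + 1, i + 1)))"

definition \<omega> :: complex where "\<omega> = csqrt (-2)"

definition \<alpha> :: complex where "\<alpha> = 1 + \<omega>"

definition S2 :: "complex mat" where
  "S2 = graph_matrix 2 [] [((1, 2), 2)]"

definition S2' :: "complex mat" where
  "S2' = graph_matrix 2 [(1, 1), (2, -1)] [((1, 2), \<alpha>)]"

definition S4' :: "complex mat" where
  "S4' = graph_matrix 4 [] [((1, 2), \<alpha>), ((3, 4), -\<alpha>), ((1, 3), 1), ((2, 4), 1)]"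

definition S4 :: "complex mat" where
  "S4 = graph_matrix 4 [(1, 1), (2, -1), (3, -1), (4, 1)]
     [((1, 2), \<omega>), ((3, 4), -\<omega>), ((1, 3), 1), ((2, 4), 1)]"

definition S4_star :: "complex mat" where
  "S4_star = graph_matrix 4 []
     [((1, 2), \<omega>), ((3, 4), -\<omega>), ((1, 3), 1), ((2, 4), 1), ((1, 4), 1), ((2, 3), -1)]"

definition S8_star :: "complex mat" where
  "S8_star = graph_matrix 8 []
     [((1, 2), 1), ((1, 5), 1), ((2, 6), 1), ((3, 4), 1), ((3, 7), 1), ((4, 8), 1),
      ((5, 6), -1), ((7, 8), -1),
      ((1, 4), \<omega>), ((2, 3), -\<omega>), ((5, 8), -\<omega>), ((6, 7), \<omega>)]"

definition ladder_edges :: "nat \<Rightarrow> ((nat \<times> nat) \<times> complex) list" where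
  "ladder_edges m = concat (map (\<lambda>i.
     [((i, i + 1), 1), ((m + i, m + i + 1), -1), ((i, m + i + 1), 1), ((i + 1, m + i), -1)])
     [1..<m])"

(* The graph T_{2k}^4, for k >= 2. *)
definition T4 :: "nat \<Rightarrow> complex mat" where
  "T4 k = (let L = k - 1 in graph_matrix (2 * k) []
     (ladder_edges L @
      [((1, 2 * L + 1), \<omega>), ((L + 1, 2 * L + 1), \<omega>),
       ((L, 2 * L + 2), \<omega>), ((2 * L, 2 * L + 2), -\<omega>)]))"

(* The graph C_{2k}^{2+}, for k >= 1. *)
definition C2_plus :: "nat \<Rightarrow> complex mat" where
  "C2_plus k = graph_matrix (2 * k + 1) [(1, 1), (k + 1, 1)]
     ([((1, k + 1), 1)] @ ladder_edges k @
      [((k, 2 * k + 1), \<omega>), ((2 * k, 2 * k + 1), -\<omega>)])"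

end

theory Submission
  imports Defs "HOL-Analysis.Function_Topology" "HOL-Analysis.Topology_Euclidean_Space" "HOL-Number_Theory.Cong"
begin

text \<open>
  If \<open>A\<close> is cyclotomic then \<open>4 - A\<^sup>2\<close> is positive semidefinite. Hence the weights at a vertex
  (including the charge) add up to at most 4; if they add up to exactly 4, the corresponding
  row of \<open>A\<^sup>2\<close> vanishes off the diagonal; and the 2 by 2 minors of \<open>4 - A\<^sup>2\<close> are nonnegative.
  Edges of weight 3 or 4 nearly exhaust this budget and determine the graph. A vertex with two
  edges of weight 2 is saturated, and the graph unrolls from it as a ladder of pairs of twin
  vertices, which closes up in \<open>T4\<close> or \<open>C2_plus\<close>. Otherwise the edges of weight 2 form a matching, and
  the same local conditions force the graph to be an induced subgraph of \<open>S4\<close>, \<open>S4_star\<close> or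
  \<open>S8_star\<close>.

  Maximality is used in two ways. These three graphs satisfy \<open>A\<^sup>2 = 4\<close>, so none of their proper
  induced subgraphs is maximal; and a one-vertex extension of a cyclotomic graph is cyclotomic as
  soon as it has eigenvectors for 2 and for -2 that do not vanish at the new vertex, which completes
  the ladders.
\<close>

section \<open>Hermitian forms\<close>

text \<open>The spectral condition is used as the inequality \<open>cyc\<close> on the Hermitian
  form, which passes to induced subgraphs at once; the only spectral input is a minimum of the
  Rayleigh quotient of A and of -A. The shape of the proof comes from the two ways in which a local
  analysis can stop early. A bounded configuration is matched with an induced subgraph of a fixed
  finite graph, so each finite target is proved cyclotomic in order to serve as the larger graph
  that contradicts maximality. A ladder can be arbitrarily long, so no fixed graph can play this
  part: the missing vertex is built from vectors with Gram matrix A + 2I, whose linear dependences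
  are eigenvectors for -2, and sign changes turn these into eigenvectors for 2. A closed ladder
  exhausts the vertices and is compared with its target entry by entry. Labels are known only up to
  switching. Structural hypotheses are therefore statements about weights, and each label is
  normalised by switching at a vertex that the labels fixed before do not meet.\<close>

definition nsq :: "complex \<Rightarrow> real" where "nsq z = (cmod z)\<^sup>2"

definition matvec :: "nat \<Rightarrow> (nat \<Rightarrow> nat \<Rightarrow> complex) \<Rightarrow> (nat \<Rightarrow> complex) \<Rightarrow> nat \<Rightarrow> complex" where
  "matvec n a v i = (\<Sum>j<n. a i j * v j)"

definition ip :: "nat \<Rightarrow> (nat \<Rightarrow> complex) \<Rightarrow> (nat \<Rightarrow> complex) \<Rightarrow> complex" where
  "ip n u v = (\<Sum>i<n. cnj (u i) * v i)"

definition qf :: "nat \<Rightarrow> (nat \<Rightarrow> nat \<Rightarrow> complex) \<Rightarrow> (nat \<Rightarrow> complex) \<Rightarrow> real" where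
  "qf n a v = Re (ip n v (matvec n a v))"

definition sqn :: "nat \<Rightarrow> (nat \<Rightarrow> complex) \<Rightarrow> real" where
  "sqn n v = (\<Sum>i<n. nsq (v i))"

definition herm :: "(nat \<Rightarrow> nat \<Rightarrow> complex) \<Rightarrow> bool" where
  "herm a \<longleftrightarrow> (\<forall>i j. a j i = cnj (a i j))"

definition cyc :: "nat \<Rightarrow> (nat \<Rightarrow> nat \<Rightarrow> complex) \<Rightarrow> bool" where
  "cyc n a \<longleftrightarrow> (\<forall>v. \<bar>qf n a v\<bar> \<le> 2 * sqn n v)"

lemma nsq_eq: "complex_of_real (nsq z) = cnj z * z"
  by (metis complex_norm_square mult.commute nsq_def)

lemma nsq_Re: "nsq z = Re (cnj z * z)"
  by (metis nsq_eq Re_complex_of_real)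

lemma nsq_mult: "nsq (x * y) = nsq x * nsq y"
  by (simp add: nsq_def norm_mult power_mult_distrib)

lemma nsq_0 [simp]: "nsq z = 0 \<longleftrightarrow> z = 0"
  by (simp add: nsq_def)

lemma nsq_ge0 [simp]: "nsq z \<ge> 0"
  by (simp add: nsq_def)

lemma nsq_cnj [simp]: "nsq (cnj z) = nsq z" "nsq (- z) = nsq z"
  by (simp_all add: nsq_def)

lemma ip_self: "ip n v v = complex_of_real (sqn n v)"
  by (simp add: ip_def sqn_def nsq_eq)

lemma sqn_ge0 [simp]: "sqn n v \<ge> 0"
  by (simp add: sqn_def sum_nonneg)

lemma sqn_eq0: "sqn n v = 0 \<longleftrightarrow> (\<forall>i<n. v i = 0)"
  unfolding sqn_def by (subst sum_nonneg_eq_0_iff) auto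

lemma ip_add: "ip n (\<lambda>i. u i + v i) w = ip n u w + ip n v w"
  "ip n w (\<lambda>i. u i + v i) = ip n w u + ip n w v"
  by (simp_all add: ip_def algebra_simps sum.distrib)

lemma ip_scale: "ip n (\<lambda>i. c * u i) w = cnj c * ip n u w"
  "ip n w (\<lambda>i. c * u i) = c * ip n w u"
  by (simp_all add: ip_def sum_distrib_left mult.assoc mult.left_commute)

lemma ip_cnj: "ip n u v = cnj (ip n v u)"
  by (simp add: ip_def mult.commute)

lemma matvec_add: "matvec n a (\<lambda>i. u i + v i) = (\<lambda>i. matvec n a u i + matvec n a v i)"
  by (rule ext) (simp add: matvec_def algebra_simps sum.distrib)

lemma matvec_scale: "matvec n a (\<lambda>i. c * u i) = (\<lambda>i. c * matvec n a u i)"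
  by (rule ext) (simp add: matvec_def sum_distrib_left mult.left_commute)

lemma matvec_herm: assumes "herm a" shows "ip n u (matvec n a v) = ip n (matvec n a u) v"
proof -
  have "ip n u (matvec n a v) = (\<Sum>i<n. \<Sum>j<n. cnj (u i) * a i j * v j)"
    by (simp add: ip_def matvec_def sum_distrib_left mult.assoc)
  also have "\<dots> = (\<Sum>j<n. \<Sum>i<n. cnj (u i) * a i j * v j)"
    by (rule sum.swap)
  also have "\<dots> = (\<Sum>j<n. \<Sum>i<n. cnj (a j i * u i) * v j)"
  proof (intro sum.cong refl)
    fix i j
    have "a i j = cnj (a j i)" using assms unfolding herm_def by blast
    then show "cnj (u i) * a i j * v j = cnj (a j i * u i) * v j" by (simp add: mult.commute)
  qed
  also have "\<dots> = ip n (matvec n a u) v"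
    by (simp add: ip_def matvec_def sum_distrib_right)
  finally show ?thesis .
qed

lemma ip_app_cnj: assumes "herm a" shows "ip n v (matvec n a u) = cnj (ip n u (matvec n a v))"
  unfolding matvec_herm[OF assms, of n v u] by (rule ip_cnj)

lemma ip_app_real: assumes "herm a" shows "ip n v (matvec n a v) = complex_of_real (qf n a v)"
  using ip_app_cnj[OF assms, of n v v] unfolding qf_def by (simp add: complex_eq_iff)

lemma qf_add_scale:
  assumes "herm a"
  shows "qf n a (\<lambda>i. u i + c * v i) = qf n a u + 2 * Re (c * ip n u (matvec n a v)) + nsq c * qf n a v"
proof -
  have "ip n (\<lambda>i. u i + c * v i) (matvec n a (\<lambda>i. u i + c * v i)) =
     ip n u (matvec n a u) + c * ip n u (matvec n a v) + cnj c * ip n v (matvec n a u) + cnj c * c * ip n v (matvec n a v)"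
    unfolding matvec_add matvec_scale ip_add ip_scale by (simp add: algebra_simps)
  also have "ip n v (matvec n a u) = cnj (ip n u (matvec n a v))"
    by (rule ip_app_cnj[OF assms])
  also have "cnj c * c * ip n v (matvec n a v) = complex_of_real (nsq c * qf n a v)"
    unfolding ip_app_real[OF assms] by (simp add: nsq_eq)
  finally have "qf n a (\<lambda>i. u i + c * v i) = Re (ip n u (matvec n a u) + c * ip n u (matvec n a v) +
      cnj c * cnj (ip n u (matvec n a v)) + complex_of_real (nsq c * qf n a v))"
    unfolding qf_def[of n a "\<lambda>i. u i + c * v i"] by simp
  then show ?thesis by (simp add: qf_def[of n a u])
qed

text \<open>A zero of a nonnegative form is a minimum, so the first variation in every coordinate
  direction vanishes there.\<close>

lemma psd_null:
  assumes h: "herm b" and p: "\<And>v. qf n b v \<ge> 0" and z: "qf n b v = 0" and i: "i < n"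
  shows "matvec n b v i = 0"
proof (rule ccontr)
  assume ne: "matvec n b v i \<noteq> 0"
  define \<beta> where "\<beta> = matvec n b v i"
  define e where "e = (\<lambda>j. if j = i then 1 else 0 :: complex)"
  have ie: "ip n e w = w i" for w
  proof -
    have "ip n e w = (\<Sum>j<n. if j = i then w j else 0)"
      unfolding ip_def e_def by (intro sum.cong) auto
    then show ?thesis using i by simp
  qed
  have key: "0 \<le> 2 * Re (c * cnj \<beta>) + nsq c * qf n b e" for c
  proof -
    have "ip n v (matvec n b e) = cnj \<beta>"
      using matvec_herm[OF h, of n v e] ip_cnj[of n "matvec n b v" e] ie[of "matvec n b v"] by (simp add: \<beta>_def)
    then show ?thesis
      using p[of "\<lambda>j. v j + c * e j"] qf_add_scale[OF h, of n v c e] z by simp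
  qed
  define B where "B = qf n b e"
  have B0: "B \<ge> 0" using p B_def by simp
  \<comment> \<open>Any t > 0 with t * B < 2 makes the form negative along the direction - t
    \<beta>; adding 1 keeps the denominator positive when B = 0.\<close>
  define t where "t = 1 / (B + 1)"
  have t0: "t > 0" using B0 by (simp add: t_def)
  have "0 \<le> 2 * (- t * nsq \<beta>) + t\<^sup>2 * nsq \<beta> * B"
  proof -
    have "Re (- complex_of_real t * \<beta> * cnj \<beta>) = - t * nsq \<beta>"
      unfolding nsq_Re by (simp add: algebra_simps)
    moreover have "nsq (- complex_of_real t * \<beta>) = t\<^sup>2 * nsq \<beta>"
      unfolding nsq_def by (simp add: norm_mult power_mult_distrib)
    ultimately show ?thesis using key[of "- complex_of_real t * \<beta>"] B_def by simp
  qed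
  then have "0 \<le> t * nsq \<beta> * (t * B - 2)" by (simp add: power2_eq_square algebra_simps)
  moreover have "t * B \<le> 1" using B0 by (simp add: t_def divide_simps)
  moreover have "t * nsq \<beta> > 0" using t0 ne \<beta>_def by (metis mult_pos_pos nsq_0 nsq_ge0 order_le_less)
  ultimately show False by (smt (verit) mult_pos_neg)
qed

section \<open>The least eigenvalue as a minimum of the Rayleigh quotient\<close>

definition minus_scalar :: "real \<Rightarrow> (nat \<Rightarrow> nat \<Rightarrow> complex) \<Rightarrow> nat \<Rightarrow> nat \<Rightarrow> complex" where
  "minus_scalar r a i j = a i j - (if i = j then complex_of_real r else 0)"

lemma herm_shift: "herm a \<Longrightarrow> herm (minus_scalar r a)"
  unfolding herm_def
proof (intro allI)
  fix i j
  assume "\<forall>i j. a j i = cnj (a i j)"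
  then have "a j i = cnj (a i j)" by blast
  then show "minus_scalar r a j i = cnj (minus_scalar r a i j)" by (simp add: minus_scalar_def)
qed

lemma matvec_shift: "i < n \<Longrightarrow> matvec n (minus_scalar r a) v i = matvec n a v i - r * v i"
proof -
  assume i: "i < n"
  have "matvec n (minus_scalar r a) v i = (\<Sum>j<n. a i j * v j - (if i = j then r * v j else 0))"
    unfolding matvec_def minus_scalar_def by (intro sum.cong) (auto simp: algebra_simps)
  then show ?thesis using i by (simp add: sum_subtractf matvec_def)
qed

lemma qf_shift: "qf n (minus_scalar r a) v = qf n a v - r * sqn n v"
proof -
  have "ip n v (matvec n (minus_scalar r a) v) = (\<Sum>i<n. cnj (v i) * matvec n a v i - r * (cnj (v i) * v i))"
    unfolding ip_def by (intro sum.cong) (auto simp: matvec_shift algebra_simps)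
  also have "\<dots> = ip n v (matvec n a v) - r * ip n v v"
    by (simp add: ip_def sum_subtractf sum_distrib_left)
  finally show ?thesis by (simp add: qf_def ip_self)
qed

lemma continuous_qf: "continuous_on K (\<lambda>v. qf n a v)" "continuous_on K (\<lambda>v. sqn n v)"
  unfolding qf_def sqn_def ip_def matvec_def nsq_def
  by (intro continuous_intros continuous_on_product_then_coordinatewise continuous_on_id)+

lemma qf_scale: "qf n a (\<lambda>i. c * v i) = nsq c * qf n a v"
proof -
  have "ip n (\<lambda>i. c * v i) (matvec n a (\<lambda>i. c * v i)) = of_real (nsq c) * ip n v (matvec n a v)"
    unfolding matvec_scale ip_scale nsq_eq by simp
  then show ?thesis unfolding qf_def by simp
qed

lemma sqn_scale: "sqn n (\<lambda>i. c * v i) = nsq c * sqn n v"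
  by (simp add: sqn_def nsq_mult sum_distrib_left)

lemma qf_cong: "(\<And>i. i < n \<Longrightarrow> v i = w i) \<Longrightarrow> qf n a v = qf n a w"
  unfolding qf_def ip_def matvec_def by simp

lemma sqn_cong: "(\<And>i. i < n \<Longrightarrow> v i = w i) \<Longrightarrow> sqn n v = sqn n w"
  unfolding sqn_def by simp

text \<open>The minimum of the form on the unit sphere is an eigenvalue: subtracting it leaves a
  nonnegative form that vanishes at the minimiser, and \<open>psd_null\<close> applies. The
  accompanying lower bound on the form makes this a substitute for the spectral theorem.\<close>

lemma rayleigh:
  assumes h: "herm a" and n: "n > 0"
  obtains \<mu> :: real and v :: "nat \<Rightarrow> complex" where "\<And>i. i < n \<Longrightarrow> matvec n a v i = \<mu> * v i" "\<exists>i<n. v i \<noteq> 0" "\<And>i. i \<ge> n \<Longrightarrow> v i = 0"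
     "\<And>w. qf n a w \<ge> \<mu> * sqn n w"
proof -
  \<comment> \<open>Vectors are functions on all of nat, so compactness is Tychonoff's theorem for a
    product of discs; the factors {0} pin the coordinates beyond \<open>n\<close>, which the form
    does not see.\<close>
  define P where "P = (PiE UNIV (\<lambda>i::nat. if i < n then cball (0::complex) 1 else {0}))"
  have P: "compact P"
  proof -
    have "compactin (product_topology (\<lambda>i. euclidean) UNIV) P"
      unfolding P_def compactin_PiE by (auto simp: compactin_euclidean_iff)
    then show ?thesis
      by (simp add: euclidean_product_topology compactin_euclidean_iff)
  qed
  define K where "K = P \<inter> {v. sqn n v = 1}"
  have "closed {v. sqn n v = 1}"
    by (intro closed_Collect_eq continuous_qf continuous_on_const)
  then have K: "compact K" unfolding K_def using P by (rule compact_Int_closed[rotated])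
  have inK: "(\<lambda>i. if i < n then w i else 0) \<in> K" if "sqn n w = 1" for w
  proof -
    have "nsq (w i) \<le> 1" if "i < n" for i
      using \<open>sqn n w = 1\<close> that unfolding sqn_def
      by (metis finite_lessThan lessThan_iff member_le_sum nsq_ge0)
    then have "cmod (w i) \<le> 1" if "i < n" for i
      using that unfolding nsq_def by (metis abs_norm_cancel abs_square_le_1)
    moreover have "sqn n (\<lambda>i. if i < n then w i else 0) = 1"
      using that sqn_cong[of n "\<lambda>i. if i < n then w i else 0" w] by simp
    ultimately show ?thesis unfolding K_def P_def by auto
  qed
  have "sqn n (\<lambda>i. if i = 0 then 1 else 0) = (\<Sum>i<n. if i = 0 then 1 else 0 :: real)"
    unfolding sqn_def by (intro sum.cong) (auto simp: nsq_def)
  then have "K \<noteq> {}" using inK[of "\<lambda>i. if i = 0 then 1 else 0"] n by auto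
  then obtain v where v: "v \<in> K" "\<And>w. w \<in> K \<Longrightarrow> qf n a v \<le> qf n a w"
    using continuous_attains_inf[OF K _ continuous_qf(1)] by metis
  define \<mu> where "\<mu> = qf n a v"
  have low: "qf n a w \<ge> \<mu> * sqn n w" for w
  proof (cases "sqn n w = 0")
    case True
    then have "qf n a w = qf n a (\<lambda>i. 0)" using sqn_eq0 by (intro qf_cong) auto
    then show ?thesis using True by (simp add: qf_def matvec_def ip_def)
  next
    case False
    define c where "c = complex_of_real (1 / sqrt (sqn n w))"
    have c: "nsq c = 1 / sqn n w" unfolding c_def nsq_def using False
      by (simp add: power_divide norm_divide)
    have "sqn n (\<lambda>i. c * w i) = 1" using c False by (simp add: sqn_scale)
    from inK[OF this] have "\<mu> \<le> qf n a (\<lambda>i. if i < n then c * w i else 0)" using v(2) \<mu>_def by blast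
    also have "\<dots> = qf n a (\<lambda>i. c * w i)" by (rule qf_cong) auto
    also have "\<dots> = qf n a w / sqn n w" by (simp add: qf_scale c)
    finally show ?thesis using False sqn_ge0[of n w] by (simp add: field_simps pos_le_divide_eq order_le_less)
  qed
  have s1: "sqn n v = 1" using v K_def by auto
  have "matvec n (minus_scalar \<mu> a) v i = 0" if "i < n" for i
  proof (rule psd_null[OF herm_shift[OF h] _ _ that])
    show "0 \<le> qf n (minus_scalar \<mu> a) w" for w using low[of w] by (simp add: qf_shift)
    show "qf n (minus_scalar \<mu> a) v = 0" by (simp add: qf_shift s1 \<mu>_def)
  qed
  then have ev: "matvec n a v i = \<mu> * v i" if "i < n" for i using that by (simp add: matvec_shift)
  have "\<exists>i<n. v i \<noteq> 0" using s1 sqn_eq0[of n v] by auto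
  moreover have "v i = 0" if "i \<ge> n" for i
    using v(1) that unfolding K_def P_def PiE_def Pi_def by (auto dest: spec[of _ i])
  ultimately show ?thesis using that[of v \<mu>] ev low by blast
qed

section \<open>Graphs with bounded form\<close>

lemma sqn_add_scale:
  "sqn n (\<lambda>i. u i + c * v i) = sqn n u + 2 * Re (c * ip n u v) + nsq c * sqn n v"
proof -
  have "complex_of_real (sqn n (\<lambda>i. u i + c * v i)) =
     ip n u u + c * ip n u v + cnj c * ip n v u + cnj c * c * ip n v v"
    unfolding ip_self[symmetric] ip_add ip_scale by (simp add: algebra_simps)
  also have "ip n v u = cnj (ip n u v)" by (rule ip_cnj)
  also have "cnj c * c * ip n v v = complex_of_real (nsq c * sqn n v)"
    by (simp add: nsq_eq ip_self)
  finally have "sqn n (\<lambda>i. u i + c * v i) = Re (complex_of_real (sqn n u) + c * ip n u v +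
      cnj c * cnj (ip n u v) + complex_of_real (nsq c * sqn n v))"
    unfolding ip_self by (metis Re_complex_of_real)
  then show ?thesis by simp
qed

text \<open>This is \<open>4 (4 - A\<^sup>2) = (2 - A) (2 + A) (2 - A) + (2 + A) (2 - A) (2 + A)\<close>.\<close>

lemma cyc_norm:
  assumes h: "herm a" and c: "cyc n a"
  shows "sqn n (matvec n a v) \<le> 4 * sqn n v"
proof -
  define w where "w = matvec n a v"
  define u where "u = (\<lambda>i. 2 * v i)"
  have su: "sqn n u = 4 * sqn n v"
    unfolding u_def sqn_scale by (simp add: nsq_def)
  have iu: "ip n u (matvec n a w) = complex_of_real (2 * sqn n w)"
    unfolding u_def ip_scale matvec_herm[OF h] w_def ip_self by simp
  have "2 * sqn n (\<lambda>i. u i + (-1) * w i) + qf n a (\<lambda>i. u i + (-1) * w i) \<ge> 0"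
    "2 * sqn n (\<lambda>i. u i + 1 * w i) - qf n a (\<lambda>i. u i + 1 * w i) \<ge> 0"
    using c[unfolded cyc_def] by (smt (verit))+
  then have "4 * sqn n u + 4 * sqn n w - 8 * sqn n w \<ge> 0"
    unfolding sqn_add_scale qf_add_scale[OF h] iu by (simp add: nsq_def)
  then show ?thesis using su by (simp add: w_def)
qed

section \<open>The matrix 4 - A^2 and its minors\<close>

definition sq :: "nat \<Rightarrow> (nat \<Rightarrow> nat \<Rightarrow> complex) \<Rightarrow> nat \<Rightarrow> nat \<Rightarrow> complex" where
  "sq n a i j = (\<Sum>t<n. a i t * a t j)"

definition defect :: "nat \<Rightarrow> (nat \<Rightarrow> nat \<Rightarrow> complex) \<Rightarrow> nat \<Rightarrow> nat \<Rightarrow> complex" where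
  "defect n a i j = (if i = j then 4 else 0) - sq n a i j"

lemma hermD: "herm a \<Longrightarrow> a j i = cnj (a i j)"
  unfolding herm_def by blast

lemma hermI: "(\<And>i j. a j i = cnj (a i j)) \<Longrightarrow> herm a"
  unfolding herm_def by blast

lemma herm_cof: assumes "herm a" shows "herm (defect n a)"
proof (rule hermI)
  fix i j
  have "a j t * a t i = cnj (a i t * a t j)" for t
    using hermD[OF assms, of j t] hermD[OF assms, of t i] by simp
  then have "sq n a j i = cnj (sq n a i j)"
    unfolding sq_def by (simp add: cnj_sum)
  then show "defect n a j i = cnj (defect n a i j)" unfolding defect_def by simp
qed

lemma matvec_sq: "matvec n (sq n a) v = matvec n a (matvec n a v)"
proof
  fix i
  have "matvec n (sq n a) v i = (\<Sum>j<n. \<Sum>t<n. a i t * a t j * v j)"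
    by (simp add: matvec_def sq_def sum_distrib_right)
  also have "\<dots> = (\<Sum>t<n. \<Sum>j<n. a i t * a t j * v j)" by (rule sum.swap)
  finally show "matvec n (sq n a) v i = matvec n a (matvec n a v) i"
    by (simp add: matvec_def sum_distrib_left mult.assoc)
qed

lemma qf_cof: assumes h: "herm a" shows "qf n (defect n a) v = 4 * sqn n v - sqn n (matvec n a v)"
proof -
  have e: "matvec n (defect n a) v i = 4 * v i - matvec n (sq n a) v i" if "i < n" for i
  proof -
    have "matvec n (defect n a) v i = (\<Sum>j<n. (if i = j then 4 * v j else 0) - sq n a i j * v j)"
      unfolding matvec_def defect_def by (intro sum.cong) (auto simp: algebra_simps)
    then show ?thesis using that by (simp add: sum_subtractf matvec_def)
  qed
  have "ip n v (matvec n (defect n a) v) = (\<Sum>i<n. 4 * (cnj (v i) * v i) - cnj (v i) * matvec n a (matvec n a v) i)"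
    unfolding ip_def by (intro sum.cong) (simp_all add: e right_diff_distrib matvec_sq)
  also have "\<dots> = 4 * ip n v v - ip n v (matvec n a (matvec n a v))"
    by (simp add: sum_subtractf ip_def sum_distrib_left)
  also have "\<dots> = complex_of_real (4 * sqn n v - sqn n (matvec n a v))"
    unfolding matvec_herm[OF h] ip_self by simp
  finally show ?thesis by (simp add: qf_def)
qed

definition unitv :: "nat \<Rightarrow> nat \<Rightarrow> complex" where
  "unitv i j = (if j = i then 1 else 0)"

lemma matvec_unitv: "i < n \<Longrightarrow> matvec n a (unitv i) l = a l i"
proof -
  assume "i < n"
  have "matvec n a (unitv i) l = (\<Sum>j<n. if j = i then a l j else 0)"
    unfolding matvec_def unitv_def by (intro sum.cong) auto
  then show ?thesis using \<open>i < n\<close> by simp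
qed

lemma ip_unitv: "i < n \<Longrightarrow> ip n (unitv i) w = w i"
proof -
  assume "i < n"
  have "ip n (unitv i) w = (\<Sum>j<n. if j = i then w j else 0)"
    unfolding ip_def unitv_def by (intro sum.cong) auto
  then show ?thesis using \<open>i < n\<close> by simp
qed

lemma qf_unitv: "i < n \<Longrightarrow> qf n b (unitv i) = Re (b i i)"
  by (simp add: qf_def ip_unitv matvec_unitv)

lemma psd_minor:
  assumes h: "herm b" and p: "\<And>v. qf n b v \<ge> 0" and i: "i < n" and j: "j < n"
  shows "nsq (b i j) \<le> Re (b i i) * Re (b j j)"
proof (cases "Re (b j j) = 0")
  case True
  then have "matvec n b (unitv j) i = 0"
    by (intro psd_null[OF h p _ i]) (simp add: qf_unitv j)
  then show ?thesis using j True by (simp add: matvec_unitv nsq_def)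
next
  case False
  define r where "r = Re (b j j)"
  have r: "r > 0" using False p[of "unitv j"] j by (simp add: qf_unitv r_def)
  \<comment> \<open>This c minimises the form at e_i + c e_j.\<close>
  define c where "c = - cnj (b i j) / r"
  have "0 \<le> qf n b (\<lambda>k. unitv i k + c * unitv j k)" by (rule p)
  also have "\<dots> = Re (b i i) + 2 * Re (c * b i j) + nsq c * r"
    unfolding qf_add_scale[OF h] using i j by (simp add: qf_unitv ip_unitv matvec_unitv r_def)
  also have "c * b i j = complex_of_real (- nsq (b i j) / r)"
    unfolding c_def by (simp add: nsq_eq)
  also have "nsq c = nsq (b i j) / r\<^sup>2"
    unfolding c_def nsq_def by (simp add: norm_divide power_divide)
  finally have "0 \<le> Re (b i i) - nsq (b i j) / r" using r by (simp add: power2_eq_square)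
  then show ?thesis using r by (simp add: field_simps r_def)
qed

text \<open>The equality case of \<open>psd_minor\<close>: the minor of i and j vanishes, so e_i -
  cnj (b i j) e_j is a null vector, and \<open>psd_null\<close> makes row i a multiple of row
  j.\<close>

lemma psd_null2:
  assumes h: "herm b" and p: "\<And>v. qf n b v \<ge> 0" and i: "i < n" and j: "j < n"
    and e: "Re (b j j) = 1" "Re (b i i) = nsq (b i j)" and t: "t < n"
  shows "b i t = b i j * b j t"
proof -
  define c where "c = - cnj (b i j)"
  have z: "qf n b (\<lambda>k. unitv i k + c * unitv j k) = 0"
  proof -
    have "qf n b (\<lambda>k. unitv i k + c * unitv j k) = Re (b i i) + 2 * Re (c * b i j) + nsq c"
      unfolding qf_add_scale[OF h] using i j e by (simp add: qf_unitv ip_unitv matvec_unitv)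
    moreover have "c * b i j = complex_of_real (- nsq (b i j))"
      unfolding c_def by (simp add: nsq_eq)
    ultimately show ?thesis using e by (simp add: c_def del: mult_minus_left times_complex.sel)
  qed
  have "matvec n b (\<lambda>k. unitv i k + c * unitv j k) t = 0"
    by (rule psd_null[OF h p z t])
  then have "b t i = cnj (b i j) * b t j"
    unfolding matvec_add matvec_scale using i j by (simp add: matvec_unitv c_def)
  then show ?thesis using hermD[OF h, of t i] hermD[OF h, of t j] by (metis complex_cnj_cnj complex_cnj_mult)
qed

section \<open>Labels: the elements of norm at most 4 in the ring Z[sqrt(-2)]\<close>

lemma omega_facts [simp]: "\<omega> * \<omega> = -2" "cnj \<omega> = - \<omega>" "Re \<omega> = 0" "Im \<omega> = sqrt 2" "nsq \<omega> = 2" "\<omega> \<noteq> 0"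
proof -
  have w: "\<omega> = \<i> * complex_of_real (sqrt 2)"
    unfolding \<omega>_def using csqrt_of_real_nonpos[of "-2"] by simp
  have s: "complex_of_real (sqrt 2) * complex_of_real (sqrt 2) = 2"
    by (metis of_real_mult of_real_numeral real_sqrt_mult_self abs_numeral)
  show "\<omega> * \<omega> = -2" unfolding w using s by (simp add: algebra_simps)
  show "cnj \<omega> = - \<omega>" "Re \<omega> = 0" "Im \<omega> = sqrt 2" "nsq \<omega> = 2" "\<omega> \<noteq> 0"
    unfolding w by (simp_all add: nsq_def norm_mult)
qed

lemma omega_mult2 [simp]: "\<omega> * (\<omega> * z) = -2 * z"
  unfolding mult.assoc[symmetric] by simp

definition Lab :: "complex set" where
  "Lab = {0, 1, -1, \<omega>, -\<omega>, 1 + \<omega>, 1 - \<omega>, -1 + \<omega>, -1 - \<omega>, 2, -2}"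

lemma nsq_vals [simp]: "nsq 0 = 0" "nsq 1 = 1" "nsq (-1) = 1" "nsq 2 = 4" "nsq (-2) = 4"
  "nsq (1 + \<omega>) = 3" "nsq (1 - \<omega>) = 3" "nsq (-1 + \<omega>) = 3" "nsq (-1 - \<omega>) = 3"
  by (simp_all add: nsq_def cmod_def)

lemma Lab_cnj: "x \<in> Lab \<Longrightarrow> cnj x \<in> Lab" and Lab_minus: "x \<in> Lab \<Longrightarrow> - x \<in> Lab"
  unfolding Lab_def by (elim insertE emptyE; simp)+

definition conn :: "nat \<Rightarrow> (nat \<Rightarrow> nat \<Rightarrow> complex) \<Rightarrow> bool" where
  "conn n a \<longleftrightarrow> (\<forall>U. U \<subseteq> {..<n} \<longrightarrow> U \<noteq> {} \<longrightarrow> U \<noteq> {..<n} \<longrightarrow> (\<exists>i\<in>U. \<exists>j\<in>{..<n} - U. a i j \<noteq> 0))"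

section \<open>Weight conditions at one vertex and at pairs of vertices\<close>

locale cyc_graph =
  fixes n :: nat and a :: "nat \<Rightarrow> nat \<Rightarrow> complex"
  assumes herm: "herm a" and supp: "\<And>i j. a i j \<noteq> 0 \<Longrightarrow> i < n \<and> j < n"
    and diag: "\<And>i. a i i \<in> {0, 1, -1}" and lab: "\<And>i j. a i j \<in> Lab"
    and conn: "conn n a" and cyc: "cyc n a"
begin

lemma flip: "a j i = cnj (a i j)" by (rule hermD[OF herm])

lemma defect_psd: "qf n (defect n a) v \<ge> 0"
  using cyc_norm[OF herm cyc, of v] by (simp add: qf_cof[OF herm])

lemma sum_supp:
  assumes "finite F" "\<And>t. t \<notin> F \<Longrightarrow> g t = 0" "\<And>t. t \<ge> n \<Longrightarrow> g t = 0"
  shows "(\<Sum>t<n. g t) = (\<Sum>t\<in>F. g t)"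
proof -
  have "(\<Sum>t<n. g t) = (\<Sum>t\<in>{..<n} \<inter> F. g t)"
    using assms by (intro sum.mono_neutral_right) auto
  also have "\<dots> = (\<Sum>t\<in>F. g t)"
    using assms not_less by (intro sum.mono_neutral_left) blast+
  finally show ?thesis .
qed

lemma supp0: "i \<ge> n \<or> j \<ge> n \<Longrightarrow> a i j = 0"
  using supp[of i j] not_less by blast

lemma sq_eq: assumes "finite F" "\<And>t. t \<notin> F \<Longrightarrow> a i t = 0" shows "sq n a i l = (\<Sum>t\<in>F. a i t * a t l)"
  unfolding sq_def using assms by (intro sum_supp) (auto simp: supp0)

definition deg :: "nat \<Rightarrow> real" where "deg i = (\<Sum>t<n. nsq (a i t))"

lemma deg_eq: assumes "finite F" "\<And>t. t \<notin> F \<Longrightarrow> a i t = 0" shows "deg i = (\<Sum>t\<in>F. nsq (a i t))"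
  unfolding deg_def using assms by (intro sum_supp) (auto simp: supp0)

lemma deg_ge: assumes "finite F" shows "(\<Sum>t\<in>F. nsq (a i t)) \<le> deg i"
proof -
  have "(\<Sum>t\<in>F. nsq (a i t)) = (\<Sum>t\<in>F \<inter> {..<n}. nsq (a i t))"
    using assms supp by (intro sum.mono_neutral_right) auto
  also have "\<dots> \<le> deg i" unfolding deg_def using assms by (intro sum_mono2) auto
  finally show ?thesis .
qed

lemma sq_diag: "sq n a i i = complex_of_real (deg i)"
proof -
  have "a i t * a t i = complex_of_real (nsq (a i t))" for t
    using flip[of t i] by (simp add: nsq_eq mult.commute)
  then show ?thesis unfolding sq_def deg_def by simp
qed

lemma defect_diag: "Re (defect n a i i) = 4 - deg i"
  by (simp add: defect_def sq_diag)

lemma deg_le: "deg i \<le> 4"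
proof (cases "i < n")
  case True
  then show ?thesis using defect_psd[of "unitv i"] by (simp add: qf_unitv defect_diag)
next
  case False
  then show ?thesis by (simp add: deg_def supp0)
qed

lemma sum_le: "finite F \<Longrightarrow> (\<Sum>t\<in>F. nsq (a i t)) \<le> 4"
  using deg_ge deg_le order_trans by blast

lemma minor: "i \<noteq> l \<Longrightarrow> nsq (sq n a i l) \<le> (4 - deg i) * (4 - deg l)"
proof (cases "i < n \<and> l < n")
  case True
  assume "i \<noteq> l"
  then show ?thesis using psd_minor[OF herm_cof[OF herm] defect_psd, of i l] True
    by (simp add: defect_diag) (simp add: defect_def)
next
  case False
  then have "sq n a i l = 0" unfolding sq_def by (auto simp: supp0)
  then show ?thesis using deg_le[of i] deg_le[of l] by simp
qed

text \<open>\<open>F\<close> has to contain all neighbours of \<open>i\<close>, because the entry of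
  A^2 and the weight at \<open>i\<close> are computed exactly. For \<open>l\<close> any set
  \<open>G\<close> of neighbours will do, since it only enters through a lower bound for the total
  weight.\<close>

lemma minorF:
  assumes "i \<noteq> l" "finite F" "\<And>t. t \<notin> F \<Longrightarrow> a i t = 0" "finite G"
  shows "nsq (\<Sum>t\<in>F. a i t * a t l) \<le> (4 - (\<Sum>t\<in>F. nsq (a i t))) * (4 - (\<Sum>t\<in>G. nsq (a l t)))"
proof -
  have "nsq (sq n a i l) \<le> (4 - deg i) * (4 - deg l)" by (rule minor[OF assms(1)])
  also have "\<dots> \<le> (4 - deg i) * (4 - (\<Sum>t\<in>G. nsq (a l t)))"
    using deg_ge[OF assms(4), of l] deg_le[of i] by (intro mult_left_mono) auto
  finally show ?thesis using sq_eq[OF assms(2,3)] deg_eq[OF assms(2,3)] by simp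
qed

text \<open>The diagonal entry of 4 - A^2 at a saturated vertex is 0, so by \<open>minor\<close> its
  whole row is 0. The second conclusion is a linear relation between the rows of the neighbours, the
  main device for determining unknown entries.\<close>

lemma full:
  assumes "finite F" "(\<Sum>t\<in>F. nsq (a i t)) \<ge> 4"
  shows "t \<notin> F \<Longrightarrow> a i t = 0" "l \<noteq> i \<Longrightarrow> (\<Sum>t\<in>F. a i t * a t l) = 0"
proof -
  have z: "a i t = 0" if "t \<notin> F" for t
  proof -
    have "nsq (a i t) + (\<Sum>t\<in>F. nsq (a i t)) \<le> 4"
      using sum_le[of "insert t F" i] assms(1) that by simp
    then have "nsq (a i t) = 0" using assms(2) nsq_ge0[of "a i t"] by linarith
    then show ?thesis by simp
  qed
  show "t \<notin> F \<Longrightarrow> a i t = 0" by (rule z)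
  assume l: "l \<noteq> i"
  have "deg i = 4" using deg_le[of i] deg_eq[OF assms(1) z] assms(2) by linarith
  then have "nsq (sq n a i l) \<le> 0" using minor[of i l] l by auto
  then show "(\<Sum>t\<in>F. a i t * a t l) = 0"
    using sq_eq[OF assms(1) z] by (metis nsq_0 nsq_ge0 order_antisym)
qed

text \<open>Propagation from a vertex one short of saturation: the diagonal entry of 4 - A^2 at
  \<open>x\<close> is 1, and the hypothesis on the weights of \<open>q\<close> makes the minor of
  \<open>x\<close> and \<open>q\<close> vanish, so \<open>psd_null2\<close> applies. The minus sign
  is what remains of the signs of three off-diagonal entries of 4 - A^2.\<close>

lemma null2:
  assumes "finite F" "\<And>t. t \<notin> F \<Longrightarrow> a x t = 0" "finite G" "\<And>t. t \<notin> G \<Longrightarrow> a q t = 0"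
    and "(\<Sum>t\<in>F. nsq (a x t)) = 3" "x \<noteq> q"
    and "(\<Sum>t\<in>G. nsq (a q t)) = 4 - nsq (\<Sum>s\<in>G. a q s * a s x)" "t \<noteq> x" "t \<noteq> q"
    and "x < n" "q < n"
  shows "(\<Sum>s\<in>G. a q s * a s t) = - (\<Sum>s\<in>G. a q s * a s x) * (\<Sum>s\<in>F. a x s * a s t)"
proof (cases "t < n")
  case True
  have "defect n a q t = defect n a q x * defect n a x t"
  proof (rule psd_null2[OF herm_cof[OF herm] defect_psd])
    show "Re (defect n a x x) = 1" using assms(5) deg_eq[OF assms(1,2)] by (simp add: defect_diag)
    show "Re (defect n a q q) = nsq (defect n a q x)"
      using assms(6,7) deg_eq[OF assms(3,4)] sq_eq[OF assms(3,4)] by (simp add: defect_diag) (simp add: defect_def)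
  qed (use True assms in auto)
  then have "- (\<Sum>s\<in>G. a q s * a s t) = (\<Sum>s\<in>G. a q s * a s x) * (\<Sum>s\<in>F. a x s * a s t)"
    using assms by (simp add: defect_def sq_eq[OF assms(3,4)] sq_eq[OF assms(1,2)])
  then show ?thesis unfolding neg_eq_iff_add_eq_0 mult_minus_left eq_neg_iff_add_eq_0 .
next
  case False
  then show ?thesis by (simp add: supp0)
qed

lemma closed_eq:
  assumes "U \<subseteq> {..<n}" "U \<noteq> {}" "\<And>i t. i \<in> U \<Longrightarrow> t \<notin> U \<Longrightarrow> a i t = 0"
  shows "{..<n} = U"
  using conn assms unfolding conn_def by blast

end

section \<open>Reordering the vertices and switching their signs\<close>

lemma bij_sum: "bij_betw g {..<N::nat} {..<N} \<Longrightarrow> (\<Sum>i<N. h (g i)) = (\<Sum>i<N. h i)"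
  using sum.reindex_bij_betw[of g "{..<N}" "{..<N}" h] by simp

text \<open>Serves to bring an induced subgraph into the leading positions, where an extension has
  to keep the old graph. Entries outside the range are set to 0 because \<open>g\<close> is only
  controlled below \<open>N\<close>.\<close>

lemma cyc_graph_reindex:
  assumes S: "cyc_graph N S" and g: "bij_betw g {..<N} {..<N}"
  shows "cyc_graph N (\<lambda>i j. if i < N \<and> j < N then S (g i) (g j) else 0)" (is "cyc_graph N ?b")
proof -
  interpret S: cyc_graph N S by fact
  have inv: "\<exists>i<N. g i = k" if "k < N" for k
    using g that unfolding bij_betw_def by (metis imageE lessThan_iff)
  have gl: "g i < N" if "i < N" for i
    using g that unfolding bij_betw_def by auto
  show ?thesis
  proof
    show "herm ?b"
    proof (rule hermI)
      fix i j show "?b j i = cnj (?b i j)" using S.flip[of "g j" "g i"] by simp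
    qed
    show "\<And>i j. ?b i j \<noteq> 0 \<Longrightarrow> i < N \<and> j < N" by (auto split: if_splits)
    show "\<And>i. ?b i i \<in> {0, 1, - 1}" using S.diag by auto
    show "\<And>i j. ?b i j \<in> Lab" using S.lab by (auto simp: Lab_def)
    show "conn N ?b"
      unfolding conn_def
    proof (intro allI impI)
      fix U assume U: "U \<subseteq> {..<N}" "U \<noteq> {}" "U \<noteq> {..<N}"
      have "g ` U \<subseteq> {..<N}" using U gl by auto
      moreover have "g ` U \<noteq> {..<N}" using U g unfolding bij_betw_def
        by (metis inj_on_image_eq_iff order_refl)
      ultimately obtain i j where "i \<in> g ` U" "j \<in> {..<N} - g ` U" "S i j \<noteq> 0"
        using S.conn U unfolding conn_def by (metis image_is_empty)
      then obtain i' j' where "i' \<in> U" "i = g i'" "j' < N" "j = g j'" "j' \<notin> U" using inv[of j] by auto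
      then show "\<exists>i\<in>U. \<exists>j\<in>{..<N} - U. ?b i j \<noteq> 0" using \<open>S i j \<noteq> 0\<close> U by auto
    qed
    show "cyc N ?b"
      unfolding cyc_def
    proof
      fix v :: "nat \<Rightarrow> complex"
      define g' where "g' = inv_into {..<N} g"
      have gg: "g' (g i) = i" if "i < N" for i
        using g that unfolding g'_def bij_betw_def by (simp add: inv_into_f_f)
      define w where "w = (\<lambda>i. v (g' i))"
      have w: "w (g i) = v i" if "i < N" for i using that by (simp add: w_def gg)
      have ap: "matvec N ?b v i = matvec N S w (g i)" if "i < N" for i
      proof -
        have "matvec N ?b v i = (\<Sum>j<N. S (g i) (g j) * w (g j))"
          unfolding matvec_def using that w by (intro sum.cong) auto
        also have "\<dots> = matvec N S w (g i)" unfolding matvec_def by (rule bij_sum[OF g])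
        finally show ?thesis .
      qed
      have "ip N v (matvec N ?b v) = (\<Sum>i<N. cnj (w (g i)) * matvec N S w (g i))"
        unfolding ip_def using ap w by (intro sum.cong) auto
      also have "\<dots> = ip N w (matvec N S w)" unfolding ip_def by (rule bij_sum[OF g])
      finally have q: "qf N ?b v = qf N S w" unfolding qf_def by simp
      have "sqn N v = (\<Sum>i<N. nsq (w (g i)))"
        unfolding sqn_def using w by (intro sum.cong) auto
      also have "\<dots> = sqn N w" unfolding sqn_def by (rule bij_sum[OF g])
      finally show "\<bar>qf N ?b v\<bar> \<le> 2 * sqn N v" using q S.cyc[unfolded cyc_def] by simp
    qed
  qed
qed

definition switched :: "(nat \<Rightarrow> complex) \<Rightarrow> (nat \<Rightarrow> nat \<Rightarrow> complex) \<Rightarrow> nat \<Rightarrow> nat \<Rightarrow> complex" where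
  "switched s a i j = s i * s j * a i j"

lemma cyc_graph_sw:
  assumes "cyc_graph n a" and s: "\<And>i. s i \<in> {1, -1}"
  shows "cyc_graph n (switched s a)"
proof -
  interpret cyc_graph n a by fact
  have s2: "s i * s i = 1" "cnj (s i) = s i" "s i \<noteq> 0" "nsq (s i) = 1" for i
    using s[of i] by auto
  show ?thesis
  proof
    show "herm (switched s a)"
    proof (rule hermI)
      fix i j show "switched s a j i = cnj (switched s a i j)" using flip[of j i] by (simp add: switched_def s2)
    qed
    show "\<And>i j. switched s a i j \<noteq> 0 \<Longrightarrow> i < n \<and> j < n" using supp by (auto simp: switched_def)
    show "switched s a i i \<in> {0, 1, - 1}" for i using diag[of i] s[of i] by (auto simp: switched_def)
    show "switched s a i j \<in> Lab" for i j
      using lab[of i j] Lab_minus[of "a i j"] s[of i] s[of j] by (auto simp: switched_def)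
    show "conn n (switched s a)" using conn unfolding conn_def by (auto simp: switched_def s2)
    show "cyc n (switched s a)"
      unfolding cyc_def
    proof
      fix v
      define w where "w = (\<lambda>i. s i * v i)"
      have "matvec n (switched s a) v = (\<lambda>i. s i * matvec n a w i)"
        by (rule ext) (simp add: matvec_def switched_def w_def sum_distrib_left algebra_simps)
      then have "qf n (switched s a) v = qf n a w"
        unfolding qf_def ip_def by (simp add: w_def s2 algebra_simps)
      moreover have "sqn n v = sqn n w"
        unfolding sqn_def w_def by (simp add: nsq_mult s2)
      ultimately show "\<bar>qf n (switched s a) v\<bar> \<le> 2 * sqn n v"
        using cyc[unfolded cyc_def] by simp
    qed
  qed
qed

text \<open>Adding a multiple of the eigenvector clears the last coordinate of \<open>w\<close> without changing
  \<open>2 |w|\<^sup>2 - e qf w\<close>.\<close>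

lemma eigen_extend:
  fixes e :: real and v w :: "nat \<Rightarrow> complex"
  assumes h: "herm b" and v: "v n = 1" and ev: "\<And>i. i \<le> n \<Longrightarrow> matvec (Suc n) b v i = (2 * e) * v i"
    and e: "e = 1 \<or> e = -1"
    and low: "\<And>w. w n = 0 \<Longrightarrow> e * qf (Suc n) b w \<le> 2 * sqn (Suc n) w"
  shows "e * qf (Suc n) b w \<le> 2 * sqn (Suc n) w"
proof -
  let ?N = "Suc n"
  define u where "u = (\<lambda>i. w i + (- w n) * v i)"
  have un: "u n = 0" using v by (simp add: u_def)
  have ipv: "ip ?N x (matvec ?N b v) = (2 * e) * ip ?N x v" for x
    unfolding ip_def sum_distrib_left using ev by (intro sum.cong) (auto simp: less_Suc_eq_le)
  have w: "w = (\<lambda>i. u i + w n * v i)" by (simp add: u_def)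
  have qv: "qf ?N b v = 2 * e * sqn ?N v"
    unfolding qf_def ipv ip_self by simp
  have ee: "e * (e * r) = r" for r :: real using e by auto
  have "e * qf ?N b w = e * qf ?N b u + 2 * e * Re (w n * ip ?N u (matvec ?N b v)) + e * nsq (w n) * qf ?N b v"
    by (subst w, subst qf_add_scale[OF h]) (simp add: algebra_simps)
  also have "\<dots> = e * qf ?N b u + 2 * (2 * Re (w n * ip ?N u v) + nsq (w n) * sqn ?N v)"
  proof -
    have "Re (w n * (complex_of_real (2 * e) * ip ?N u v)) = 2 * e * Re (w n * ip ?N u v)"
      by (simp add: algebra_simps)
    then show ?thesis unfolding ipv qv by (simp add: algebra_simps ee)
  qed
  also have "\<dots> \<le> 2 * (sqn ?N u + 2 * Re (w n * ip ?N u v) + nsq (w n) * sqn ?N v)"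
    using low[of u] un by simp
  also have "\<dots> = 2 * sqn ?N w"
    by (subst (3) w, subst sqn_add_scale) simp
  finally show ?thesis .
qed

section \<open>Adding one vertex to a maximal graph\<close>

definition ext1 :: "nat \<Rightarrow> (nat \<Rightarrow> nat \<Rightarrow> complex) \<Rightarrow> (nat \<Rightarrow> complex) \<Rightarrow> complex \<Rightarrow> nat \<Rightarrow> nat \<Rightarrow> complex" where
  "ext1 n a b c i j = (if i = n then if j = n then c else b j else if j = n then cnj (b i) else a i j)"

lemma matvec_supp:
  assumes "finite F" "F \<subseteq> {..<N}" "\<And>j. j \<notin> F \<Longrightarrow> v j = 0"
  shows "matvec N b v i = (\<Sum>j\<in>F. b i j * v j)"
  unfolding matvec_def using assms by (intro sum.mono_neutral_right) auto

text \<open>New vertices are always appended at the end: \<open>a\<close> has to be the leading principal submatrix of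
  an extension.\<close>

locale max_graph = cyc_graph +
  assumes maxi: "\<And>N a'. cyc_graph N a' \<Longrightarrow> n < N \<Longrightarrow> (\<And>i j. i < n \<Longrightarrow> j < n \<Longrightarrow> a' i j = a i j) \<Longrightarrow> False"
begin

lemma no_extension:
  assumes bl: "\<And>j. b j \<in> Lab" and bn: "\<And>j. b j \<noteq> 0 \<Longrightarrow> j < n" and b0: "b k \<noteq> 0" and c: "c \<in> {0, 1, -1}"
    and v: "v n = 1" "\<And>i. i \<le> n \<Longrightarrow> matvec (Suc n) (ext1 n a b c) v i = 2 * v i"
    and u: "u n = 1" "\<And>i. i \<le> n \<Longrightarrow> matvec (Suc n) (ext1 n a b c) u i = - 2 * u i"
  shows False
proof (rule maxi)
  let ?e = "ext1 n a b c"
  have an: "a n j = 0" "a j n = 0" for j using supp0 by auto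
  show h: "cyc_graph (Suc n) ?e"
  proof
    show h: "herm ?e"
    proof (rule hermI)
      fix i j show "?e j i = cnj (?e i j)"
        using flip[of j i] c by (auto simp: ext1_def)
    qed
    show "\<And>i j. ?e i j \<noteq> 0 \<Longrightarrow> i < Suc n \<and> j < Suc n"
      using supp bn by (auto simp: ext1_def less_Suc_eq split: if_splits)
    show "\<And>i. ?e i i \<in> {0, 1, - 1}" using diag c by (auto simp: ext1_def)
    show "\<And>i j. ?e i j \<in> Lab" using lab bl Lab_cnj c by (auto simp: ext1_def) (auto simp: Lab_def)
    show "conn (Suc n) ?e"
      unfolding conn_def
    proof (intro allI impI)
      fix U assume U: "U \<subseteq> {..<Suc n}" "U \<noteq> {}" "U \<noteq> {..<Suc n}"
      have kn: "k < n" using bn b0 by auto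
      let ?U = "U \<inter> {..<n}"
      consider "?U = {}" | "?U = {..<n}" | "?U \<noteq> {}" "?U \<noteq> {..<n}" by blast
      then show "\<exists>i\<in>U. \<exists>j\<in>{..<Suc n} - U. ?e i j \<noteq> 0"
      proof cases
        case 1
        then have "n \<in> U" "k \<notin> U" using U kn by (auto simp: lessThan_Suc)
        then show ?thesis using kn b0 by (intro bexI[of _ n] bexI[of _ k]) (auto simp: ext1_def)
      next
        case 2
        then have "n \<notin> U" "k \<in> U" using U kn by (auto simp: lessThan_Suc)
        then show ?thesis using kn b0 by (intro bexI[of _ k] bexI[of _ n]) (auto simp: ext1_def)
      next
        case 3
        then obtain i j where "i \<in> ?U" "j \<in> {..<n} - ?U" "a i j \<noteq> 0"
          using conn unfolding conn_def by (metis inf_le2)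
        then show ?thesis by (intro bexI[of _ i] bexI[of _ j]) (auto simp: ext1_def)
      qed
    qed
    \<comment> \<open>On vectors that vanish at the new vertex the extended form is the old one, so
      both bounds come from \<open>cyc\<close>; the two eigenvectors then remove the
      restriction.\<close>
    have low: "\<bar>qf (Suc n) ?e w\<bar> \<le> 2 * sqn (Suc n) w" if "w n = 0" for w
    proof -
      have "matvec (Suc n) ?e w i = matvec n a w i" if "i < n" for i
        unfolding matvec_def using that \<open>w n = 0\<close> by (simp add: ext1_def)
      then have "qf (Suc n) ?e w = qf n a w"
        unfolding qf_def ip_def using \<open>w n = 0\<close> by simp
      moreover have "sqn (Suc n) w = sqn n w" unfolding sqn_def using \<open>w n = 0\<close> by simp
      ultimately show ?thesis using cyc[unfolded cyc_def] by simp
    qed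
    have "1 * qf (Suc n) ?e w \<le> 2 * sqn (Suc n) w" for w
      by (rule eigen_extend[of ?e v n 1 w]) (use h v low in \<open>auto simp: abs_le_iff\<close>)
    moreover have "(-1) * qf (Suc n) ?e w \<le> 2 * sqn (Suc n) w" for w
      by (rule eigen_extend[of ?e u n "-1" w]) (use h u low in \<open>auto simp: abs_le_iff\<close>)
    ultimately show "cyc (Suc n) ?e" unfolding cyc_def by (auto simp: abs_le_iff)
  qed
qed (auto simp: ext1_def)

text \<open>The next three extensions come from Gram vectors of \<open>A + 2I\<close>: with \<open>p = \<omega> e\<^sub>1\<close> and
  \<open>x = e\<^sub>1 + e\<^sub>2\<close> the new vertex is \<open>e\<^sub>1 - e\<^sub>2\<close>; with \<open>x = e\<^sub>1 + e\<^sub>2\<close>, \<open>y = e\<^sub>1 - e\<^sub>2\<close>,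
  \<open>z = e\<^sub>2 + e\<^sub>3\<close> it is \<open>e\<^sub>2 - e\<^sub>3\<close>; with the same \<open>x\<close> and \<open>y\<close> alone it is \<open>\<omega> e\<^sub>2\<close>.\<close>

lemma no_ext_leaf:
  assumes px: "a p x = \<omega>" "p \<noteq> x" and p0: "\<And>t. t \<noteq> x \<Longrightarrow> a p t = 0"
  shows False
proof -
  have pn: "p < n" "x < n" using supp[of p x] px by auto
  \<comment> \<open>The new vertex is a copy of \<open>x\<close> that agrees with it at
    \<open>p\<close> and has the opposite sign elsewhere. A charge of \<open>x\<close> is covered by
    giving e_2 the squared length 1 + a x x: it reappears as the charge of the new vertex and,
    negated, as the label between the two.\<close>
  define b where "b = (\<lambda>l. if l = p then - \<omega> else - a x l)"
  \<comment> \<open>\<open>V (-1)\<close> lies in the kernel of A + 2I and expresses, up to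
    conjugation, the linear dependence of the Gram vectors of \<open>p\<close>, \<open>x\<close> and
    the new vertex; changing the sign at \<open>p\<close> gives the eigenvector for 2.\<close>
  define V where "V = (\<lambda>e::complex. \<lambda>i. if i = p then e * \<omega> else if i = x \<or> i = n then 1 else 0)"
  have xp: "a x p = - \<omega>" using flip[of x p] px by simp
  have tp: "a t p = 0" if "t \<noteq> x" for t using flip[of t p] p0[OF that] by simp
  have xx: "cnj (a x x) = a x x" using diag[of x] by auto
  have ev: "matvec (Suc n) (ext1 n a b (a x x)) (V e) i = 2 * e * V e i" if "i \<le> n" "e = 1 \<or> e = -1" for e i
  proof -
    have "matvec (Suc n) (ext1 n a b (a x x)) (V e) i = (\<Sum>j\<in>{p, x, n}. ext1 n a b (a x x) i j * V e j)"
      by (rule matvec_supp) (use pn in \<open>auto simp: V_def\<close>)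
    also have "\<dots> = ext1 n a b (a x x) i p * e * \<omega> + ext1 n a b (a x x) i x + ext1 n a b (a x x) i n"
      using pn px by (simp add: V_def)
    also have "\<dots> = 2 * e * V e i"
    proof -
      have cx: "cnj (a x i) = a i x" using flip[of i x] by simp
      consider "i = n" | "i = p" | "i = x" | "i \<noteq> n" "i \<noteq> p" "i \<noteq> x" by blast
      then show ?thesis
        by cases (use pn px xp tp xx cx that p0 in \<open>auto simp: ext1_def b_def V_def algebra_simps\<close>)
    qed
    finally show ?thesis .
  qed
  show False
  proof (rule no_extension[of b p "a x x" "V 1" "V (-1)"])
    show "b j \<in> Lab" for j using lab[of x j] Lab_minus by (auto simp: b_def Lab_def)
    show "\<And>j. b j \<noteq> 0 \<Longrightarrow> j < n" using pn supp by (auto simp: b_def split: if_splits)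
    show "b p \<noteq> 0" by (simp add: b_def)
    show "a x x \<in> {0, 1, - 1}" by (rule diag)
    show "V 1 n = 1" "V (-1) n = 1" using pn by (auto simp: V_def)
    show "\<And>i. i \<le> n \<Longrightarrow> matvec (Suc n) (ext1 n a b (a x x)) (V 1) i = 2 * V 1 i" using ev[of _ 1] by simp
    show "\<And>i. i \<le> n \<Longrightarrow> matvec (Suc n) (ext1 n a b (a x x)) (V (-1)) i = - 2 * V (-1) i" using ev[of _ "-1"] by simp
  qed
qed

lemma no_ext_twin:
  assumes d: "x \<noteq> y" "x \<noteq> z" "y \<noteq> z" and u: "a x x = 0" "a y y = 0" "a x y = 0"
    and s: "\<And>l. l \<noteq> z \<Longrightarrow> l \<noteq> x \<Longrightarrow> l \<noteq> y \<Longrightarrow> a x l = a y l" and xz: "a x z = 1" "a y z = -1"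
  shows False
proof -
  have pn: "x < n" "y < n" "z < n" using supp[of x z] supp[of y z] xz by auto
  define c where "c = a z z"
  define b where "b = (\<lambda>l. if l = x then 1 else if l = y then -1 else - a z l)"
  \<comment> \<open>The dependence behind \<open>V (-1)\<close> is that x - y and the sum of z and
    the new vector both equal 2 e_2; for the eigenvalue 2 the signs at \<open>x\<close> and
    \<open>y\<close> change.\<close>
  define V where "V = (\<lambda>e::complex. \<lambda>i. if i = x then e else if i = y then -e else if i = z \<or> i = n then 1 else 0)"
  have f: "a z x = 1" "a z y = -1" "a y x = 0" using flip[of z x] flip[of z y] flip[of y x] xz u by auto
  have zz: "cnj c = c" using diag[of z] by (auto simp: c_def)
  have s': "a l x = a l y" if "l \<noteq> z" "l \<noteq> x" "l \<noteq> y" for l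
    using s[OF that] flip[of l x] flip[of l y] by simp
  have ev: "matvec (Suc n) (ext1 n a b c) (V e) i = 2 * e * V e i" if "i \<le> n" "e = 1 \<or> e = -1" for e i
  proof -
    have "matvec (Suc n) (ext1 n a b c) (V e) i = (\<Sum>j\<in>{x, y, z, n}. ext1 n a b c i j * V e j)"
      by (rule matvec_supp) (use pn in \<open>auto simp: V_def\<close>)
    also have "\<dots> = ext1 n a b c i x * e - ext1 n a b c i y * e + ext1 n a b c i z + ext1 n a b c i n"
      using pn d by (simp add: V_def)
    also have "\<dots> = 2 * e * V e i"
    proof -
      have cx: "cnj (a z i) = a i z" using flip[of i z] by simp
      consider "i = n" | "i = x" | "i = y" | "i = z" | "i \<noteq> n" "i \<noteq> x" "i \<noteq> y" "i \<noteq> z" by blast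
      then show ?thesis
        by cases (use pn d f u xz zz cx that s'[of i] in \<open>auto simp: ext1_def b_def V_def c_def algebra_simps\<close>)
    qed
    finally show ?thesis .
  qed
  show False
  proof (rule no_extension[of b x c "V 1" "V (-1)"])
    show "b j \<in> Lab" for j using lab[of z j] Lab_minus by (auto simp: b_def Lab_def)
    show "\<And>j. b j \<noteq> 0 \<Longrightarrow> j < n" using pn supp by (auto simp: b_def split: if_splits)
    show "b x \<noteq> 0" by (simp add: b_def)
    show "c \<in> {0, 1, - 1}" unfolding c_def by (rule diag)
    show "V 1 n = 1" "V (-1) n = 1" using pn by (auto simp: V_def)
    show "\<And>i. i \<le> n \<Longrightarrow> matvec (Suc n) (ext1 n a b c) (V 1) i = 2 * V 1 i" using ev[of _ 1] by simp
    show "\<And>i. i \<le> n \<Longrightarrow> matvec (Suc n) (ext1 n a b c) (V (-1)) i = - 2 * V (-1) i" using ev[of _ "-1"] by simp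
  qed
qed

lemma no_ext_cap:
  assumes d: "x \<noteq> y" "x < n" "y < n" and u: "a x x = 0" "a y y = 0" "a x y = 0"
    and s: "\<And>l. l \<noteq> x \<Longrightarrow> l \<noteq> y \<Longrightarrow> a x l = a y l"
  shows False
proof -
  define b where "b = (\<lambda>l. if l = x then \<omega> else if l = y then -\<omega> else 0)"
  \<comment> \<open>Here the new Gram vector is \<omega> / 2 times x - y, which accounts for the
    coefficients.\<close>
  define V where "V = (\<lambda>e::complex. \<lambda>i. if i = x then -e * \<omega> / 2 else if i = y then e * \<omega> / 2 else if i = n then 1 else 0)"
  have f: "a y x = 0" using flip[of y x] u by auto
  have s': "a l x = a l y" if "l \<noteq> x" "l \<noteq> y" for l
    using s[OF that] flip[of l x] flip[of l y] by simp
  have ev: "matvec (Suc n) (ext1 n a b 0) (V e) i = 2 * e * V e i" if "i \<le> n" "e = 1 \<or> e = -1" for e i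
  proof -
    have "matvec (Suc n) (ext1 n a b 0) (V e) i = (\<Sum>j\<in>{x, y, n}. ext1 n a b 0 i j * V e j)"
      by (rule matvec_supp) (use d in \<open>auto simp: V_def\<close>)
    also have "\<dots> = ext1 n a b 0 i x * (-e * \<omega> / 2) + ext1 n a b 0 i y * (e * \<omega> / 2) + ext1 n a b 0 i n"
      using d by (simp add: V_def)
    also have "\<dots> = 2 * e * V e i"
    proof -
      consider "i = n" | "i = x" | "i = y" | "i \<noteq> n" "i \<noteq> x" "i \<noteq> y" by blast
      then show ?thesis
        by cases (use d f u that s'[of i] in \<open>auto simp: ext1_def b_def V_def algebra_simps\<close>)
    qed
    finally show ?thesis .
  qed
  show False
  proof (rule no_extension[of b x 0 "V 1" "V (-1)"])
    show "b j \<in> Lab" for j by (auto simp: b_def Lab_def)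
    show "\<And>j. b j \<noteq> 0 \<Longrightarrow> j < n" using d by (auto simp: b_def split: if_splits)
    show "b x \<noteq> 0" by (simp add: b_def)
    show "(0::complex) \<in> {0, 1, - 1}" by simp
    show "V 1 n = 1" "V (-1) n = 1" using d by (auto simp: V_def)
    show "\<And>i. i \<le> n \<Longrightarrow> matvec (Suc n) (ext1 n a b 0) (V 1) i = 2 * V 1 i" using ev[of _ 1] by simp
    show "\<And>i. i \<le> n \<Longrightarrow> matvec (Suc n) (ext1 n a b 0) (V (-1)) i = - 2 * V (-1) i" using ev[of _ "-1"] by simp
  qed
qed

text \<open>If the image were proper, \<open>f\<close> would extend to a permutation of the vertices
  of \<open>S\<close>, and reindexing \<open>S\<close> by it would give a strictly larger cyclotomic
  graph with \<open>a\<close> as its leading block.\<close>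

lemma embed:
  assumes S: "cyc_graph N S" and f: "inj_on f {..<n}" "f ` {..<n} \<subseteq> {..<N}"
    and e: "\<And>i j. i < n \<Longrightarrow> j < n \<Longrightarrow> a i j = S (f i) (f j)"
  shows "n = N" "bij_betw f {..<n} {..<N}"
proof -
  have cf: "card (f ` {..<n}) = n" using f(1) by (simp add: card_image)
  have le: "n \<le> N" using card_mono[OF _ f(2)] cf by simp
  show "n = N"
  proof (rule ccontr)
    assume "n \<noteq> N"
    then have lt: "n < N" using le by simp
    have "card {n..<N} = card ({..<N} - f ` {..<n})"
      using f(2) cf by (simp add: card_Diff_subset)
    then obtain h where h: "bij_betw h {n..<N} ({..<N} - f ` {..<n})"
      using finite_same_card_bij[of "{n..<N}" "{..<N} - f ` {..<n}"] by auto
    define g where "g = (\<lambda>i. if i < n then f i else h i)"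
    have g1: "bij_betw g {..<n} (f ` {..<n})"
      using f(1) unfolding bij_betw_def g_def by (auto simp: inj_on_def)
    have g2: "bij_betw g {n..<N} ({..<N} - f ` {..<n})"
      using h by (subst bij_betw_cong[of _ _ h]) (auto simp: g_def)
    have "bij_betw g ({..<n} \<union> {n..<N}) (f ` {..<n} \<union> ({..<N} - f ` {..<n}))"
      by (rule bij_betw_combine[OF g1 g2]) auto
    moreover have "{..<n} \<union> {n..<N} = {..<N}" using le by auto
    moreover have "f ` {..<n} \<union> ({..<N} - f ` {..<n}) = {..<N}" using f(2) by auto
    ultimately have g: "bij_betw g {..<N} {..<N}" by simp
    show False
      by (rule maxi[OF cyc_graph_reindex[OF S g] lt]) (use e lt in \<open>auto simp: g_def\<close>)
  qed
  then have "f ` {..<n} = {..<N}" using f(2) cf by (intro card_subset_eq) auto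
  then show "bij_betw f {..<n} {..<N}" using f(1) by (simp add: bij_betw_def)
qed

end

lemma max_graph_sw:
  assumes "max_graph n a" and s: "\<And>i. s i \<in> {1, -1}"
  shows "max_graph n (switched s a)"
proof -
  interpret max_graph n a by fact
  interpret b: cyc_graph n "switched s a" by (rule cyc_graph_sw[OF cyc_graph_axioms s])
  show ?thesis
  proof
    fix N a' assume a': "cyc_graph N a'" "n < N" "\<And>i j. i < n \<Longrightarrow> j < n \<Longrightarrow> a' i j = switched s a i j"
    have ss: "s i * (s i * z) = z" for i z using s[of i] by auto
    show False
    proof (rule maxi[OF cyc_graph_sw[OF a'(1) s] a'(2)])
      show "switched s a' i j = a i j" if "i < n" "j < n" for i j
        using a'(3)[OF that] by (simp add: switched_def ss mult.assoc mult.left_commute[of "s j"])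
    qed
  qed
qed

section \<open>Equivalence up to vertex order, switching and a global sign\<close>

definition equiv_to :: "nat \<Rightarrow> (nat \<Rightarrow> nat \<Rightarrow> complex) \<Rightarrow> complex mat \<Rightarrow> bool" where
  "equiv_to n a T \<longleftrightarrow> T \<in> carrier_mat n n \<and>
     (\<exists>f s. \<exists>e \<in> {1, -1}. bij_betw f {..<n} {..<n} \<and> (\<forall>i. s i \<in> {1, -1}) \<and>
        (\<forall>i<n. \<forall>j<n. T $$ (i, j) = s i * s j * (e * a (f i) (f j))))"

definition targets :: "complex mat set" where
  "targets = {S2, S2', S4', S4, S4_star, S8_star} \<union> {T4 k | k. k \<ge> 2} \<union> {C2_plus k | k. k \<ge> 1}"

definition listed :: "nat \<Rightarrow> (nat \<Rightarrow> nat \<Rightarrow> complex) \<Rightarrow> bool" where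
  "listed n a \<longleftrightarrow> (\<exists>T \<in> targets. equiv_to n a T)"

lemma listed_sw:
  assumes "listed n (switched s a)" and s: "\<And>i. s i \<in> {1, -1}"
  shows "listed n a"
proof -
  obtain T f s' e where T: "T \<in> targets" "T \<in> carrier_mat n n" "e \<in> {1,-1}" "bij_betw f {..<n} {..<n}"
    "\<forall>i. s' i \<in> {1,-1}" "\<forall>i<n. \<forall>j<n. T $$ (i, j) = s' i * s' j * (e * switched s a (f i) (f j))"
    using assms(1) unfolding listed_def equiv_to_def by blast
  define t where "t = (\<lambda>i. s' i * s (f i))"
  have "t i \<in> {1,-1}" for i
  proof -
    have "s' i \<in> {1,-1}" using T(5) by blast
    then show ?thesis using s[of "f i"] unfolding t_def by auto
  qed
  moreover have "\<forall>i<n. \<forall>j<n. T $$ (i, j) = t i * t j * (e * a (f i) (f j))"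
    using T(6) by (simp add: t_def switched_def mult_ac)
  ultimately have "equiv_to n a T" unfolding equiv_to_def using T(2,3,4) by blast
  then show ?thesis unfolding listed_def using T(1) by blast
qed

text \<open>Extending by 0 outside the matrix lets the sums over neighbours range over arbitrary finite sets.\<close>

definition entry :: "complex mat \<Rightarrow> nat \<Rightarrow> nat \<Rightarrow> complex" where
  "entry A i j = (if i < dim_row A \<and> j < dim_row A then A $$ (i, j) else 0)"

lemma (in max_graph) embed_listed:
  assumes T: "T \<in> targets" "T \<in> carrier_mat N N" "cyc_graph N (entry T)"
    and f: "inj_on f {..<n}" "f ` {..<n} \<subseteq> {..<N}"
    and e: "\<And>i j. i < n \<Longrightarrow> j < n \<Longrightarrow> a i j = entry T (f i) (f j)"
  shows "listed n a"
proof -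
  note nN = embed[OF T(3) f e]
  \<comment> \<open>\<open>equiv_to\<close> reads off the vertices in the order of the target, so
    the embedding has to be inverted.\<close>
  define g where "g = inv_into {..<n} f"
  have bf: "bij_betw f {..<n} {..<n}" using nN by simp
  have g: "bij_betw g {..<n} {..<n}" unfolding g_def using bf by (rule bij_betw_inv_into)
  have fg: "f (g i) = i" "g i < n" if "i < n" for i
    using bf g that unfolding g_def bij_betw_def by (auto simp: f_inv_into_f)
  have "T $$ (i, j) = 1 * 1 * (1 * a (g i) (g j))" if "i < n" "j < n" for i j
    using e[of "g i" "g j"] fg that T(2) nN(1) by (simp add: entry_def)
  then have "equiv_to n a T" unfolding equiv_to_def using T(2) nN(1) g by (intro conjI exI[of _ g] exI[of _ "\<lambda>_. 1"] bexI[of _ 1]) auto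
  then show ?thesis unfolding listed_def using T(1) by blast
qed

section \<open>The finite maximal graphs\<close>

text \<open>If T^2 = 4 then 0 \<le> |2v + Tv|^2 = 8 |v|^2 + 4 <v, Tv>, and the same with Tv negated
  gives the other half of \<open>cyc\<close>. The last assumption provides a spanning tree: every
  vertex but 0 has an earlier neighbour.\<close>

lemma cyc_graph_of_square:
  assumes T: "T \<in> carrier_mat N N" and h: "\<And>i j. i < N \<Longrightarrow> j < N \<Longrightarrow> entry T j i = cnj (entry T i j)"
    and d: "\<And>i. i < N \<Longrightarrow> entry T i i \<in> {0, 1, -1}" and l: "\<And>i j. i < N \<Longrightarrow> j < N \<Longrightarrow> entry T i j \<in> Lab"
    and s: "\<And>i j. i < N \<Longrightarrow> j < N \<Longrightarrow> (\<Sum>t<N. entry T i t * entry T t j) = (if i = j then 4 else 0)"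
    and c: "\<And>i. i < N \<Longrightarrow> i \<noteq> 0 \<Longrightarrow> \<exists>k<i. entry T k i \<noteq> 0"
  shows "cyc_graph N (entry T)"
proof
  have z: "entry T i j = 0" if "\<not> (i < N \<and> j < N)" for i j using T that by (auto simp: entry_def)
  have hf: "entry T j i = cnj (entry T i j)" for i j
    using h[of i j] z[of i j] z[of j i] by (cases "i < N \<and> j < N") auto
  show herm: "herm (entry T)" by (rule hermI, rule hf)
  show "\<And>i j. entry T i j \<noteq> 0 \<Longrightarrow> i < N \<and> j < N" using z by blast
  show "entry T i i \<in> {0, 1, -1}" for i using d[of i] z[of i i] by (cases "i < N") auto
  show "entry T i j \<in> Lab" for i j
    using l[of i j] z[of i j] by (cases "i < N \<and> j < N") (auto simp: Lab_def)
  show "conn N (entry T)"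
    unfolding conn_def
  proof (intro allI impI, rule ccontr)
    fix U assume U: "U \<subseteq> {..<N}" "U \<noteq> {}" "U \<noteq> {..<N}" and no: "\<not> (\<exists>i\<in>U. \<exists>j\<in>{..<N} - U. entry T i j \<noteq> 0)"
    have e: "(i \<in> U) = (j \<in> U)" if "entry T i j \<noteq> 0" for i j
    proof -
      have "i < N" "j < N" "entry T j i \<noteq> 0" using that z[of i j] hf[of j i] by auto
      then show ?thesis using no that by blast
    qed
    have "(i \<in> U) = (0 \<in> U)" if "i < N" for i
      using that
    proof (induction i rule: less_induct)
      case (less i)
      show ?case
      proof (cases "i = 0")
        case False
        then obtain k where "k < i" "entry T k i \<noteq> 0" using c less.prems by blast
        then show ?thesis using less.IH[of k] less.prems e[of k i] by simp
      qed simp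
    qed
    then show False using U by blast
  qed
  show "cyc N (entry T)"
    unfolding cyc_def
  proof
    fix v
    define w where "w = matvec N (entry T) v"
    define u where "u = (\<lambda>i. 2 * v i)"
    have "defect N (entry T) i j = 0" if "i < N" "j < N" for i j
      using s[OF that] by (simp add: defect_def sq_def)
    then have "matvec N (defect N (entry T)) v i = 0" if "i < N" for i
      using that by (simp add: matvec_def)
    then have "qf N (defect N (entry T)) v = 0" by (simp add: qf_def ip_def)
    then have w: "sqn N w = 4 * sqn N v" using qf_cof[OF herm, of N v] w_def by simp
    have su: "sqn N u = 4 * sqn N v" unfolding u_def sqn_scale by simp
    have i: "Re (ip N u w) = 2 * qf N (entry T) v"
      unfolding u_def ip_scale w_def qf_def by simp
    have "0 \<le> sqn N (\<lambda>i. u i + 1 * w i)" "0 \<le> sqn N (\<lambda>i. u i + (-1) * w i)" by (rule sqn_ge0)+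
    then show "\<bar>qf N (entry T) v\<bar> \<le> 2 * sqn N v"
      unfolding sqn_add_scale using w su i by (simp add: abs_le_iff)
  qed
qed

lemma less_4: "i < (4::nat) \<longleftrightarrow> i = 0 \<or> i = 1 \<or> i = 2 \<or> i = 3" by auto
lemma less_8: "i < (8::nat) \<longleftrightarrow> i = 0 \<or> i = 1 \<or> i = 2 \<or> i = 3 \<or> i = 4 \<or> i = 5 \<or> i = 6 \<or> i = 7" by auto

lemmas graph_simps = entry_def graph_matrix_def lookup_def

lemma S4'_table: "i < 4 \<Longrightarrow> j < 4 \<Longrightarrow> entry S4' i j =
  [[0, 1 + \<omega>, 1, 0], [1 - \<omega>, 0, 0, 1], [1, 0, 0, -1 - \<omega>], [0, 1, -1 + \<omega>, 0]] ! i ! j"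
  unfolding less_4 by (elim disjE; simp add: S4'_def graph_simps \<alpha>_def)

lemma S4_table: "i < 4 \<Longrightarrow> j < 4 \<Longrightarrow> entry S4 i j =
  [[1, \<omega>, 1, 0], [-\<omega>, -1, 0, 1], [1, 0, -1, -\<omega>], [0, 1, \<omega>, 1]] ! i ! j"
  unfolding less_4 by (elim disjE; simp add: S4_def graph_simps)

lemma S4_star_table: "i < 4 \<Longrightarrow> j < 4 \<Longrightarrow> entry S4_star i j =
  [[0, \<omega>, 1, 1], [-\<omega>, 0, -1, 1], [1, -1, 0, -\<omega>], [1, 1, \<omega>, 0]] ! i ! j"
  unfolding less_4 by (elim disjE; simp add: S4_star_def graph_simps)

lemma S8_star_table: "i < 8 \<Longrightarrow> j < 8 \<Longrightarrow> entry S8_star i j =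
  [[0, 1, 0, \<omega>, 1, 0, 0, 0],
   [1, 0, -\<omega>, 0, 0, 1, 0, 0],
   [0, \<omega>, 0, 1, 0, 0, 1, 0],
   [-\<omega>, 0, 1, 0, 0, 0, 0, 1],
   [1, 0, 0, 0, 0, -1, 0, -\<omega>],
   [0, 1, 0, 0, -1, 0, \<omega>, 0],
   [0, 0, 1, 0, 0, -\<omega>, 0, -1],
   [0, 0, 0, 1, \<omega>, 0, -1, 0]] ! i ! j"
  unfolding less_8 by (elim disjE; simp add: S8_star_def graph_simps)

lemma sum_less_4: "(\<Sum>t<4. g t) = g 0 + g 1 + g 2 + (g 3 :: complex)" for g :: "nat \<Rightarrow> complex"
  by (simp add: eval_nat_numeral)

lemma sum_less_8: "(\<Sum>t<8. g t) = g 0 + g 1 + g 2 + g 3 + g 4 + g 5 + g 6 + (g 7 :: complex)" for g :: "nat \<Rightarrow> complex"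
  by (simp add: eval_nat_numeral)

lemma cyc_graph_S4': "S4' \<in> carrier_mat 4 4" "cyc_graph 4 (entry S4')"
proof -
  show c: "S4' \<in> carrier_mat 4 4" by (simp add: S4'_def graph_matrix_def)
  show "cyc_graph 4 (entry S4')"
  proof (rule cyc_graph_of_square[OF c])
    show "\<exists>k<i. entry S4' k i \<noteq> 0" if "i < 4" "i \<noteq> 0" for i
      using that unfolding less_4
      by (elim disjE) (auto intro: exI[of _ 0] exI[of _ 1] simp: S4'_table complex_eq_iff)
  qed (unfold less_4 sum_less_4, (elim disjE; simp add: S4'_table Lab_def algebra_simps)+)
qed

lemma cyc_graph_S4: "S4 \<in> carrier_mat 4 4" "cyc_graph 4 (entry S4)"
proof -
  show c: "S4 \<in> carrier_mat 4 4" by (simp add: S4_def graph_matrix_def)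
  show "cyc_graph 4 (entry S4)"
  proof (rule cyc_graph_of_square[OF c])
    show "\<exists>k<i. entry S4 k i \<noteq> 0" if "i < 4" "i \<noteq> 0" for i
      using that unfolding less_4
      by (elim disjE) (auto intro: exI[of _ 0] exI[of _ 1] simp: S4_table)
  qed (unfold less_4 sum_less_4, (elim disjE; simp add: S4_table Lab_def algebra_simps)+)
qed

lemma cyc_graph_S4_star: "S4_star \<in> carrier_mat 4 4" "cyc_graph 4 (entry S4_star)"
proof -
  show c: "S4_star \<in> carrier_mat 4 4" by (simp add: S4_star_def graph_matrix_def)
  show "cyc_graph 4 (entry S4_star)"
  proof (rule cyc_graph_of_square[OF c])
    show "\<exists>k<i. entry S4_star k i \<noteq> 0" if "i < 4" "i \<noteq> 0" for i
      using that unfolding less_4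
      by (elim disjE) (auto intro: exI[of _ 0] exI[of _ 1] simp: S4_star_table)
  qed (unfold less_4 sum_less_4, (elim disjE; simp add: S4_star_table Lab_def algebra_simps)+)
qed

lemma cyc_graph_S8_star: "S8_star \<in> carrier_mat 8 8" "cyc_graph 8 (entry S8_star)"
proof -
  show c: "S8_star \<in> carrier_mat 8 8" by (simp add: S8_star_def graph_matrix_def)
  show "cyc_graph 8 (entry S8_star)"
  proof (rule cyc_graph_of_square[OF c])
    show "\<exists>k<i. entry S8_star k i \<noteq> 0" if "i < 8" "i \<noteq> 0" for i
      using that unfolding less_8
      by (elim disjE) (auto intro: exI[of _ 0] exI[of _ 1] exI[of _ 2] exI[of _ 3] simp: S8_star_table)
  qed (unfold less_8 sum_less_8, (elim disjE; simp add: S8_star_table Lab_def)+)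
qed

section \<open>The labels\<close>

text \<open>\<open>I\<^sub>k = Im (x\<^sup>k) / Im x\<close> satisfies a linear recurrence, and if \<open>t = r / s\<close> in lowest terms then
  \<open>s\<^sup>k I\<^sub>k\<^sub>+\<^sub>1\<close> is an integer congruent to \<open>r\<^sup>k\<close> modulo \<open>s\<close>. A monic integral relation of degree
  \<open>d\<close> for \<open>x\<close> therefore makes \<open>s\<close> divide \<open>r\<^sup>d\<^sup>-\<^sup>1\<close>.\<close>

lemma quadratic_trace_int:
  fixes x :: complex and t :: rat and m :: int
  assumes ai: "algebraic_int x" and im: "Im x \<noteq> 0" and q: "x * x = of_rat t * x - of_int m"
  shows "t \<in> \<int>"
proof -
  obtain r s where rs: "quotient_of t = (r, s)" by (cases "quotient_of t")
  have t: "t = of_int r / of_int s" and cop: "coprime r s" and s0: "s > 0"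
    using quotient_of_div[OF rs] quotient_of_coprime[OF rs] quotient_of_denom_pos[OF rs] by auto
  define T :: real where "T = real_of_int r / real_of_int s"
  have tT: "of_rat t = complex_of_real T" unfolding t T_def by (simp add: of_rat_divide)
  define I where "I = (\<lambda>k. Im (x ^ k) / Im x)"
  have I0: "I 0 = 0" and I1: "I 1 = 1" using im by (auto simp: I_def)
  have Irec: "I (Suc (Suc k)) = T * I (Suc k) - m * I k" for k
  proof -
    have "x ^ Suc (Suc k) = x ^ k * (x * x)" by (simp add: mult.assoc mult.left_commute)
    also have "\<dots> = of_real T * x ^ Suc k - of_int m * x ^ k" unfolding q tT by (simp add: algebra_simps)
    finally have "Im (x ^ Suc (Suc k)) = T * Im (x ^ Suc k) - m * Im (x ^ k)"
      by (metis Im_complex_of_real Re_complex_of_real minus_complex.sel(2) times_complex.sel(2) mult_zero_left add.right_neutral of_real_of_int_eq)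
    then show ?thesis unfolding I_def by (simp add: diff_divide_distrib)
  qed
  \<comment> \<open>That \<open>s ^ k * I k\<close> is divisible by \<open>s\<close> is carried
    along because it removes the norm term of the recurrence modulo \<open>s\<close>, so that each
    step just multiplies by \<open>r\<close>.\<close>
  have U: "\<exists>u w :: int. real_of_int s ^ k * I (Suc k) = u \<and> real_of_int s ^ k * I k = w * s \<and> [u = r ^ k] (mod s)" for k
  proof (induction k)
    case 0
    then show ?case using I0 I1 by (intro exI[of _ 1] exI[of _ 0]) auto
  next
    case (Suc k)
    then obtain u w where uw: "real_of_int s ^ k * I (Suc k) = of_int u" "real_of_int s ^ k * I k = of_int (w * s)" "[u = r ^ k] (mod s)" by auto
    have "real_of_int s ^ Suc k * I (Suc (Suc k)) = (s * T) * (real_of_int s ^ k * I (Suc k)) - m * s * (real_of_int s ^ k * I k)"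
      unfolding Irec by (simp add: algebra_simps)
    also have "s * T = r" using s0 by (simp add: T_def)
    finally have 1: "real_of_int s ^ Suc k * I (Suc (Suc k)) = of_int (r * u - m * s * (w * s))" unfolding uw by simp
    have 2: "real_of_int s ^ Suc k * I (Suc k) = of_int (u * s)" using uw(1) by (simp add: algebra_simps)
    have "[r * u - m * s * (w * s) = r * r ^ k - 0] (mod s)"
      by (intro cong_diff cong_mult cong_refl uw(3)) (simp add: cong_0_iff)
    then show ?case using 1 2 by (metis diff_zero power_Suc)
  qed
  obtain p where p: "lead_coeff p = 1" "\<And>i. coeff p i \<in> \<int>" "poly p x = 0"
    using ai unfolding algebraic_int.simps by auto
  define d where "d = degree p"
  have "\<exists>c :: nat \<Rightarrow> int. \<forall>i. coeff p i = of_int (c i)"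
  proof (intro choice allI)
    fix i
    show "\<exists>k. coeff p i = of_int k" using p(2)[of i] by (rule Ints_cases) blast
  qed
  then obtain c where c: "\<And>i. coeff p i = of_int (c i)" by blast
  have cd: "c d = 1" using p(1) c[of d] by (simp add: d_def)
  have dpos: "d > 0"
  proof (rule ccontr)
    assume "\<not> d > 0"
    then have "degree p = 0" by (simp add: d_def)
    then obtain k where "p = [:k:]" by (rule degree_eq_zeroE)
    then show False using p(1,3) by simp
  qed
  have "(\<Sum>i\<le>d. of_int (c i) * x ^ i) = 0"
    using p(3) unfolding poly_altdef c d_def .
  then have "Im (\<Sum>i\<le>d. of_int (c i) * x ^ i) = 0" by simp
  then have "(\<Sum>i\<le>d. c i * Im (x ^ i)) = 0"
    by (simp add: Im_sum)
  then have "(\<Sum>i\<le>d. c i * I i) = 0"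
    unfolding I_def using im by (simp add: sum_divide_distrib[symmetric])
  moreover have "{..d} = insert d {..<d}" by auto
  ultimately have z: "I d + (\<Sum>i<d. c i * I i) = 0" using cd by simp
  obtain d' where d': "d = Suc d'" using dpos by (cases d) auto
  obtain u where u: "real_of_int s ^ d' * I d = of_int u" "[u = r ^ d'] (mod s)" using U[of d'] d' by auto
  \<comment> \<open>After multiplication by s^(d-1) every term below the leading one is a multiple
    of s, whereas the leading term is u, congruent to r^(d-1).\<close>
  have "\<exists>w::int. real_of_int s ^ d' * I i = w * s" if "i < d" for i
  proof -
    obtain w :: int where w: "real_of_int s ^ i * I i = w * s" using U[of i] by auto
    have "real_of_int s ^ d' = real_of_int s ^ (d' - i) * real_of_int s ^ i" using that d'
      by (simp add: power_add[symmetric])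
    then have "real_of_int s ^ d' * I i = of_int (s ^ (d' - i) * w) * s" using w by simp
    then show ?thesis by blast
  qed
  then obtain w where w: "\<And>i. i < d \<Longrightarrow> real_of_int s ^ d' * I i = of_int (w i * s)" by metis
  have "0 = real_of_int s ^ d' * (I d + (\<Sum>i<d. c i * I i))" using z by simp
  also have "\<dots> = u + (\<Sum>i<d. c i * (real_of_int s ^ d' * I i))"
    using u(1) by (simp add: algebra_simps sum_distrib_left)
  also have "\<dots> = u + (\<Sum>i<d. c i * real_of_int (w i * s))" using w by simp
  also have "\<dots> = of_int (u + (\<Sum>i<d. c i * w i) * s)" by (simp add: sum_distrib_right mult.assoc)
  finally have "u + (\<Sum>i<d. c i * w i) * s = 0" by linarith
  then have "s dvd u" by (metis add.commute dvd_0_right dvd_add_right_iff dvd_triv_right)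
  then have "s dvd r ^ d'" using u(2) by (metis cong_dvd_iff cong_sym cong_0_iff cong_trans)
  moreover have "coprime (r ^ d') s" using cop by simp
  ultimately have "is_unit s" by (metis coprime_common_divisor dvd_refl)
  then have "s = 1" using s0 by simp
  then show ?thesis using t by simp
qed

text \<open>The trace of an algebraic integer a + b \<omega> is integral by
  \<open>quadratic_trace_int\<close>, or because rational algebraic integers are integers if b = 0.
  The norm equation then bounds the denominator of b, and a finite search remains.\<close>

lemma labels_eq: "labels (-2) = Lab"
proof
  have w: "csqrt (of_int (-2)) = \<omega>" by (simp add: \<omega>_def)
  show "labels (-2) \<subseteq> Lab"
  proof
    fix x assume "x \<in> labels (-2)"
    then consider "x = 0" | n where "n \<in> {1,2,3,4::nat}" "x \<in> labels_of_norm (-2) n"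
      unfolding labels_def by auto
    then show "x \<in> Lab"
    proof cases
      case 2
      then obtain a b :: rat where ab: "x = of_rat a + of_rat b * \<omega>" and ai: "algebraic_int x"
        and nm: "x * cnj x = of_nat n"
        unfolding labels_of_norm_def quadratic_integers_def quadratic_field_def w by auto
      define A B where "A = real_of_rat a" and "B = real_of_rat b"
      have rc: "of_rat q = complex_of_real (real_of_rat q)" for q
      proof -
        obtain r s where rs: "quotient_of q = (r, s)" by (cases "quotient_of q")
        show ?thesis unfolding quotient_of_div[OF rs] by (simp add: of_rat_divide)
      qed
      have x: "Re x = A" "Im x = B * sqrt 2" unfolding ab rc by (auto simp: A_def B_def)
      have "Re (x * cnj x) = n" using nm by simp
      then have nrm: "A\<^sup>2 + 2 * B\<^sup>2 = n" using x by (simp add: power2_eq_square algebra_simps)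
      have "2 * a \<in> \<int>"
      proof (cases "b = 0")
        case True
        then have "x = of_rat a" using ab by simp
        then have "x \<in> \<int>" using rational_algebraic_int_is_int[OF ai] by (simp add: Rats_of_rat)
        then obtain k where "x = of_int k" unfolding Ints_def by auto
        then have "of_rat a = (of_rat (of_int k) :: complex)" using \<open>x = of_rat a\<close> by simp
        then show ?thesis by (simp only: of_rat_eq_iff) simp
      next
        case False
        show ?thesis
        proof (rule quadratic_trace_int[OF ai])
          show "Im x \<noteq> 0" using x False by (simp add: B_def)
          have "x * x + x * cnj x = of_rat (2 * a) * x"
            unfolding rc using x by (simp add: complex_eq_iff A_def of_rat_mult algebra_simps)
          then show "x * x = of_rat (2 * a) * x - of_int (int n)" using nm by (simp add: eq_diff_eq)
        qed
      qed
      then obtain k where k: "2 * a = of_int k" unfolding Ints_def by auto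
      have "2 * A = real_of_rat (2 * a)" by (simp add: A_def of_rat_mult)
      then have kA: "2 * A = of_int k" unfolding k by simp
      \<comment> \<open>With b = r / s in lowest terms the norm equation makes s^2 divide 8 r^2,
        hence 8, so s is 1 or 2 and 2 b is an integer.\<close>
      obtain r s where rs: "quotient_of b = (r, s)" by (cases "quotient_of b")
      have b: "b = of_int r / of_int s" and cop: "coprime r s" and s0: "s > 0"
        using quotient_of_div[OF rs] quotient_of_coprime[OF rs] quotient_of_denom_pos[OF rs] by auto
      have Bs: "B * s = r" unfolding B_def b using s0 by (simp add: of_rat_divide)
      have "(2 * A)\<^sup>2 * s\<^sup>2 + 8 * (B * s)\<^sup>2 = 4 * real n * s\<^sup>2" by (simp add: nrm[symmetric] power2_eq_square algebra_simps)
      then have "real_of_int (k\<^sup>2 * s\<^sup>2 + 8 * r\<^sup>2) = real_of_int (4 * int n * s\<^sup>2)" unfolding kA Bs by simp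
      then have eq: "k\<^sup>2 * s\<^sup>2 + 8 * r\<^sup>2 = 4 * int n * s\<^sup>2" by linarith
      then have "8 * r\<^sup>2 = s\<^sup>2 * (4 * int n - k\<^sup>2)" by (simp add: algebra_simps)
      then have "s\<^sup>2 dvd 8 * r\<^sup>2" by simp
      moreover have "coprime (s\<^sup>2) (r\<^sup>2)" using cop by (simp add: coprime_commute)
      ultimately have "s\<^sup>2 dvd 8" by (metis coprime_dvd_mult_left_iff)
      then have "s\<^sup>2 \<le> 8" by (simp add: zdvd_imp_le)
      then have "s < 3" using power2_nonneg_ge_1_iff power_mono[of 3 s 2] by force
      then have s12: "s = 1 \<or> s = 2" using s0 by auto
      define j where "j = (if s = 1 then 2 * r else r)"
      have j: "2 * B = of_int j" using s12 Bs by (auto simp: j_def)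
      have "real_of_int (k\<^sup>2 + 2 * j\<^sup>2) = (2 * A)\<^sup>2 + 2 * (2 * B)\<^sup>2" unfolding kA j by simp
      also have "\<dots> = real_of_int (4 * int n)" using nrm by (simp add: power2_eq_square)
      finally have kj: "k\<^sup>2 + 2 * j\<^sup>2 = 4 * int n" by linarith
      have n4: "n \<le> 4" using 2 by auto
      have "4 * int n \<le> 16" using n4 by simp
      then have "k\<^sup>2 \<le> 16" "j\<^sup>2 \<le> 8" using kj zero_le_power2[of k] zero_le_power2[of j] by linarith+
      then have "\<bar>k\<bar> \<le> 4" "\<bar>j\<bar> < 3"
        using abs_le_square_iff[of k 4] power_mono[of 3 "\<bar>j\<bar>" 2] by (simp, force)
      then have "k \<in> {-4,-3,-2,-1,0,1,2,3,4}" "j \<in> {-2,-1,0,1,2}" by auto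
      moreover have "int n \<in> {1, 2, 3, 4}" using 2(1) by auto
      then have "k\<^sup>2 + 2 * j\<^sup>2 \<in> {4, 8, 12, 16}" unfolding kj by auto
      \<comment> \<open>Only even pairs survive: this is where proper half-integers are
        excluded.\<close>
      ultimately have "(k, j) \<in> {(2,0),(-2,0),(0,2),(0,-2),(2,2),(2,-2),(-2,2),(-2,-2),(4,0),(-4,0)}"
        by (elim insertE[of k] insertE[of j] emptyE; simp)
      moreover have "x = of_real (of_int k / 2) + of_real (of_int j / 2) * \<omega>"
        using kA j x by (simp add: complex_eq_iff)
      ultimately show ?thesis unfolding Lab_def insert_iff prod.inject by (elim disjE conjE; simp)
    qed (simp add: Lab_def)
  qed
  show "Lab \<subseteq> labels (-2)"
  proof
    fix x assume xL: "x \<in> Lab"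
    have main: "of_int k + of_int j * \<omega> \<in> labels (-2)"
      if "(k, j) \<in> {(1,0),(-1,0),(0,1),(0,-1),(1,1),(1,-1),(-1,1),(-1,-1),(2,0),(-2,0)}" for k j :: int
    proof -
      let ?y = "of_int k + of_int j * \<omega>"
      have y: "?y = of_rat (of_int k) + of_rat (of_int j) * \<omega>" by simp
      then have "?y \<in> quadratic_field (-2)" unfolding quadratic_field_def w by blast
      moreover have "algebraic_int ?y"
      proof (rule algebraic_int.intros[of "[:of_int (k\<^sup>2 + 2 * j\<^sup>2), - of_int (2 * k), 1:]"])
        show "lead_coeff [:of_int (k\<^sup>2 + 2 * j\<^sup>2), - of_int (2 * k), 1 :: complex:] = 1" by simp
        show "\<forall>i. coeff [:of_int (k\<^sup>2 + 2 * j\<^sup>2), - of_int (2 * k), 1 :: complex:] i \<in> \<int>"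
          by (auto simp: coeff_pCons split: nat.split)
        show "poly [:of_int (k\<^sup>2 + 2 * j\<^sup>2), - of_int (2 * k), 1 :: complex:] ?y = 0"
          by (simp add: algebra_simps power2_eq_square)
      qed
      moreover have "?y * cnj ?y \<in> {1, 2, 3, 4}" using that by (auto simp: algebra_simps)
      ultimately show ?thesis unfolding labels_def labels_of_norm_def quadratic_integers_def by auto
    qed
    have "0 \<in> labels (-2)" by (simp add: labels_def)
    moreover note main[of 1 0, simplified] main[of "-1" 0, simplified] main[of 0 1, simplified] main[of 0 "-1", simplified]
      main[of 1 1, simplified] main[of 1 "-1", simplified] main[of "-1" 1, simplified] main[of "-1" "-1", simplified]
      main[of 2 0, simplified] main[of "-2" 0, simplified]
    ultimately show "x \<in> labels (-2)" using xL unfolding Lab_def by (elim insertE emptyE) simp_all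
  qed
qed

section \<open>Translation from matrices\<close>

lemma perm_conj_index:
  fixes X :: "complex mat"
  assumes p: "p permutes {..<n}" and X: "X \<in> carrier_mat n n" and ij: "i < n" "j < n"
    and P: "P = Matrix.mat n n (\<lambda>(i, j). if j = p i then 1 else 0)"
  shows "(P * X * transpose_mat P) $$ (i, j) = X $$ (p i, p j)"
proof -
  have pl: "p k < n" if "k < n" for k using p that permutes_in_image by fastforce
  have 1: "(P * X) $$ (i, l) = X $$ (p i, l)" if "l < n" for l
  proof -
    have "(P * X) $$ (i, l) = (\<Sum>k = 0..<n. (if k = p i then 1 else 0) * X $$ (k, l))"
      using P X ij that by (simp add: scalar_prod_def)
    also have "\<dots> = (\<Sum>k = 0..<n. if k = p i then X $$ (k, l) else 0)"
      by (intro sum.cong) auto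
    finally show ?thesis using pl ij by simp
  qed
  have "(P * X * transpose_mat P) $$ (i, j) = (\<Sum>k = 0..<n. (P * X) $$ (i, k) * (if k = p j then 1 else 0))"
    using P X ij by (simp add: scalar_prod_def)
  also have "\<dots> = (\<Sum>k = 0..<n. if k = p j then X $$ (p i, k) else 0)"
    using 1 by (intro sum.cong) auto
  finally show ?thesis using pl ij by simp
qed

lemma perm_conj_carrier:
  "X \<in> carrier_mat n n \<Longrightarrow> P = Matrix.mat n n f \<Longrightarrow> P * X * transpose_mat P \<in> carrier_mat n n"
  by auto

lemma sign_conj_index:
  fixes Y :: "complex mat"
  assumes D: "D = Matrix.mat n n (\<lambda>(i, j). if i = j then s i else 0)" and Y: "Y \<in> carrier_mat n n" and ij: "i < n" "j < n"
  shows "(D * Y * D) $$ (i, j) = s i * Y $$ (i, j) * s j"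
proof -
  have 1: "(D * Y) $$ (i, l) = s i * Y $$ (i, l)" if "l < n" for l
  proof -
    have "(D * Y) $$ (i, l) = (\<Sum>k = 0..<n. (if i = k then s i else 0) * Y $$ (k, l))"
      using D Y ij that by (simp add: scalar_prod_def)
    also have "\<dots> = (\<Sum>k = 0..<n. if i = k then s i * Y $$ (k, l) else 0)"
      by (intro sum.cong) auto
    finally show ?thesis using ij by simp
  qed
  have "(D * Y * D) $$ (i, j) = (\<Sum>k = 0..<n. (D * Y) $$ (i, k) * (if k = j then s k else 0))"
    using D Y ij by (simp add: scalar_prod_def)
  also have "\<dots> = (\<Sum>k = 0..<n. if k = j then s i * Y $$ (i, k) * s k else 0)"
    using 1 by (intro sum.cong) auto
  finally show ?thesis using ij by simp
qed

lemma equivalentI: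
  assumes A: "A \<in> carrier_mat n n" and e: "equiv_to n (entry A) T"
  shows "equivalent A T"
proof -
  obtain f s e where T: "T \<in> carrier_mat n n" and e: "e \<in> {1, -1::complex}" and f: "bij_betw f {..<n} {..<n}"
    and s: "\<And>i. s i \<in> {1, -1}" and eq: "\<And>i j. i < n \<Longrightarrow> j < n \<Longrightarrow> T $$ (i, j) = s i * s j * (e * entry A (f i) (f j))"
    using e unfolding equiv_to_def by blast
  define p where "p = (\<lambda>i. if i < n then f i else i)"
  have "bij_betw p {..<n} {..<n}" using f by (subst bij_betw_cong[of _ _ f]) (auto simp: p_def)
  then have p: "p permutes {..<n}" by (rule bij_imp_permutes) (auto simp: p_def)
  define P where "P = Matrix.mat n n (\<lambda>(i, j). if j = p i then 1 else (0::complex))"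
  define D where "D = Matrix.mat n n (\<lambda>(i, j). if i = j then s i else (0::complex))"
  define X where "X = (if e = 1 then A else - A)"
  have X: "X \<in> carrier_mat n n" using A by (auto simp: X_def)
  have carr: "P \<in> carrier_mat n n" "D \<in> carrier_mat n n" by (auto simp: P_def D_def)
  have Xe: "X $$ (i, j) = e * entry A i j" if "i < n" "j < n" for i j
    using e that A by (auto simp: X_def entry_def)
  have fl: "f i < n" if "i < n" for i using f that unfolding bij_betw_def by auto
  have "T = D * (P * X * transpose_mat P) * D"
  proof (rule eq_matI)
    show "dim_row T = dim_row (D * (P * X * transpose_mat P) * D)" "dim_col T = dim_col (D * (P * X * transpose_mat P) * D)"
      using T carr by auto
    fix i j assume "i < dim_row (D * (P * X * transpose_mat P) * D)" "j < dim_col (D * (P * X * transpose_mat P) * D)"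
    then have ij: "i < n" "j < n" using carr by auto
    have "(D * (P * X * transpose_mat P) * D) $$ (i, j) = s i * X $$ (p i, p j) * s j"
      using sign_conj_index[OF D_def perm_conj_carrier[OF X P_def] ij] perm_conj_index[OF p X ij P_def] by simp
    then show "T $$ (i, j) = (D * (P * X * transpose_mat P) * D) $$ (i, j)"
      using eq[OF ij] ij by (simp add: p_def Xe fl)
  qed
  also have "\<dots> = D * P * X * transpose_mat P * D"
    using carr X by (simp add: assoc_mult_mat[of _ n n _ n _ n])
  finally have "T = D * P * X * transpose_mat P * D" .
  moreover have "permutation_matrix (dim_row A) P" unfolding permutation_matrix_def using A p P_def by auto
  moreover have "sign_matrix (dim_row A) D"
    unfolding sign_matrix_def using A carr s by (auto simp: D_def diagonal_mat_def)
  moreover have "X \<in> {A, - A, map_mat cnj A, - map_mat cnj A}" by (simp add: X_def)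
  ultimately show ?thesis unfolding equivalent_def by blast
qed

lemma adjoint_index: "i < dim_col A \<Longrightarrow> j < dim_row A \<Longrightarrow> mat_adjoint A $$ (i, j) = cnj ((A :: complex mat) $$ (j, i))"
  unfolding mat_adjoint_def by (simp add: mat_of_rows_def)

lemma matvec_mat:
  assumes A: "A \<in> carrier_mat n n" and v: "v \<in> carrier_vec n" and i: "i < n"
  shows "vec_index (A *\<^sub>v v) i = matvec n (entry A) (vec_index v) i"
  using assms by (simp add: scalar_prod_def matvec_def entry_def lessThan_atLeast0)

text \<open>Minimising the forms of A and of -A produces the two extreme eigenvalues together with
  the bounds that they impose on the form, so it is enough that these two lie in [-2, 2].\<close>

lemma cyc_of_cyclotomic:
  assumes A: "A \<in> carrier_mat n n" and h: "herm (entry A)" and c: "cyclotomic A"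
  shows "cyc n (entry A)"
proof (cases "n = 0")
  case True
  then show ?thesis by (simp add: cyc_def qf_def ip_def sqn_def)
next
  case False
  have ev: "-2 \<le> \<mu> \<and> \<mu> \<le> 2" if "\<And>i. i < n \<Longrightarrow> matvec n (entry A) v i = complex_of_real \<mu> * v i" "\<exists>i<n. v i \<noteq> 0" for \<mu> v
  proof -
    have "eigenvector A (Matrix.vec n v) (complex_of_real \<mu>)"
      unfolding eigenvector_def
    proof (intro conjI)
      show "Matrix.vec n v \<in> carrier_vec (dim_row A)" using A by auto
      show "Matrix.vec n v \<noteq> 0\<^sub>v (dim_row A)" using that(2) A
        by (metis carrier_matD(1) index_vec index_zero_vec(1))
      show "A *\<^sub>v Matrix.vec n v = complex_of_real \<mu> \<cdot>\<^sub>v Matrix.vec n v"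
      proof (rule eq_vecI)
        show "dim_vec (A *\<^sub>v Matrix.vec n v) = dim_vec (complex_of_real \<mu> \<cdot>\<^sub>v Matrix.vec n v)" using A by simp
        fix i assume "i < dim_vec (complex_of_real \<mu> \<cdot>\<^sub>v Matrix.vec n v)"
        then have i: "i < n" by simp
        have "vec_index (A *\<^sub>v Matrix.vec n v) i = matvec n (entry A) (vec_index (Matrix.vec n v)) i" by (rule matvec_mat[OF A _ i]) simp
        also have "\<dots> = matvec n (entry A) v i" unfolding matvec_def by simp
        finally show "vec_index (A *\<^sub>v Matrix.vec n v) i = vec_index (complex_of_real \<mu> \<cdot>\<^sub>v Matrix.vec n v) i" using that(1)[OF i] i by simp
      qed
    qed
    then have "complex_of_real \<mu> \<in> complex_of_real ` {-2..2}"
      using c unfolding cyclotomic_def eigenvalue_def by blast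
    then show ?thesis by auto
  qed
  let ?m = "\<lambda>i j. - entry A i j"
  have am: "matvec n ?m v i = - matvec n (entry A) v i" for v i by (simp add: matvec_def sum_negf)
  have qm: "qf n ?m v = - qf n (entry A) v" for v by (simp add: qf_def ip_def am sum_negf)
  have hm: "herm ?m"
  proof (rule hermI)
    fix i j show "- entry A j i = cnj (- entry A i j)" using hermD[OF h, of j i] by simp
  qed
  obtain \<mu> v where 1: "\<And>i. i < n \<Longrightarrow> matvec n (entry A) v i = complex_of_real \<mu> * v i" "\<exists>i<n. v i \<noteq> 0"
    "\<And>w. qf n (entry A) w \<ge> \<mu> * sqn n w" using rayleigh[OF h] False by (metis neq0_conv)
  obtain \<nu> u where 2: "\<And>i. i < n \<Longrightarrow> matvec n ?m u i = complex_of_real \<nu> * u i" "\<exists>i<n. u i \<noteq> 0"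
    "\<And>w. qf n ?m w \<ge> \<nu> * sqn n w" using rayleigh[OF hm] False by (metis neq0_conv)
  have "matvec n (entry A) u i = complex_of_real (- \<nu>) * u i" if "i < n" for i
    using 2(1)[OF that] unfolding am by (simp add: minus_equation_iff)
  then have "-2 \<le> \<mu>" "-2 \<le> \<nu>" using ev[of v \<mu>] ev[of u "-\<nu>"] 1 2 by auto
  then have "-2 * sqn n w \<le> \<mu> * sqn n w" "-2 * sqn n w \<le> \<nu> * sqn n w" for w
    using mult_right_mono[OF _ sqn_ge0] by blast+
  then show ?thesis unfolding cyc_def using 1(3) 2(3) qm by (smt (verit))
qed

lemma cyclotomic_of_cyc:
  assumes A: "A \<in> carrier_mat n n" and h: "herm (entry A)" and c: "cyc n (entry A)"
  shows "cyclotomic A"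
  unfolding cyclotomic_def
proof (intro allI impI)
  fix e assume "eigenvalue A e"
  then obtain v where v: "v \<in> carrier_vec n" "v \<noteq> 0\<^sub>v n" "A *\<^sub>v v = e \<cdot>\<^sub>v v"
    using A unfolding eigenvalue_def eigenvector_def by auto
  define w where "w = (vec_index v)"
  have "matvec n (entry A) w i = e * w i" if "i < n" for i
    using matvec_mat[OF A v(1) that] v(3) v(1) that by (simp add: w_def)
  then have "ip n w (matvec n (entry A) w) = e * ip n w w"
    unfolding ip_def sum_distrib_left by (intro sum.cong) auto
  then have e: "complex_of_real (qf n (entry A) w) = e * complex_of_real (sqn n w)"
    unfolding ip_app_real[OF h] ip_self .
  have "sqn n w \<noteq> 0"
  proof
    assume "sqn n w = 0"
    then have "\<forall>i<n. vec_index v i = 0" by (simp add: sqn_eq0 w_def)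
    then have "v = 0\<^sub>v n" using v(1) by (intro eq_vecI) auto
    then show False using v(2) by simp
  qed
  then have s: "sqn n w > 0" using sqn_ge0[of n w] by linarith
  define r where "r = qf n (entry A) w / sqn n w"
  have "e = complex_of_real r" unfolding r_def of_real_divide e using s by simp
  moreover have "\<bar>r\<bar> \<le> 2" unfolding r_def using c s by (simp add: cyc_def divide_simps)
  ultimately show "e \<in> complex_of_real ` {-2..2}" by (auto simp: abs_le_iff)
qed

text \<open>Listing a vertex set without outgoing edges before its complement permutes the matrix
  into two diagonal blocks.\<close>

lemma conn_of_connected:
  assumes A: "A \<in> carrier_mat n n" and h: "herm (entry A)" and c: "connected_graph A"
  shows "conn n (entry A)"
  unfolding conn_def
proof (intro allI impI, rule ccontr)
  fix U assume U: "U \<subseteq> {..<n}" "U \<noteq> {}" "U \<noteq> {..<n}" and no: "\<not> (\<exists>i\<in>U. \<exists>j\<in>{..<n} - U. entry A i j \<noteq> 0)"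
  have fU: "finite U" using U(1) by (rule finite_subset) simp
  define k where "k = card U"
  have k0: "k > 0" using U fU by (simp add: k_def card_gt_0_iff)
  have kn: "k < n" using U psubset_card_mono[of "{..<n}" U] by (auto simp: k_def)
  have "card {..<k} = card U" by (simp add: k_def)
  then obtain f where f: "bij_betw f {..<k} U" using finite_same_card_bij[of "{..<k}" U] fU by auto
  have "card {k..<n} = card ({..<n} - U)" using U fU by (simp add: k_def card_Diff_subset)
  then obtain g where g: "bij_betw g {k..<n} ({..<n} - U)" using finite_same_card_bij[of "{k..<n}" "{..<n} - U"] by auto
  define p where "p = (\<lambda>i. if i < k then f i else if i < n then g i else i)"
  have p1: "bij_betw p {..<k} U" using f by (subst bij_betw_cong[of _ _ f]) (auto simp: p_def)
  have p2: "bij_betw p {k..<n} ({..<n} - U)" using g by (subst bij_betw_cong[of _ _ g]) (auto simp: p_def)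
  have "bij_betw p ({..<k} \<union> {k..<n}) (U \<union> ({..<n} - U))" by (rule bij_betw_combine[OF p1 p2]) auto
  moreover have "{..<k} \<union> {k..<n} = {..<n}" "U \<union> ({..<n} - U) = {..<n}" using kn U by auto
  ultimately have "bij_betw p {..<n} {..<n}" by simp
  then have p: "p permutes {..<n}" by (rule bij_imp_permutes) (use kn in \<open>auto simp: p_def\<close>)
  have pU: "p i \<in> U" if "i < k" for i using p1 that unfolding bij_betw_def by auto
  have pU': "p i \<in> {..<n} - U" if "k \<le> i" "i < n" for i using p2 that unfolding bij_betw_def by auto
  have z: "A $$ (p i, p j) = 0" "A $$ (p j, p i) = 0" if "i < k" "k \<le> j" "j < n" for i j
  proof -
    have "entry A (p i) (p j) = 0" using no pU[OF that(1)] pU'[OF that(2,3)] by blast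
    moreover have "p i < n" "p j < n" using pU[OF that(1)] pU'[OF that(2,3)] U by auto
    ultimately show "A $$ (p i, p j) = 0" "A $$ (p j, p i) = 0" using hermD[OF h, of "p j" "p i"] A by (auto simp: entry_def)
  qed
  define P where "P = Matrix.mat n n (\<lambda>(i, j). if j = p i then 1 else (0::complex))"
  define B1 where "B1 = Matrix.mat k k (\<lambda>(i, j). A $$ (p i, p j))"
  define B2 where "B2 = Matrix.mat (n - k) (n - k) (\<lambda>(i, j). A $$ (p (i + k), p (j + k)))"
  have pm: "permutation_matrix (dim_row A) P" unfolding permutation_matrix_def using A p P_def by auto
  have "P * A * transpose_mat P = diag_block_mat [B1, B2]"
  proof (rule eq_matI)
    show "dim_row (P * A * transpose_mat P) = dim_row (diag_block_mat [B1, B2])"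
      "dim_col (P * A * transpose_mat P) = dim_col (diag_block_mat [B1, B2])"
      using kn by (auto simp: P_def B1_def B2_def dim_diag_block_mat Let_def)
    fix i j assume "i < dim_row (diag_block_mat [B1, B2])" "j < dim_col (diag_block_mat [B1, B2])"
    then have ij: "i < n" "j < n" using kn by (auto simp: B1_def B2_def dim_diag_block_mat Let_def)
    have "(P * A * transpose_mat P) $$ (i, j) = A $$ (p i, p j)" by (rule perm_conj_index[OF p A ij P_def])
    also have "\<dots> = diag_block_mat [B1, B2] $$ (i, j)"
      using ij kn z by (auto simp: B1_def B2_def Let_def not_less)
    finally show "(P * A * transpose_mat P) $$ (i, j) = diag_block_mat [B1, B2] $$ (i, j)" .
  qed
  moreover have "\<forall>B \<in> set [B1, B2]. square_mat B \<and> dim_row B > 0"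
    using k0 kn by (auto simp: B1_def B2_def)
  moreover have "length [B1, B2] > 1" by simp
  ultimately show False using c pm unfolding connected_graph_def by blast
qed

text \<open>All blocks after the first are merged, and the vertices placed in the first block form a
  set without outgoing edges; it is nonempty and proper because blocks have positive size.\<close>

lemma connected_of_conn:
  assumes A: "A \<in> carrier_mat n n" and c: "conn n (entry A)"
  shows "connected_graph A"
  unfolding connected_graph_def
proof (rule notI, elim exE conjE)
  fix P Bs assume P: "permutation_matrix (dim_row A) P" and eq: "P * A * transpose_mat P = diag_block_mat Bs"
    and l: "1 < length Bs" and sq: "\<forall>B\<in>set Bs. square_mat B \<and> 0 < dim_row B"
  obtain B1 B2 Bs' where Bs: "Bs = B1 # B2 # Bs'" using l by (cases Bs; cases "tl Bs") auto
  define R where "R = diag_block_mat (B2 # Bs')"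
  have e: "diag_block_mat Bs = four_block_mat B1 (0\<^sub>m (dim_row B1) (dim_col R)) (0\<^sub>m (dim_row R) (dim_col B1)) R"
    unfolding Bs R_def by (simp add: Let_def)
  obtain p where p: "p permutes {..<n}" and Pd: "P = Matrix.mat n n (\<lambda>(i, j). if j = p i then 1 else 0)"
    using P A unfolding permutation_matrix_def by auto
  define k where "k = dim_row B1"
  have s1: "dim_col B1 = k" "k > 0" using sq Bs by (auto simp: k_def)
  have R0: "dim_row R > 0" using sq Bs unfolding R_def by (simp add: dim_diag_block_mat Let_def)
  have sR: "dim_col R = dim_row R"
    using diag_block_mat_square[of "B2 # Bs'"] sq Bs unfolding R_def by auto
  have "n = dim_row (P * A * transpose_mat P)" using Pd by simp
  then have n: "n = k + dim_row R" unfolding eq e by (simp add: k_def)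
  have pl: "p i < n" if "i < n" for i using p that permutes_in_image by fastforce
  have z: "entry A (p i) (p j) = 0" if "i < k" "k \<le> j" "j < n" for i j
  proof -
    have "i < n" using that n by simp
    have "A $$ (p i, p j) = diag_block_mat Bs $$ (i, j)"
      using perm_conj_index[OF p A \<open>i < n\<close> \<open>j < n\<close> Pd] eq by simp
    also have "\<dots> = 0" unfolding e using that n s1 sR by (simp add: k_def)
    finally show ?thesis by (simp add: entry_def)
  qed
  define U where "U = p ` {..<k}"
  have pi: "inj p" using p by (rule permutes_inj)
  have "U \<subseteq> {..<n}" using pl n by (auto simp: U_def)
  moreover have "U \<noteq> {}" using s1 by (auto simp: U_def)
  moreover have "U \<noteq> {..<n}"
  proof
    assume "U = {..<n}"
    then have "card U = n" by simp
    moreover have "card U = k" unfolding U_def using pi by (simp add: card_image inj_on_def)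
    ultimately show False using n R0 by simp
  qed
  ultimately obtain i j where ij: "i \<in> U" "j \<in> {..<n} - U" "entry A i j \<noteq> 0" using c unfolding conn_def by blast
  obtain i' where i': "i' < k" "i = p i'" using ij(1) by (auto simp: U_def)
  have "j \<in> p ` {..<n}" using permutes_image[OF p] ij(2) by auto
  then obtain j' where "j' < n" "j = p j'" by auto
  moreover have "k \<le> j'" using ij(2) \<open>j = p j'\<close> unfolding U_def by (metis DiffD2 imageI lessThan_iff not_less)
  ultimately show False using z[OF i'(1)] i' ij(3) by auto
qed

lemma max_graph_of_maximal:
  assumes m: "maximal_connected_cyclotomic (-2) A" and n: "n = dim_row A"
  shows "A \<in> carrier_mat n n" "max_graph n (entry A)"
proof -
  have L: "L_graph (-2) A" and cn: "connected_graph A" and cy: "cyclotomic A"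
    using m unfolding maximal_connected_cyclotomic_def connected_cyclotomic_def by auto
  show A: "A \<in> carrier_mat n n" using L n unfolding L_graph_def by (auto simp: square_mat.simps)
  have h: "herm (entry A)"
  proof (rule hermI)
    fix i j show "entry A j i = cnj (entry A i j)"
    proof (cases "i < n \<and> j < n")
      case True
      then have "mat_adjoint A $$ (j, i) = cnj (A $$ (i, j))" using A by (intro adjoint_index) auto
      then show ?thesis using L True A unfolding L_graph_def by (simp add: entry_def)
    next
      case False
      then show ?thesis using A by (auto simp: entry_def)
    qed
  qed
  show "max_graph n (entry A)"
  proof
    show "herm (entry A)" by fact
    show "entry A i j \<noteq> 0 \<Longrightarrow> i < n \<and> j < n" for i j using A by (auto simp: entry_def split: if_splits)
    show d: "entry A i i \<in> {0, 1, -1}" for i using L A unfolding L_graph_def entry_def by auto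
    show "entry A i j \<in> Lab" for i j
    proof (cases "i = j")
      case True
      then show ?thesis using d[of i] by (auto simp: Lab_def)
    next
      case False
      then have "i < n \<Longrightarrow> j < n \<Longrightarrow> A $$ (i, j) \<in> Lab" using L A unfolding L_graph_def labels_eq by auto
      then show ?thesis using A by (auto simp: entry_def Lab_def)
    qed
    show "conn n (entry A)" by (rule conn_of_connected[OF A h cn])
    show "cyc n (entry A)" by (rule cyc_of_cyclotomic[OF A h cy])
    fix N a' assume c: "cyc_graph N a'" and lt: "n < N" and e: "\<And>i j. i < n \<Longrightarrow> j < n \<Longrightarrow> a' i j = entry A i j"
    interpret c: cyc_graph N a' by fact
    define G where "G = Matrix.mat N N (\<lambda>(i, j). a' i j)"
    have G: "G \<in> carrier_mat N N" by (simp add: G_def)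
    have fG: "entry G = a'" using c.supp0 by (auto simp: entry_def G_def fun_eq_iff not_less)
    have "L_graph (-2) G"
      unfolding L_graph_def labels_eq
    proof (intro conjI allI impI)
      show "square_mat G" using G by (auto simp: square_mat.simps)
      show "mat_adjoint G = G"
      proof (rule eq_matI)
        show "dim_row (mat_adjoint G) = dim_row G" "dim_col (mat_adjoint G) = dim_col G"
          using G by (auto simp: mat_adjoint_def)
        fix i j assume "i < dim_row G" "j < dim_col G"
        then show "mat_adjoint G $$ (i, j) = G $$ (i, j)"
          using G c.flip[of i j] by (subst adjoint_index) (auto simp: G_def)
      qed
      show "G $$ (i, i) \<in> {0, 1, -1}" if "i < dim_row G" for i using c.diag[of i] that G by (auto simp: G_def)
      show "G $$ (i, j) \<in> Lab" if "i < dim_row G" "j < dim_row G" for i j using c.lab[of i j] that G by (auto simp: G_def)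
    qed
    moreover have "connected_graph G" by (rule connected_of_conn[OF G]) (use fG c.conn in simp)
    moreover have "cyclotomic G" by (rule cyclotomic_of_cyc[OF G]) (use fG c.cyc c.herm in auto)
    ultimately have "connected_cyclotomic (-2) G" unfolding connected_cyclotomic_def by simp
    moreover have "contained_in A G"
      unfolding contained_in_def
    proof
      \<comment> \<open>The leading block is the submatrix for the index set {..<n}, on which
        \<open>pick\<close> is the identity.\<close>
      have pk: "pick {..<n} i = i" if "i < n" for i
      proof -
        have "{a \<in> {..<n}. a < i} = {..<i}" using that by auto
        then show ?thesis using pick_card_in_set[of i "{..<n}"] that by simp
      qed
      have s: "{i. i < N \<and> i \<in> {..<n}} = {..<n}" using lt by auto
      show "A = submatrix G {..<n} {..<n}"
      proof (rule eq_matI)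
        show "dim_row A = dim_row (submatrix G {..<n} {..<n})" "dim_col A = dim_col (submatrix G {..<n} {..<n})"
          using A G s by (auto simp: dim_submatrix)
        fix i j assume "i < dim_row (submatrix G {..<n} {..<n})" "j < dim_col (submatrix G {..<n} {..<n})"
        then have ij: "i < n" "j < n" using G s by (auto simp: dim_submatrix)
        have "submatrix G {..<n} {..<n} $$ (i, j) = G $$ (pick {..<n} i, pick {..<n} j)"
          using ij G s by (intro submatrix_index) auto
        then show "A $$ (i, j) = submatrix G {..<n} {..<n} $$ (i, j)"
          using ij pk lt e[OF ij] A by (simp add: G_def entry_def)
      qed
    qed
    ultimately show False using m lt n G unfolding maximal_connected_cyclotomic_def by auto
  qed
qed

text \<open>Lets the second hypothesis of the theorem be read as: some entry lies outside {0, 1,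
  -1}.\<close>

lemma charged_signed_self:
  assumes A: "A \<in> carrier_mat n n" "L_graph (-2) A" and e: "\<And>i j. entry A i j \<in> {0, 1, -1}"
  shows "\<exists>B. charged_signed_graph (-2) B \<and> equivalent A B"
proof -
  have "equiv_to n (entry A) A"
    unfolding equiv_to_def using A(1)
    by (intro conjI exI[of _ id] exI[of _ "\<lambda>_. 1"] bexI[of _ 1]) (auto simp: entry_def)
  moreover have "A $$ (i, j) \<in> {0, 1, -1}" if "i < n" "j < n" for i j
    using e[of i j] that A(1) by (simp add: entry_def)
  ultimately show ?thesis using A equivalentI[OF A(1)] unfolding charged_signed_graph_def by auto
qed

section \<open>Edges of weight 3 and 4\<close>

text \<open>Weights are unchanged by switching and by negation. Structural hypotheses are stated for
  the function \<open>weights a\<close>, so that an equation between weight functions transfers them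
  to a normalised graph.\<close>

definition weights :: "(nat \<Rightarrow> nat \<Rightarrow> complex) \<Rightarrow> nat \<Rightarrow> nat \<Rightarrow> real" where
  "weights a i j = nsq (a i j)"

lemma omega_neq [simp]: "1 + \<omega> \<noteq> 0" "1 - \<omega> \<noteq> 0" "\<omega> \<noteq> 1" "\<omega> \<noteq> -1" "- \<omega> \<noteq> 1" "- \<omega> \<noteq> -1"
  and nsq_omega_1 [simp]: "nsq (\<omega> - 1) = 3" "nsq (\<omega> + 1) = 3" "nsq (- \<omega> - 1) = 3"
  by (simp_all add: complex_eq_iff nsq_def cmod_def)

lemma weights_eqD: "weights b = weights a \<Longrightarrow> nsq (b i j) = nsq (a i j)"
  by (metis weights_def)

text \<open>Switching at \<open>q\<close> alone corrects the label and disturbs no entry outside row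
  and column \<open>q\<close>, so several normalisations can be carried out in turn.\<close>

lemma (in max_graph) wlog_sign:
  assumes e: "a p q = z \<or> a p q = - z" and pq: "p \<noteq> q"
    and P: "\<And>b. max_graph n b \<Longrightarrow> weights b = weights a \<Longrightarrow> b p q = z \<Longrightarrow> (\<And>i j. i \<noteq> q \<Longrightarrow> j \<noteq> q \<Longrightarrow> b i j = a i j) \<Longrightarrow> listed n b"
  shows "listed n a"
proof (cases "a p q = z")
  case True
  show ?thesis by (rule P[OF max_graph_axioms refl True]) simp
next
  case False
  define s where "s = (\<lambda>i. if i = q then -1 else 1 :: complex)"
  have s: "s i \<in> {1, -1}" for i by (simp add: s_def)
  have "nsq (s i) = 1" for i by (simp add: s_def)
  then have "weights (switched s a) = weights a" by (intro ext) (simp add: weights_def switched_def nsq_mult)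
  then have "listed n (switched s a)"
    using False e pq by (intro P[OF max_graph_sw[OF max_graph_axioms s]]) (auto simp: switched_def s_def)
  then show ?thesis by (rule listed_sw[OF _ s])
qed

lemma max_graph_neg: assumes "max_graph n a" shows "max_graph n (\<lambda>i j. - a i j)"
proof -
  have neg: "cyc_graph N (\<lambda>i j. - b i j)" if "cyc_graph N b" for N b
  proof -
    interpret b: cyc_graph N b by fact
    have am: "matvec N (\<lambda>i j. - b i j) v i = - matvec N b v i" for v i by (simp add: matvec_def sum_negf)
    have qm: "qf N (\<lambda>i j. - b i j) v = - qf N b v" for v by (simp add: qf_def ip_def am sum_negf)
    show ?thesis
    proof
      show "herm (\<lambda>i j. - b i j)"
      proof (rule hermI)
        fix i j show "- b j i = cnj (- b i j)" using b.flip[of j i] by simp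
      qed
      show "\<And>i j. - b i j \<noteq> 0 \<Longrightarrow> i < N \<and> j < N" using b.supp by auto
      show "- b i i \<in> {0, 1, -1}" for i using b.diag[of i] by auto
      show "- b i j \<in> Lab" for i j using b.lab Lab_minus by blast
      show "conn N (\<lambda>i j. - b i j)" using b.conn by (simp add: conn_def)
      show "cyc N (\<lambda>i j. - b i j)" using b.cyc by (simp add: cyc_def qm)
    qed
  qed
  interpret max_graph n a by fact
  interpret b: cyc_graph n "\<lambda>i j. - a i j" by (rule neg[OF cyc_graph_axioms])
  show ?thesis
  proof
    fix N a' assume a': "cyc_graph N a'" "n < N" "\<And>i j. i < n \<Longrightarrow> j < n \<Longrightarrow> a' i j = - a i j"
    show False by (rule maxi[OF neg[OF a'(1)] a'(2)]) (simp add: a'(3))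
  qed
qed

lemma listed_neg: assumes "listed n (\<lambda>i j. - a i j)" shows "listed n a"
proof -
  obtain T f s e where T: "T \<in> targets" "T \<in> carrier_mat n n" "e \<in> {1,-1}" "bij_betw f {..<n} {..<n}"
    "\<forall>i. s i \<in> {1,-1}" "\<forall>i<n. \<forall>j<n. T $$ (i, j) = s i * s j * (e * - a (f i) (f j))"
    using assms unfolding listed_def equiv_to_def by blast
  have "- e \<in> {1, -1}" using T(3) by auto
  then have "equiv_to n a T" unfolding equiv_to_def using T(2,4,5,6)
    by (intro conjI exI[of _ f] exI[of _ s] bexI[of _ "-e"]) auto
  then show ?thesis unfolding listed_def using T(1) by blast
qed

context max_graph
begin

lemma embed_sgn:
  assumes T: "T \<in> targets" "T \<in> carrier_mat N N" "cyc_graph N (entry T)"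
    and f: "inj_on f {..<n}" "f ` {..<n} \<subseteq> {..<N}"
    and s: "\<And>i. i < n \<Longrightarrow> s i \<in> {1, -1}"
    and e: "\<And>i j. i < n \<Longrightarrow> j < n \<Longrightarrow> a i j = s i * s j * entry T (f i) (f j)"
  shows "listed n a"
proof -
  define t where "t = (\<lambda>i. if i < n then s i else 1)"
  have t: "t i \<in> {1, -1}" for i using s by (simp add: t_def)
  interpret b: max_graph n "switched t a" by (rule max_graph_sw[OF max_graph_axioms t])
  have "switched t a i j = entry T (f i) (f j)" if "i < n" "j < n" for i j
  proof -
    have "switched t a i j = (s i * s i) * (s j * s j) * entry T (f i) (f j)"
      unfolding switched_def e[OF that] using that by (simp add: t_def mult_ac)
    moreover have "s i * s i = 1" "s j * s j = 1" using s[OF that(1)] s[OF that(2)] by auto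
    ultimately show ?thesis by simp
  qed
  then have "listed n (switched t a)" by (intro b.embed_listed[OF T f])
  then show ?thesis by (rule listed_sw[OF _ t])
qed

text \<open>A triple (u, k, s) sends the vertex u to the vertex k of \<open>T\<close> with sign s.
  Each unordered pair is checked once, since the reversed entry is the conjugate. The list may cover
  only part of \<open>T\<close>: maximality excludes proper induced subgraphs, and this is how
  incomplete configurations are disposed of in the finite cases.\<close>

lemma embed_list:
  assumes T: "T \<in> targets" "T \<in> carrier_mat N N" "cyc_graph N (entry T)"
    and U: "{..<n} = fst ` set ps"
    and s: "sorted_wrt (\<lambda>(u, k, s) (v, l, t). u \<noteq> v \<and> k \<noteq> l \<and> a u v = s * t * entry T k l) ps"
    and dg: "list_all (\<lambda>(u, k, s). k < N \<and> (s = 1 \<or> s = -1) \<and> a u u = entry T k k) ps"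
  shows "listed n a"
proof -
  have d: "k < N \<and> s \<in> {1, -1} \<and> a u u = entry T k k" if "(u, k, s) \<in> set ps" for u k s
    using dg that unfolding list_all_iff by fastforce
  interpret T: cyc_graph N "entry T" by fact
  have pair: "(u \<noteq> v \<and> k \<noteq> l \<or> u = v \<and> k = l \<and> s = t) \<and> a u v = s * t * entry T k l"
    if m: "(u, k, s) \<in> set ps" "(v, l, t) \<in> set ps" for u k s v l t
  proof -
    obtain i j where i: "i < length ps" "ps ! i = (u, k, s)" and j: "j < length ps" "ps ! j = (v, l, t)"
      using m unfolding in_set_conv_nth by blast
    consider "i < j" | "i = j" | "j < i" by linarith
    then show ?thesis
    proof cases
      case 1
      then show ?thesis using s[unfolded sorted_wrt_iff_nth_less, rule_format, OF 1 j(1)] i j by simp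
    next
      case 2
      then show ?thesis using d[OF m(1)] i j by auto
    next
      case 3
      then have "v \<noteq> u" "l \<noteq> k" "a v u = t * s * entry T l k"
        using s[unfolded sorted_wrt_iff_nth_less, rule_format, OF 3 i(1)] i j by simp_all
      moreover have "cnj s = s" "cnj t = t" using d[OF m(1)] d[OF m(2)] by auto
      ultimately show ?thesis using flip[of u v] T.flip[of k l] by simp
    qed
  qed
  define f where "f = (\<lambda>u. fst (SOME r. (u, r) \<in> set ps))"
  define sg where "sg = (\<lambda>u. snd (SOME r. (u, r) \<in> set ps))"
  have in_ps: "(u, f u, sg u) \<in> set ps" if "u < n" for u
  proof -
    have "u \<in> fst ` set ps" using that U by blast
    then have "\<exists>r. (u, r) \<in> set ps" by (auto, blast)
    then have "(u, SOME r. (u, r) \<in> set ps) \<in> set ps" by (rule someI_ex)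
    then show ?thesis by (simp add: f_def sg_def)
  qed
  show ?thesis
  proof (rule embed_sgn[OF T, of f sg])
    show "inj_on f {..<n}"
    proof (rule inj_onI)
      fix u v assume "u \<in> {..<n}" "v \<in> {..<n}" "f u = f v"
      then show "u = v" using pair[OF in_ps in_ps, of u v] by auto
    qed
    show "f ` {..<n} \<subseteq> {..<N}" using d[OF in_ps] by auto
    show "sg i \<in> {1, -1}" if "i < n" for i using d[OF in_ps[OF that]] by blast
    show "a i j = sg i * sg j * entry T (f i) (f j)" if "i < n" "j < n" for i j
      using pair[OF in_ps[OF that(1)] in_ps[OF that(2)]] by blast
  qed
qed

lemma loop_ne: "nsq (a p x) \<ge> 2 \<Longrightarrow> p \<noteq> x"
  using diag[of p] by auto

lemma row_zero: "finite F \<Longrightarrow> (\<Sum>t\<in>F. nsq (a i t)) \<ge> 4 \<Longrightarrow> \<forall>t. t \<notin> F \<longrightarrow> a i t = 0"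
  using full(1) by blast

lemma lab_cases: "nsq (a i j) \<in> {0,1,2,3,4}"
  "nsq (a i j) = 1 \<Longrightarrow> a i j = 1 \<or> a i j = -1"
  "nsq (a i j) = 2 \<Longrightarrow> a i j = \<omega> \<or> a i j = -\<omega>"
  "nsq (a i j) = 3 \<Longrightarrow> a i j = 1 + \<omega> \<or> a i j = 1 - \<omega> \<or> a i j = - (1 + \<omega>) \<or> a i j = - (1 - \<omega>)"
  "nsq (a i j) = 4 \<Longrightarrow> a i j = 2 \<or> a i j = -2"
proof -
  have l: "a i j = 0 \<or> a i j = 1 \<or> a i j = -1 \<or> a i j = \<omega> \<or> a i j = -\<omega> \<or> a i j = 1 + \<omega> \<or> a i j = 1 - \<omega> \<or>
      a i j = -1 + \<omega> \<or> a i j = -1 - \<omega> \<or> a i j = 2 \<or> a i j = -2"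
    using lab[of i j] unfolding Lab_def by simp
  show "nsq (a i j) \<in> {0,1,2,3,4}" using l by (elim disjE) simp_all
  show "nsq (a i j) = 1 \<Longrightarrow> a i j = 1 \<or> a i j = -1" using l by (elim disjE) simp_all
  show "nsq (a i j) = 2 \<Longrightarrow> a i j = \<omega> \<or> a i j = -\<omega>" using l by (elim disjE) simp_all
  show "nsq (a i j) = 3 \<Longrightarrow> a i j = 1 + \<omega> \<or> a i j = 1 - \<omega> \<or> a i j = - (1 + \<omega>) \<or> a i j = - (1 - \<omega>)"
    using l by (elim disjE) (simp_all add: minus_add_distrib)
  show "nsq (a i j) = 4 \<Longrightarrow> a i j = 2 \<or> a i j = -2" using l by (elim disjE) simp_all
qed

lemma nz_ge1: "a i j \<noteq> 0 \<Longrightarrow> nsq (a i j) \<ge> 1"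
  using lab_cases(1)[of i j] by auto

lemma nsq_flip: "nsq (a j i) = nsq (a i j)"
  using flip[of j i] by simp

lemma supp_nsq: "nsq (a i j) > 0 \<Longrightarrow> i < n \<and> j < n"
  using supp[of i j] by (cases "a i j = 0") auto

text \<open>Up to switching at \<open>x\<close> this is \<open>no_ext_leaf\<close>.\<close>

lemma leaf_false:
  assumes px: "nsq (a p x) = 2" and p0: "\<And>t. t \<noteq> x \<Longrightarrow> a p t = 0"
  shows False
proof (cases "a p x = \<omega>")
  case True
  then show ?thesis using no_ext_leaf[OF True _ p0] loop_ne[of p x] by simp
next
  case False
  then have m: "a p x = - \<omega>" using lab_cases(3)[OF px] by simp
  have ne: "p \<noteq> x" using loop_ne[of p x] px by simp
  define s where "s = (\<lambda>i. if i = x then -1 else 1 :: complex)"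
  have s: "s i \<in> {1, -1}" for i by (simp add: s_def)
  interpret b: max_graph n "switched s a" by (rule max_graph_sw[OF max_graph_axioms s])
  show False
    by (rule b.no_ext_leaf[of p x]) (use m ne p0 in \<open>auto simp: switched_def s_def\<close>)
qed

end

lemma S2_table: "entry S2 0 0 = 0" "entry S2 0 (Suc 0) = 2" "entry S2 (Suc 0) 0 = 2" "entry S2 (Suc 0) (Suc 0) = 0"
  by (simp_all add: S2_def graph_simps)

lemma S2'_table: "entry S2' 0 0 = 1" "entry S2' 0 (Suc 0) = 1 + \<omega>" "entry S2' (Suc 0) 0 = 1 - \<omega>" "entry S2' (Suc 0) (Suc 0) = -1"
  by (simp_all add: S2'_def graph_simps \<alpha>_def)

lemma less_2: "i < (2::nat) \<longleftrightarrow> i = 0 \<or> i = Suc 0" by auto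

lemma sum_less_2: "(\<Sum>t<2. g t) = g 0 + (g (Suc 0) :: complex)" for g :: "nat \<Rightarrow> complex"
  by (simp add: eval_nat_numeral)

lemma cyc_graph_S2: "S2 \<in> carrier_mat 2 2" "cyc_graph 2 (entry S2)"
proof -
  show c: "S2 \<in> carrier_mat 2 2" by (simp add: S2_def graph_matrix_def)
  show "cyc_graph 2 (entry S2)"
  proof (rule cyc_graph_of_square[OF c])
    show "\<exists>k<i. entry S2 k i \<noteq> 0" if "i < 2" "i \<noteq> 0" for i
      using that unfolding less_2 by (auto simp: S2_table)
  qed (unfold less_2 sum_less_2, (elim disjE; simp add: S2_table Lab_def)+)
qed

lemma cyc_graph_S2': "S2' \<in> carrier_mat 2 2" "cyc_graph 2 (entry S2')"
proof -
  show c: "S2' \<in> carrier_mat 2 2" by (simp add: S2'_def graph_matrix_def)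
  show "cyc_graph 2 (entry S2')"
  proof (rule cyc_graph_of_square[OF c])
    show "\<exists>k<i. entry S2' k i \<noteq> 0" if "i < 2" "i \<noteq> 0" for i
      using that unfolding less_2 by (auto simp: S2'_table complex_eq_iff)
  qed (unfold less_2 sum_less_2, (elim disjE; simp add: S2'_table Lab_def algebra_simps)+)
qed

lemma targets_mem: "S2 \<in> targets" "S2' \<in> targets" "S4' \<in> targets" "S4 \<in> targets" "S4_star \<in> targets" "S8_star \<in> targets"
  by (auto simp: targets_def)

context max_graph
begin

lemma weight4:
  assumes w: "nsq (a p x) = 4"
  shows "listed n a"
proof -
  have ne: "p \<noteq> x" using loop_ne[of p x] w by simp
  have n: "p < n" "x < n" using supp_nsq[of p x] w by auto
  have p0: "\<forall>t. t \<notin> {x} \<longrightarrow> a p t = 0" by (rule row_zero) (use w in auto)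
  have x0: "\<forall>t. t \<notin> {p} \<longrightarrow> a x t = 0" by (rule row_zero) (use w nsq_flip[of x p] in auto)
  have U: "{..<n} = {p, x}" by (rule closed_eq) (use n p0 x0 in auto)
  have px: "a p x = 2 \<or> a p x = -2" using lab_cases(5)[OF w] .
  define e where "e = (if a p x = 2 then 1 else -1 :: complex)"
  have pxe: "a p x = 2 * e" "e = 1 \<or> e = -1" using px by (auto simp: e_def)
  show ?thesis
    by (rule embed_list[OF targets_mem(1) cyc_graph_S2, of "[(p, 0, 1), (x, Suc 0, e)]"])
      (use U pxe ne p0 x0 in \<open>simp_all add: S2_table algebra_simps\<close>)
qed

text \<open>The charge and the edge saturate \<open>p\<close>, and the resulting relation at
  \<open>x\<close> forces the opposite charge there, which saturates \<open>x\<close> as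
  well.\<close>

lemma weight3_charged:
  assumes px: "a p x = 1 + \<omega>" and pp: "a p p = 1"
  shows "listed n a"
proof -
  have ne: "p \<noteq> x" using loop_ne[of p x] px by simp
  have n: "p < n" "x < n" using supp[of p x] px by auto
  have Fs: "(\<Sum>t\<in>{p,x}. nsq (a p t)) \<ge> 4" using ne px pp by simp
  have p0: "\<forall>t. t \<notin> {p,x} \<longrightarrow> a p t = 0" by (rule row_zero[OF _ Fs]) simp
  have "a p p * a p x + a p x * a x x = 0" using full(2)[OF _ Fs, of x] ne by simp
  then have "(1 + \<omega>) * (1 + a x x) = 0" using px pp by (simp add: algebra_simps)
  moreover have "1 + \<omega> \<noteq> 0" by (simp add: complex_eq_iff)
  ultimately have xx: "a x x = -1" by (simp add: add_eq_0_iff)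
  have x0: "\<forall>t. t \<notin> {p,x} \<longrightarrow> a x t = 0"
    by (rule row_zero) (use ne xx px nsq_flip[of x p] in auto)
  have U: "{..<n} = {p, x}" by (rule closed_eq) (use n p0 x0 in auto)
  show ?thesis
    by (rule embed_list[OF targets_mem(2) cyc_graph_S2', of "[(p, 0, 1), (x, Suc 0, 1)]"])
      (use U px ne pp xx in \<open>simp_all add: S2'_table algebra_simps\<close>)
qed

text \<open>\<open>p\<close> is saturated by \<open>x\<close> and \<open>q\<close>, so row
  \<open>q\<close> is -(1 + \<omega>) times row \<open>x\<close> away from \<open>p\<close>. A
  further neighbour of \<open>x\<close> is therefore joined to \<open>q\<close> by an edge of weight
  3 and closes a saturated square; without one the graph is a path inside
  \<open>S4'\<close>.\<close>

lemma weight3_pq: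
  assumes px: "a p x = 1 + \<omega>" and z: "a p p = 0" "a x x = 0" and pq: "a p q = 1"
  shows "listed n a"
proof -
  have ne: "p \<noteq> x" "p \<noteq> q" "x \<noteq> q" using loop_ne[of p x] px z pq by (auto simp: complex_eq_iff)
  have n: "p < n" "x < n" "q < n" using supp[of p x] supp[of p q] px pq by auto
  have Fs: "(\<Sum>t\<in>{x,q}. nsq (a p t)) \<ge> 4" using ne px pq by simp
  have p0: "\<forall>t. t \<notin> {x,q} \<longrightarrow> a p t = 0" by (rule row_zero[OF _ Fs]) simp
  have row: "(1 + \<omega>) * a x l + a q l = 0" if "l \<noteq> p" for l
    using full(2)[OF _ Fs that] ne px pq by simp
  have qx: "a q x = 0" using row[of x] ne z by simp
  then have xq: "a x q = 0" using flip[of x q] by simp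
  have qq: "a q q = 0" using row[of q] ne xq by simp
  have qp: "a q p = 1" using flip[of q p] pq by simp
  have xp: "a x p = 1 - \<omega>" using flip[of x p] px by simp
  show ?thesis
  proof (cases "\<exists>r. r \<noteq> p \<and> a x r \<noteq> 0")
    case False
    then have x0: "\<forall>t. t \<noteq> p \<longrightarrow> a x t = 0" by blast
    have q0: "a q t = 0" if "t \<noteq> p" for t using row[OF that] x0 that by simp
    have U: "{..<n} = {p, x, q}" by (rule closed_eq) (use n p0 x0 q0 in auto)
    show ?thesis
      by (rule embed_list[OF targets_mem(3) cyc_graph_S4', of "[(p, 0, 1), (x, 1, 1), (q, 2, 1)]"])
        (use U px pq ne z qq xq in \<open>simp_all add: S4'_table algebra_simps\<close>)
  next
    case True
    then obtain r where r: "r \<noteq> p" "a x r \<noteq> 0" by blast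
    have rne: "r \<noteq> q" "r \<noteq> x" using r xq z by auto
    have rn: "r < n" using supp r by blast
    have "(\<Sum>t\<in>{p,r}. nsq (a x t)) \<le> 4" by (rule sum_le) simp
    then have "nsq (a x r) = 1" using r xp nz_ge1[OF r(2)] by simp
    then have xr: "a x r = 1 \<or> a x r = -1" by (rule lab_cases(2))
    define e where "e = a x r"
    have e: "e = 1 \<or> e = -1" using xr by (simp add: e_def)
    have qr: "a q r = - (1 + \<omega>) * e" using row[OF r(1)] unfolding e_def add_eq_0_iff mult_minus_left .
    have qr': "a q r = e * (-1 - \<omega>)" unfolding qr by (simp add: algebra_simps)
    have nqr: "nsq (a q r) = 3" using e unfolding qr nsq_mult by auto
    have x0: "\<forall>t. t \<notin> {p,r} \<longrightarrow> a x t = 0" by (rule row_zero) (use r xr xp in auto)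
    have q0: "\<forall>t. t \<notin> {p,r} \<longrightarrow> a q t = 0" by (rule row_zero) (use r nqr qp in auto)
    have r0: "\<forall>t. t \<notin> {x,q} \<longrightarrow> a r t = 0"
      by (rule row_zero) (use ne nqr xr nsq_flip[of r q] nsq_flip[of r x] in auto)
    have U: "{..<n} = {p, x, q, r}" by (rule closed_eq) (use n rn p0 x0 q0 r0 in auto)
    have pr: "a p r = 0" using p0 r rne by auto
    show ?thesis
      by (rule embed_list[OF targets_mem(3) cyc_graph_S4', of "[(p, 0, 1), (x, 1, 1), (q, 2, 1), (r, 3, e)]"])
        (use U px pq ne r rne z qq xq pr qr' r0 e e_def[symmetric] in \<open>simp_all add: S4'_table\<close>)
  qed
qed

lemma weight3_main:
  assumes px: "a p x = 1 + \<omega>"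
  shows "listed n a"
proof (cases "a p p = 0")
  case False
  then consider "a p p = 1" | "a p p = -1" using diag[of p] by auto
  then show ?thesis
  proof cases
    case 1
    then show ?thesis by (rule weight3_charged[OF px])
  next
    case 2
    have ne: "p \<noteq> x" using loop_ne[of p x] px by simp
    interpret m: max_graph n "\<lambda>i j. - a i j" by (rule max_graph_neg[OF max_graph_axioms])
    \<comment> \<open>Negation makes the charge 1 but also changes the label, which switching at
      \<open>x\<close> restores.\<close>
    have "listed n (\<lambda>i j. - a i j)"
    proof (rule m.wlog_sign[of p x "1 + \<omega>"])
      show "listed n b" if "max_graph n b" "b p x = 1 + \<omega>" "\<And>i j. i \<noteq> x \<Longrightarrow> j \<noteq> x \<Longrightarrow> b i j = - a i j" for b
      proof -
        interpret b: max_graph n b by fact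
        show ?thesis by (rule b.weight3_charged[OF that(2)]) (use that(3)[of p p] ne 2 in auto)
      qed
    qed (use px ne in auto)
    then show ?thesis by (rule listed_neg)
  qed
next
  case pp: True
  have ne: "p \<noteq> x" using loop_ne[of p x] px by simp
  have n: "p < n" "x < n" using supp[of p x] px by auto
  have xp: "a x p = 1 - \<omega>" using flip[of x p] px by simp
  \<comment> \<open>A charge would saturate \<open>x\<close>, and the resulting relation at the
    uncharged vertex \<open>p\<close> would contain a single nonzero term.\<close>
  have xx: "a x x = 0"
  proof (rule ccontr)
    assume nz: "a x x \<noteq> 0"
    have "(\<Sum>t\<in>{p,x}. nsq (a x t)) \<ge> 4" using ne xp nz_ge1[OF nz] by simp
    from full(2)[OF _ this, of p] have "a x x * a x p = 0" using ne pp by simp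
    then show False using nz xp by simp
  qed
  show ?thesis
  proof (cases "\<exists>q. q \<noteq> x \<and> a p q \<noteq> 0")
    case True
    then obtain q where q: "q \<noteq> x" "a p q \<noteq> 0" by blast
    have pq: "p \<noteq> q" using q pp by auto
    have "(\<Sum>t\<in>{x,q}. nsq (a p t)) \<le> 4" by (rule sum_le) simp
    then have "nsq (a p q) = 1" using q px nz_ge1[OF q(2)] by simp
    then have "a p q = 1 \<or> a p q = -1" by (rule lab_cases(2))
    then show ?thesis
    proof (rule wlog_sign[OF _ pq])
      fix b assume b: "max_graph n b" "b p q = 1" and e: "\<And>i j. i \<noteq> q \<Longrightarrow> j \<noteq> q \<Longrightarrow> b i j = a i j"
      interpret b: max_graph n b by fact
      show "listed n b" by (rule b.weight3_pq[of p x q]) (use e pq q b px pp xx in auto)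
    qed
  next
    case False
    then have p0: "\<forall>t. t \<noteq> x \<longrightarrow> a p t = 0" by blast
    show ?thesis
    proof (cases "\<exists>r. r \<noteq> p \<and> a x r \<noteq> 0")
      case False
      then have x0: "\<forall>t. t \<noteq> p \<longrightarrow> a x t = 0" by blast
      have U: "{..<n} = {p, x}" by (rule closed_eq) (use n p0 x0 in auto)
      show ?thesis
        by (rule embed_list[OF targets_mem(3) cyc_graph_S4', of "[(p, 0, 1), (x, 1, 1)]"])
          (use U px ne pp xx in \<open>simp_all add: S4'_table algebra_simps\<close>)
    next
      case True
      then obtain r where r: "r \<noteq> p" "a x r \<noteq> 0" by blast
      have rne: "r \<noteq> x" using r xx by auto
      have rn: "r < n" using supp r by blast
      have "(\<Sum>t\<in>{p,r}. nsq (a x t)) \<le> 4" by (rule sum_le) simp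
      then have "nsq (a x r) = 1" using r xp nz_ge1[OF r(2)] by simp
      then have xr: "a x r = 1 \<or> a x r = -1" by (rule lab_cases(2))
      have Fs: "(\<Sum>t\<in>{p,r}. nsq (a x t)) \<ge> 4" using r xr xp by auto
      have x0: "\<forall>t. t \<notin> {p,r} \<longrightarrow> a x t = 0" by (rule row_zero[OF _ Fs]) simp
      have r0: "a r l = 0" if "l \<noteq> x" for l
      proof -
        have "a x p * a p l + a x r * a r l = 0" using full(2)[OF _ Fs that] r by simp
        then show ?thesis using p0 that xr by auto
      qed
      have U: "{..<n} = {p, x, r}" by (rule closed_eq) (use n rn p0 x0 r0 in auto)
      show ?thesis
        by (rule embed_list[OF targets_mem(3) cyc_graph_S4', of "[(p, 0, 1), (x, 1, 1), (r, 3, a x r)]"])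
          (use U px ne pp xx r rne p0 r0 xr in \<open>simp_all add: S4'_table algebra_simps\<close>)
    qed
  qed
qed

text \<open>The labels 1 - \<omega> and -(1 - \<omega>) become 1 + \<omega> and its negative when
  the edge is read from its other end.\<close>

lemma weight3:
  assumes w: "nsq (a p x) = 3"
  shows "listed n a"
proof -
  have ne: "p \<noteq> x" using loop_ne[of p x] w by simp
  have g: "listed n a" if "a u v = 1 + \<omega> \<or> a u v = - (1 + \<omega>)" "u \<noteq> v" for u v
  proof (rule wlog_sign[OF that])
    fix b assume "max_graph n b" "b u v = 1 + \<omega>"
    then show "listed n b" by (rule max_graph.weight3_main)
  qed
  have "a x p = cnj (a p x)" by (rule flip)
  then show ?thesis using lab_cases(4)[OF w] g[of p x] g[of x p] ne by auto
qed

end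

section \<open>Edges of weight 2 forming a matching\<close>

definition light_matching :: "(nat \<Rightarrow> nat \<Rightarrow> real) \<Rightarrow> bool" where
  "light_matching w \<longleftrightarrow> (\<forall>i j. w i j \<le> 2) \<and> (\<forall>i j k. w i j = 2 \<longrightarrow> w i k = 2 \<longrightarrow> j = k)"

lemma light_matching_le: "light_matching (weights a) \<Longrightarrow> nsq (a i j) \<le> 2"
  by (simp add: light_matching_def weights_def)

lemma light_matching_eq: "light_matching (weights a) \<Longrightarrow> nsq (a i j) = 2 \<Longrightarrow> nsq (a i k) = 2 \<Longrightarrow> j = k"
  unfolding light_matching_def weights_def by blast

lemma minus_eqI: "u + v = 0 \<Longrightarrow> v = - (u::complex)"
  by (simp add: add_eq_0_iff)

context max_graph
begin

lemma small_cases: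
  assumes "light_matching (weights a)"
  shows "a i j = 0 \<or> a i j = 1 \<or> a i j = -1 \<or> a i j = \<omega> \<or> a i j = -\<omega>"
  using lab_cases(1-3)[of i j] light_matching_le[OF assms, of i j] by auto

text \<open>At most one unit of weight is left, so a further neighbour uses it up and saturates the
  vertex.\<close>

lemma residual1:
  assumes "finite F" "(\<Sum>t\<in>F. nsq (a i t)) \<ge> 3" "q \<notin> F" "a i q \<noteq> 0"
  shows "nsq (a i q) = 1" "a i q = 1 \<or> a i q = -1" "\<forall>t. t \<notin> insert q F \<longrightarrow> a i t = 0"
    "(\<Sum>t\<in>insert q F. nsq (a i t)) \<ge> 4"
proof -
  have "(\<Sum>t\<in>insert q F. nsq (a i t)) \<le> 4" using assms(1) by (intro sum_le) simp
  then show 1: "nsq (a i q) = 1" using assms nz_ge1[OF assms(4)] by simp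
  show "a i q = 1 \<or> a i q = -1" using lab_cases(2)[OF 1] .
  show 2: "(\<Sum>t\<in>insert q F. nsq (a i t)) \<ge> 4" using assms 1 by simp
  show "\<forall>t. t \<notin> insert q F \<longrightarrow> a i t = 0" by (rule row_zero[OF _ 2]) (use assms in simp)
qed

text \<open>The charge and the edge leave \<open>p\<close> one unit of weight. Whether or not it is
  used, the charge of \<open>x\<close> must be -1: other values are excluded by comparing norms if
  it is, and by the minor of \<open>p\<close> and \<open>x\<close> if it is not. The rows are then
  those of an induced subgraph of \<open>S4\<close>.\<close>

lemma charged_main:
  assumes tm: "light_matching (weights a)" and px: "a p x = \<omega>" and pp: "a p p = 1"
  shows "listed n a"
proof -
  have ne: "p \<noteq> x" using loop_ne[of p x] px by simp
  have n: "p < n" "x < n" using supp[of p x] px by auto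
  have xp: "a x p = -\<omega>" using flip[of x p] px by simp
  have F3: "(\<Sum>t\<in>{p,x}. nsq (a p t)) \<ge> 3" using px pp ne by simp
  have xx_cases: "a x x = 0 \<or> a x x = 1 \<or> a x x = -1" using diag[of x] by auto
  have key: "a x x = -1 \<and> a q x = 0 \<and> a q q = -1 \<and> (\<forall>l. l \<notin> {p,x,q} \<longrightarrow> a q l = - \<omega> * a p q * a x l)"
    if q: "q \<notin> {p,x}" "a p q \<noteq> 0" for q
  proof -
    note r1 = residual1[OF _ F3 q, simplified]
    have Fs: "(\<Sum>t\<in>{q,p,x}. nsq (a p t)) \<ge> 4" using q ne px pp r1(1) by simp
    have row: "a p q * a q l + a p l + \<omega> * a x l = 0" if "l \<noteq> p" for l
      using full(2)[OF _ Fs that] q ne px pp by (simp add: add.assoc)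
    have "a p q * a q x + \<omega> * (1 + a x x) = 0" using row[of x] ne px by (simp add: algebra_simps)
    then have e1: "\<omega> * (1 + a x x) = - (a p q * a q x)" by (rule minus_eqI)
    have "nsq (\<omega> * (1 + a x x)) = nsq (a p q * a q x)" unfolding e1 by simp
    \<comment> \<open>Charge 1 would need an edge of weight 8, and charge 0 a second edge of weight
      2 at \<open>x\<close>, contrary to the matching.\<close>
    then have e: "2 * nsq (1 + a x x) = nsq (a q x)" by (simp add: nsq_mult r1(1))
    have x1: "a x x \<noteq> 1"
    proof
      assume "a x x = 1"
      then show False using e light_matching_le[OF tm, of q x] by simp
    qed
    have x0: "a x x \<noteq> 0"
    proof
      assume "a x x = 0"
      then have "nsq (a x q) = 2" using e nsq_flip[of x q] by simp
      then show False using light_matching_eq[OF tm, of x q p] xp q by simp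
    qed
    have xx: "a x x = -1" using xx_cases x0 x1 by blast
    have qx: "a q x = 0" using e xx by simp
    then have xq: "a x q = 0" using flip[of x q] by simp
    have "a p q * (1 + a q q) = 0" using row[of q] q xq by (simp add: algebra_simps)
    then have "1 + a q q = 0" using q by simp
    then have qq: "a q q = -1" using minus_eqI by blast
    have "a q l = - \<omega> * a p q * a x l" if "l \<notin> {p,x,q}" for l
    proof -
      have "a p l = 0" using r1(3) that by auto
      then have "a p q * a q l + \<omega> * a x l = 0" using row[of l] that by simp
      then have "a p q * (a p q * a q l + \<omega> * a x l) = 0" by simp
      moreover have "a p q * (a p q * z) = z" for z using r1(2) by auto
      ultimately have "a q l + a p q * (\<omega> * a x l) = 0" by (simp add: distrib_left)
      then show ?thesis by (simp add: add_eq_0_iff2 mult_ac)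
    qed
    then show ?thesis using xx qx qq by blast
  qed
  show ?thesis
  proof (cases "\<exists>q. q \<notin> {p,x} \<and> a p q \<noteq> 0")
    case True
    then obtain q where q: "q \<notin> {p,x}" "a p q \<noteq> 0" by blast
    note k = key[OF q]
    note r1 = residual1[OF _ F3 q, simplified]
    have xx: "a x x = -1" and qx: "a q x = 0" and qq: "a q q = -1" using k by auto
    have xq: "a x q = 0" using flip[of x q] qx by simp
    have ql: "a q l = - \<omega> * a p q * a x l" if "l \<notin> {p,x,q}" for l using k that by blast
    have qn: "q < n" using supp q by blast
    have qne: "q \<noteq> p" "q \<noteq> x" using q by auto
    define e where "e = a p q"
    have e: "e = 1 \<or> e = -1" using r1(2) by (simp add: e_def)
    have X3: "(\<Sum>t\<in>{p,x}. nsq (a x t)) \<ge> 3" using xp xx ne by simp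
    show ?thesis
    proof (cases "\<exists>r. r \<notin> {p,x} \<and> a x r \<noteq> 0")
      case False
      then have x0: "\<forall>t. t \<notin> {p,x} \<longrightarrow> a x t = 0" by blast
      have q0: "a q t = 0" if "t \<notin> {p,x,q}" for t using ql[OF that] x0 that by simp
      have U: "{..<n} = {p, x, q}"
        by (rule closed_eq) (use n qn r1(3) x0 q0 in auto)
      show ?thesis
        by (rule embed_list[OF targets_mem(4) cyc_graph_S4, of "[(p, 0, 1), (x, 1, 1), (q, 2, e)]"])
          (use U px ne qne pp xx qq xq e e_def[symmetric] in \<open>simp_all add: S4_table\<close>)
    next
      case True
      then obtain r where r: "r \<notin> {p,x}" "a x r \<noteq> 0" by blast
      note r2 = residual1[OF _ X3 r, simplified]
      have rne: "r \<noteq> p" "r \<noteq> x" "r \<noteq> q" using r xq by auto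
      have rn: "r < n" using supp r by blast
      define g where "g = a x r"
      have g: "g = 1 \<or> g = -1" using r2(2) by (simp add: g_def)
      have qr: "a q r = e * g * (- \<omega>)" using ql[of r] rne by (simp add: e_def g_def)
      have nqr: "nsq (a q r) = 2" using e g unfolding qr by (auto simp: nsq_mult)
      have Xs: "(\<Sum>t\<in>{r,p,x}. nsq (a x t)) \<ge> 4" using r2(1) rne xp xx ne by simp
      have pr: "a p r = 0" using r1(3) rne by auto
      have "g * a r r - g = 0"
        using full(2)[OF _ Xs, of r] rne ne xp xx pr by (simp add: g_def)
      then have rr: "a r r = 1" using g by auto
      have qp: "nsq (a q p) = 1" using nsq_flip[of q p] r1(1) by simp
      have q0: "\<forall>t. t \<notin> {p,q,r} \<longrightarrow> a q t = 0"
        by (rule row_zero) (use qne rne qp qq nqr in auto)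
      have r0: "\<forall>t. t \<notin> {x,q,r} \<longrightarrow> a r t = 0"
        by (rule row_zero) (use qne rne r2(1) nsq_flip[of r x] rr nqr nsq_flip[of r q] in auto)
      have U: "{..<n} = {p, x, q, r}"
        by (rule closed_eq) (use n qn rn r1(3) r2(3) q0 r0 in auto)
      show ?thesis
        by (rule embed_list[OF targets_mem(4) cyc_graph_S4, of "[(p, 0, 1), (x, 1, 1), (q, 2, e), (r, 3, g)]"])
          (use U px ne qne rne pp xx qq xq rr pr qr e g e_def[symmetric] g_def[symmetric] in \<open>simp_all add: S4_table\<close>)
    qed
  next
    case False
    then have p0: "\<forall>t. t \<notin> {p,x} \<longrightarrow> a p t = 0" by blast
    \<comment> \<open>Here \<open>p\<close> is one short of saturation, so the minor bounds the
      weights at \<open>x\<close>. Charge 1 violates the bound; charge 0 turns \<open>x\<close> into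
      a leaf on an edge of weight 2, which \<open>leaf_false\<close> forbids.\<close>
    have mn: "nsq (\<omega> + \<omega> * a x x) \<le> 4 - (\<Sum>t\<in>G. nsq (a x t))" if "finite G" for G
    proof -
      have "nsq (\<Sum>t\<in>{p,x}. a p t * a t x) \<le> (4 - (\<Sum>t\<in>{p,x}. nsq (a p t))) * (4 - (\<Sum>t\<in>G. nsq (a x t)))"
        by (rule minorF) (use ne p0 that in auto)
      then show ?thesis using ne px pp by simp
    qed
    have x1: "a x x \<noteq> 1"
    proof
      assume "a x x = 1"
      moreover have "nsq (\<omega> + \<omega>) = 8" by (simp add: nsq_def cmod_def)
      ultimately show False using mn[of "{}"] by simp
    qed
    have x0: "a x x \<noteq> 0"
    proof
      assume z: "a x x = 0"
      have "a x t = 0" if "t \<noteq> p" for t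
      proof -
        have "nsq (a x t) \<le> 0" using mn[of "{p,t}"] z that xp by simp
        then have "nsq (a x t) = 0" using nsq_ge0[of "a x t"] by linarith
        then show ?thesis by simp
      qed
      then show False using leaf_false[of x p] xp by simp
    qed
    have xx: "a x x = -1" using xx_cases x0 x1 by blast
    have X3: "(\<Sum>t\<in>{p,x}. nsq (a x t)) \<ge> 3" using xp xx ne by simp
    show ?thesis
    proof (cases "\<exists>r. r \<notin> {p,x} \<and> a x r \<noteq> 0")
      case False
      then have x0: "\<forall>t. t \<notin> {p,x} \<longrightarrow> a x t = 0" by blast
      have U: "{..<n} = {p, x}"
        by (rule closed_eq) (use n p0 x0 in auto)
      show ?thesis
        by (rule embed_list[OF targets_mem(4) cyc_graph_S4, of "[(p, 0, 1), (x, 1, 1)]"])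
          (use U px ne pp xx in \<open>simp_all add: S4_table\<close>)
    next
      case True
      then obtain r where r: "r \<notin> {p,x}" "a x r \<noteq> 0" by blast
      note r2 = residual1[OF _ X3 r, simplified]
      have rne: "r \<noteq> p" "r \<noteq> x" using r by auto
      have rn: "r < n" using supp r by blast
      define g where "g = a x r"
      have g: "g = 1 \<or> g = -1" using r2(2) by (simp add: g_def)
      have Xs: "(\<Sum>t\<in>{r,p,x}. nsq (a x t)) \<ge> 4" using r2(1) rne xp xx ne by simp
      have pr: "a p r = 0" using p0 rne by auto
      have "g * a r r - g = 0"
        using full(2)[OF _ Xs, of r] rne ne xp xx pr by (simp add: g_def)
      then have rr: "a r r = 1" using g by auto
      have r0: "a r l = 0" if "l \<notin> {x,r}" for l
      proof (cases "l = p")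
        case True
        then show ?thesis using flip[of r p] pr by simp
      next
        case False
        have "a x l = 0" "a p l = 0" using r2(3) p0 that False by auto
        then have "g * a r l = 0" using full(2)[OF _ Xs, of l] that rne ne xp xx by (simp add: g_def)
        then show ?thesis using g by auto
      qed
      have U: "{..<n} = {p, x, r}"
        by (rule closed_eq) (use n rn p0 r2(3) r0 in auto)
      show ?thesis
        by (rule embed_list[OF targets_mem(4) cyc_graph_S4, of "[(p, 0, 1), (x, 1, 1), (r, 3, g)]"])
          (use U px ne rne pp xx rr pr g g_def[symmetric] in \<open>simp_all add: S4_table\<close>)
    qed
  qed
qed

lemma wlog_nsq:
  assumes w: "nsq (a p q) = 2 \<or> nsq (a p q) = 1" and pq: "p \<noteq> q"
    and P: "\<And>b. max_graph n b \<Longrightarrow> weights b = weights a \<Longrightarrow> b p q = (if nsq (a p q) = 2 then \<omega> else 1) \<Longrightarrow>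
      (\<And>i j. i \<noteq> q \<Longrightarrow> j \<noteq> q \<Longrightarrow> b i j = a i j) \<Longrightarrow> listed n b"
  shows "listed n a"
proof (rule wlog_sign[OF _ pq])
  show "a p q = (if nsq (a p q) = 2 then \<omega> else 1) \<or> a p q = - (if nsq (a p q) = 2 then \<omega> else 1)"
    using w lab_cases(2,3)[of p q] by auto
qed (rule P)

lemma charged:
  assumes tm: "light_matching (weights a)" and px: "nsq (a p x) = 2" and pp: "a p p \<noteq> 0"
  shows "listed n a"
proof -
  have ne: "p \<noteq> x" using loop_ne[of p x] px by simp
  have pos: "listed n b" if b: "max_graph n b" "weights b = weights a" "b p p = 1" for b
  proof -
    interpret b: max_graph n b by fact
    show ?thesis
    proof (rule b.wlog_nsq[of p x])
      show "nsq (b p x) = 2 \<or> nsq (b p x) = 1" using px weights_eqD[OF b(2)] by simp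
      show "p \<noteq> x" by fact
      fix c assume c: "max_graph n c" "weights c = weights b" "c p x = (if nsq (b p x) = 2 then \<omega> else 1)"
        "\<And>i j. i \<noteq> x \<Longrightarrow> j \<noteq> x \<Longrightarrow> c i j = b i j"
      show "listed n c"
        by (rule max_graph.charged_main[OF c(1), of p x]) (use tm c b ne px weights_eqD[OF b(2)] in auto)
    qed
  qed
  consider "a p p = 1" | "a p p = -1" using diag[of p] pp by auto
  then show ?thesis
  proof cases
    case 1
    then show ?thesis by (rule pos[OF max_graph_axioms refl])
  next
    case 2
    have "weights (\<lambda>i j. - a i j) = weights a" by (intro ext) (simp add: weights_def)
    then have "listed n (\<lambda>i j. - a i j)" using 2 by (intro pos[OF max_graph_neg[OF max_graph_axioms]]) auto
    then show ?thesis by (rule listed_neg)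
  qed
qed

end

section \<open>Matched edges of weight 2 with uncharged ends\<close>

definition uncharged_ends :: "(nat \<Rightarrow> nat \<Rightarrow> real) \<Rightarrow> bool" where
  "uncharged_ends w \<longleftrightarrow> (\<forall>i j. w i j = 2 \<longrightarrow> w i i = 0)"

lemma uncharged_endsD: "uncharged_ends (weights a) \<Longrightarrow> nsq (a i j) = 2 \<Longrightarrow> a i i = 0"
  unfolding uncharged_ends_def weights_def by (metis nsq_0)

text \<open>In a light matching with uncharged ends, \<open>leaf_false\<close> leaves one or two
  further neighbours of weight 1 at an end of a weight-2 edge. This is the case of one throughout:
  every such end is one short of saturation, and \<open>minorF\<close> applies with first factor
  1.\<close>

definition nonfull :: "(nat \<Rightarrow> nat \<Rightarrow> real) \<Rightarrow> bool" where
  "nonfull w \<longleftrightarrow> (\<forall>i j. w i j = 2 \<longrightarrow> (\<exists>q. q \<noteq> j \<and> w i q = 1 \<and> (\<forall>t. t \<noteq> j \<longrightarrow> t \<noteq> q \<longrightarrow> w i t = 0)))"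

context max_graph
begin

text \<open>Saturation of \<open>p\<close> gives \<omega> times row x plus row q plus row r equal to
  0 away from \<open>p\<close>. With a x q = -1 this determines all labels among the four vertices
  once \<open>q\<close> is uncharged, and a charge of \<open>q\<close> would give the edge {q, r}
  weight 3.\<close>

lemma s4_star_case:
  assumes tm: "light_matching (weights a)" and un: "uncharged_ends (weights a)" and px: "a p x = \<omega>" and pq: "a p q = 1" and pr: "a p r = 1"
    and qr: "q \<noteq> r" and xq: "a x q = -1"
  shows "listed n a"
proof -
  have xp: "a x p = -\<omega>" using flip[of x p] px by simp
  have pp: "a p p = 0" and xx: "a x x = 0" using uncharged_endsD[OF un, of p x] uncharged_endsD[OF un, of x p] px xp by auto
  have ne: "p \<noteq> x" "p \<noteq> q" "p \<noteq> r" "x \<noteq> q" "x \<noteq> r" using pp px pq pr by auto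
  have n: "p < n" "x < n" "q < n" "r < n" using supp[of p x] supp[of p q] supp[of p r] px pq pr by auto
  have Fs: "(\<Sum>t\<in>{x,q,r}. nsq (a p t)) \<ge> 4" using ne qr px pq pr by simp
  have p0: "\<forall>t. t \<notin> {x,q,r} \<longrightarrow> a p t = 0" by (rule row_zero[OF _ Fs]) simp
  have row: "\<omega> * a x l + a q l + a r l = 0" if "l \<noteq> p" for l
    using full(2)[OF _ Fs that] ne qr px pq pr by (simp add: add.assoc)
  have qx: "a q x = -1" using flip[of q x] xq by simp
  have rx: "a r x = 1" using row[of x] ne xx qx by simp
  then have xr: "a x r = 1" using flip[of x r] by simp
  have "(a q q - \<omega>) + a r q = 0" using row[of q] ne xq by simp
  then have rq: "a r q = \<omega> - a q q" using minus_eqI by fastforce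
  have qq: "a q q = 0"
  proof (rule ccontr)
    assume "a q q \<noteq> 0"
    then have "a q q = 1 \<or> a q q = -1" using diag[of q] by auto
    then have "nsq (a r q) = 3" unfolding rq by (auto simp: add.commute)
    then show False using light_matching_le[OF tm, of r q] by simp
  qed
  have rq': "a r q = \<omega>" using rq qq by simp
  then have qr': "a q r = -\<omega>" using flip[of q r] by simp
  have rr: "a r r = 0" using row[of r] ne xr qr' by simp
  have x0: "\<forall>t. t \<notin> {p,q,r} \<longrightarrow> a x t = 0" by (rule row_zero) (use ne qr xp xq xr in auto)
  have qp: "a q p = 1" "a r p = 1" using flip[of q p] flip[of r p] pq pr by auto
  have q0: "\<forall>t. t \<notin> {p,x,r} \<longrightarrow> a q t = 0" by (rule row_zero) (use ne qr qx qr' qp in auto)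
  have r0: "\<forall>t. t \<notin> {p,x,q} \<longrightarrow> a r t = 0" by (rule row_zero) (use ne qr rx rq' qp in auto)
  have U: "{..<n} = {p, x, q, r}" by (rule closed_eq) (use n p0 x0 q0 r0 in auto)
  show ?thesis
    by (rule embed_list[OF targets_mem(5) cyc_graph_S4_star, of "[(p, 0, 1), (x, 1, 1), (q, 2, 1), (r, 3, 1)]"])
      (use U px pq pr ne qr pp xx qq rr xq xr qr' in \<open>simp_all add: S4_star_table\<close>)
qed

text \<open>\<open>p\<close> is saturated, row \<open>r\<close> is determined by rows
  \<open>x\<close> and \<open>q\<close>, and each of \<open>x\<close>, \<open>q\<close>,
  \<open>l\<close> has one unit of weight left. So at most three vertices remain, one for each unit;
  the saturation relations give their rows, and the whole graph is an induced subgraph of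
  \<open>S8_star\<close>.\<close>

lemma s8_case:
  assumes tm: "light_matching (weights a)" and un: "uncharged_ends (weights a)" and px: "a p x = \<omega>" and pq: "a p q = 1" and pr: "a p r = 1"
    and qr: "q \<noteq> r" and xq: "a x q = 0" and xl: "a x l = 1" and ql: "a q l = -\<omega>"
  shows "listed n a"
proof -
  have xp: "a x p = -\<omega>" using flip[of x p] px by simp
  have pp: "a p p = 0" and xx: "a x x = 0" using uncharged_endsD[OF un, of p x] uncharged_endsD[OF un, of x p] px xp by auto
  have ne: "p \<noteq> x" "p \<noteq> q" "p \<noteq> r" "x \<noteq> q" "x \<noteq> r" using pp px pq pr by auto
  have n: "p < n" "x < n" "q < n" "r < n" "l < n"
    using supp[of p x] supp[of p q] supp[of p r] supp[of x l] px pq pr xl by auto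
  have Fs: "(\<Sum>t\<in>{x,q,r}. nsq (a p t)) \<ge> 4" using ne qr px pq pr by simp
  have p0: "\<forall>t. t \<notin> {x,q,r} \<longrightarrow> a p t = 0" by (rule row_zero[OF _ Fs]) simp
  have row: "\<omega> * a x t + a q t + a r t = 0" if "t \<noteq> p" for t
    using full(2)[OF _ Fs that] ne qr px pq pr by (simp add: add.assoc)
  have qx: "a q x = 0" using flip[of q x] xq by simp
  have rx: "a r x = 0" using row[of x] ne xx qx by simp
  then have xr: "a x r = 0" using flip[of x r] by simp
  have lq: "a l q = \<omega>" and lx: "a l x = 1" using flip[of l q] flip[of l x] ql xl by auto
  have ll: "a l l = 0" and qq: "a q q = 0" using uncharged_endsD[OF un, of l q] uncharged_endsD[OF un, of q l] lq ql by auto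
  have nel: "l \<noteq> p" "l \<noteq> x" "l \<noteq> q" "l \<noteq> r" using xl xp xx xq xr by auto
  have rl: "a r l = 0" using row[of l] nel xl ql by simp
  then have lr: "a l r = 0" using flip[of l r] by simp
  have rq: "a r q = 0" using row[of q] ne xq qq by simp
  then have qr0: "a q r = 0" using flip[of q r] by simp
  have rr: "a r r = 0" using row[of r] ne xr qr0 by simp
  have pl: "a p l = 0" using p0 nel by auto
  then have lp: "a l p = 0" using flip[of l p] by simp
  have qp: "a q p = 1" "a r p = 1" using flip[of q p] flip[of r p] pq pr by auto
  \<comment> \<open>The vertices outside \<open>B\<close> adjacent to \<open>x\<close>, \<open>q\<close> and \<open>l\<close> will be the (0-based) vertices 7, 5 and 6 of
    \<open>S8_star\<close>; the facts \<open>K\<close>, \<open>M\<close> and \<open>H\<close> below describe them.\<close>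
  define B where "B = {p,x,q,r,l}"
  have tB: "t \<noteq> p" "t \<noteq> x" "t \<noteq> q" "t \<noteq> r" "t \<noteq> l" if "t \<notin> B" for t using that by (auto simp: B_def)
  have pB: "a p t = 0" if "t \<notin> B" for t using p0 tB[OF that] by auto
  have X3: "(\<Sum>t\<in>{p,l}. nsq (a x t)) \<ge> 3" using xp xl nel by simp
  have Q3: "(\<Sum>t\<in>{p,l}. nsq (a q t)) \<ge> 3" using qp ql nel by simp
  have L3: "(\<Sum>t\<in>{x,q}. nsq (a l t)) \<ge> 3" using lx lq ne by simp
  have rB: "a r t = - (\<omega> * a x t + a q t)" if "t \<notin> B" for t
    using minus_eqI[OF row[OF tB(1)[OF that]]] .
  have K: "(a x k = 1 \<or> a x k = -1) \<and> a q k = 0 \<and> a l k = 0 \<and> a k k = 0 \<and>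
      (\<forall>t. a x t \<noteq> 0 \<longrightarrow> t \<notin> B \<longrightarrow> t = k) \<and> (\<forall>t. t \<notin> B \<longrightarrow> a k t = - a x k * a l t)"
    if k: "k \<notin> B" "a x k \<noteq> 0" for k
  proof -
    note kB = tB[OF k(1)]
    have kF: "k \<notin> {p,l}" using kB by auto
    note R = residual1[OF _ X3 kF k(2), simplified]
    \<comment> \<open>A common outer neighbour of \<open>x\<close> and \<open>q\<close> would be
      joined to \<open>r\<close> by an edge of weight 3.\<close>
    have qk: "a q k = 0"
    proof (rule ccontr)
      assume nz: "a q k \<noteq> 0"
      have "a q k = 1 \<or> a q k = -1"
        using small_cases[OF tm, of q k] nz light_matching_eq[OF tm, of q k l] ql kB by auto
      then have "nsq (a r k) = 3" unfolding rB[OF k(1)] using R(2) by (auto simp: add.commute)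
      then show False using light_matching_le[OF tm, of r k] by simp
    qed
    have "nsq (a r k) = 2" unfolding rB[OF k(1)] using R(2) qk by auto
    then have kk: "a k k = 0" using uncharged_endsD[OF un, of k r] nsq_flip[of k r] by simp
    have Fx: "(\<Sum>t\<in>{k,p,l}. nsq (a x t)) \<ge> 4" using R(1) xp xl kB nel by simp
    have xrow: "a x k * a k t + (a l t - \<omega> * a p t) = 0" if "t \<noteq> x" for t
      using full(2)[OF _ Fx that] xp xl kB nel by (simp add: add.assoc)
    have lk: "a l k = 0" using xrow[OF kB(2)] kk pB[OF k(1)] by simp
    have "a k t = - a x k * a l t" if "t \<notin> B" for t
    proof -
      have "a x k * a k t + a l t = 0" using xrow[OF tB(2)[OF that]] pB[OF that] by simp
      then have "a l t = - (a x k * a k t)" by (rule minus_eqI)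
      then show ?thesis using R(2) by auto
    qed
    moreover have "t = k" if "a x t \<noteq> 0" "t \<notin> B" for t using R(3) that tB[OF that(2)] by auto
    ultimately show ?thesis using R(2) qk lk kk by blast
  qed
  have M: "(a q m = 1 \<or> a q m = -1) \<and> a x m = 0 \<and> a l m = 0 \<and> a m m = 0 \<and>
      (\<forall>t. a q t \<noteq> 0 \<longrightarrow> t \<notin> B \<longrightarrow> t = m) \<and> (\<forall>t. t \<notin> B \<longrightarrow> a m t = \<omega> * a q m * a l t)"
    if m: "m \<notin> B" "a q m \<noteq> 0" for m
  proof -
    note mB = tB[OF m(1)]
    have mF: "m \<notin> {p,l}" using mB by auto
    note R = residual1[OF _ Q3 mF m(2), simplified]
    have xm: "a x m = 0" using K[OF m(1)] m(2) by blast
    have Fq: "(\<Sum>t\<in>{m,p,l}. nsq (a q t)) \<ge> 4" using R(1) qp ql mB nel by simp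
    have qrow: "a q m * a m t + (a p t - \<omega> * a l t) = 0" if "t \<noteq> q" for t
      using full(2)[OF _ Fq that] qp ql mB nel by (simp add: add.assoc)
    have "a q m * a m m = \<omega> * a l m" using qrow[OF mB(3)] pB[OF m(1)] by simp
    then have "nsq (a q m * a m m) = nsq (\<omega> * a l m)" by simp
    \<comment> \<open>A charge has norm at most 1, whereas twice a nonzero norm is at least 2, so
      both sides vanish.\<close>
    then have e: "nsq (a m m) = 2 * nsq (a l m)" using R(1) by (simp add: nsq_mult)
    have "nsq (a m m) \<le> 1" using diag[of m] by auto
    then have lm: "a l m = 0" using e nz_ge1[of l m] by fastforce
    then have mm: "a m m = 0" using e by simp
    have "a m t = \<omega> * a q m * a l t" if "t \<notin> B" for t
    proof -
      have "a q m * a m t = \<omega> * a l t" using qrow[OF tB(3)[OF that]] pB[OF that] by simp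
      then have e': "a q m * (a q m * a m t) = a q m * (\<omega> * a l t)" by simp
      have f: "a q m * (a q m * z) = z" for z using R(2) by auto
      show ?thesis using e' unfolding f by (simp add: mult_ac)
    qed
    moreover have "t = m" if "a q t \<noteq> 0" "t \<notin> B" for t using R(3) that tB[OF that(2)] by auto
    ultimately show ?thesis using R(2) xm lm mm by blast
  qed
  have H: "(a l h = 1 \<or> a l h = -1) \<and> a x h = 0 \<and> a q h = 0 \<and> a h h = 0 \<and>
      (\<forall>t. a l t \<noteq> 0 \<longrightarrow> t \<notin> B \<longrightarrow> t = h) \<and> (\<forall>t. t \<notin> B \<longrightarrow> a h t = - a l h * (a x t + \<omega> * a q t))"
    if h: "h \<notin> B" "a l h \<noteq> 0" for h
  proof -
    note hB = tB[OF h(1)]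
    have hF: "h \<notin> {x,q}" using hB by auto
    note R = residual1[OF _ L3 hF h(2), simplified]
    have xh: "a x h = 0" using K[OF h(1)] h(2) by blast
    have qh: "a q h = 0" using M[OF h(1)] h(2) by blast
    have Fl: "(\<Sum>t\<in>{h,x,q}. nsq (a l t)) \<ge> 4" using R(1) lx lq hB ne by simp
    have lrow: "a l h * a h t + (a x t + \<omega> * a q t) = 0" if "t \<noteq> l" for t
      using full(2)[OF _ Fl that] lx lq hB ne by (simp add: add.assoc)
    have hh: "a h h = 0" using lrow[OF hB(5)] xh qh h(2) by simp
    have "a h t = - a l h * (a x t + \<omega> * a q t)" if "t \<notin> B" for t
    proof -
      have "a x t + \<omega> * a q t = - (a l h * a h t)" using minus_eqI[OF lrow[OF tB(5)[OF that]]] .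
      then show ?thesis using R(2) by auto
    qed
    moreover have "t = h" if "a l t \<noteq> 0" "t \<notin> B" for t using R(3) that tB[OF that(2)] by auto
    ultimately show ?thesis using R(2) xh qh hh by blast
  qed
  have K1: "(a x k = 1 \<or> a x k = -1) \<and> a q k = 0 \<and> a l k = 0 \<and> a k k = 0" if "k \<notin> B" "a x k \<noteq> 0" for k
    using K[OF that] by blast
  have M1: "(a q m = 1 \<or> a q m = -1) \<and> a x m = 0 \<and> a l m = 0 \<and> a m m = 0" if "m \<notin> B" "a q m \<noteq> 0" for m
    using M[OF that] by blast
  have H1: "(a l h = 1 \<or> a l h = -1) \<and> a x h = 0 \<and> a q h = 0 \<and> a h h = 0" if "h \<notin> B" "a l h \<noteq> 0" for h
    using H[OF that] by blast
  have uniq: "i = j" if "i \<notin> B" "j \<notin> B" "a x i \<noteq> 0 \<and> a x j \<noteq> 0 \<or> a q i \<noteq> 0 \<and> a q j \<noteq> 0 \<or> a l i \<noteq> 0 \<and> a l j \<noteq> 0" for i j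
    using that K[OF that(2)] M[OF that(2)] H[OF that(2)] by blast
  \<comment> \<open>Outer neighbours of \<open>r\<close> are included, because by \<open>rB\<close>
    they are neighbours of \<open>x\<close> or of \<open>q\<close>.\<close>
  define C where "C = B \<union> {t. t \<notin> B \<and> (a x t \<noteq> 0 \<or> a q t \<noteq> 0 \<or> a l t \<noteq> 0)}"
  have "{..<n} = C"
  proof (rule closed_eq)
    show "C \<subseteq> {..<n}" using n supp unfolding C_def B_def by auto
    show "C \<noteq> {}" by (auto simp: C_def B_def)
    fix i t assume i: "i \<in> C" and t: "t \<notin> C"
    have tB': "t \<notin> B" and z: "a x t = 0" "a q t = 0" "a l t = 0" using t by (auto simp: C_def)
    consider "i = p" | "i = x" | "i = q" | "i = r" | "i = l" | "i \<notin> B" "a x i \<noteq> 0" | "i \<notin> B" "a q i \<noteq> 0" | "i \<notin> B" "a l i \<noteq> 0"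
      using i unfolding C_def B_def by blast
    then show "a i t = 0"
    proof cases
      case 6
      then have "a i t = - a x i * a l t" using K[OF 6] tB' by blast
      then show ?thesis using z by simp
    next
      case 7
      then have "a i t = \<omega> * a q i * a l t" using M[OF 7] tB' by blast
      then show ?thesis using z by simp
    next
      case 8
      then have "a i t = - a l i * (a x t + \<omega> * a q t)" using H[OF 8] tB' by blast
      then show ?thesis using z by simp
    qed (use pB[OF tB'] rB[OF tB'] z in auto)
  qed
  then have inC: "i \<in> C" if "i < n" for i using that by auto
  define f where "f = (\<lambda>t. if t = p then 0 else if t = x then 3 else if t = q then 1 else if t = r then 4 else if t = l then 2
      else if a x t \<noteq> 0 then 7 else if a q t \<noteq> 0 then 5 else 6 :: nat)"
  define s where "s = (\<lambda>t. if t \<in> B then 1 else if a x t \<noteq> 0 then a x t else if a q t \<noteq> 0 then a q t else a l t)"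
  have cls: "i \<in> B \<or> i \<notin> B \<and> a x i \<noteq> 0 \<and> f i = 7 \<and> s i = a x i \<or>
       i \<notin> B \<and> a q i \<noteq> 0 \<and> f i = 5 \<and> s i = a q i \<or> i \<notin> B \<and> a l i \<noteq> 0 \<and> f i = 6 \<and> s i = a l i"
    if ii: "i < n" for i
  proof (cases "i \<in> B")
    case False
    note iB = tB[OF False]
    consider "a x i \<noteq> 0" | "a q i \<noteq> 0" | "a l i \<noteq> 0" using inC[OF ii] False unfolding C_def by blast
    then show ?thesis
    proof cases
      case 1
      then have "f i = 7 \<and> s i = a x i" using iB False by (simp add: f_def s_def)
      then show ?thesis using 1 False by blast
    next
      case 2
      then have "f i = 5 \<and> s i = a q i" using iB False M1[OF False 2] by (simp add: f_def s_def)
      then show ?thesis using 2 False by blast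
    next
      case 3
      then have "f i = 6 \<and> s i = a l i" using iB False H1[OF False 3] by (simp add: f_def s_def)
      then show ?thesis using 3 False by blast
    qed
  qed simp
  have fb: "f p = 0" "f x = 3" "f q = 1" "f r = 4" "f l = 2" "s p = 1" "s x = 1" "s q = 1" "s r = 1" "s l = 1"
    using ne nel qr by (auto simp: f_def s_def B_def)
  have f8: "f i < 8" for i by (simp add: f_def)
  have srange: "s i = 1 \<or> s i = -1" if ii: "i < n" for i
  proof (cases "i \<in> B")
    case True
    then show ?thesis by (simp add: s_def)
  next
    case False
    then consider "a x i \<noteq> 0" "s i = a x i" | "a q i \<noteq> 0" "s i = a q i" | "a l i \<noteq> 0" "s i = a l i"
      using cls[OF ii] by blast
    then show ?thesis
    proof cases
      case 1
      then show ?thesis using K1[OF False 1(1)] by simp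
    next
      case 2
      then show ?thesis using M1[OF False 2(1)] by simp
    next
      case 3
      then show ?thesis using H1[OF False 3(1)] by simp
    qed
  qed
  interpret S: cyc_graph 8 "entry S8_star" by (rule cyc_graph_S8_star)
  have eqB: "a i j = s i * s j * entry S8_star (f i) (f j)" if i: "i \<in> B" and j: "j < n" for i j
  proof -
    have i': "i = p \<or> i = x \<or> i = q \<or> i = r \<or> i = l" using i by (auto simp: B_def)
    consider "j = p" | "j = x" | "j = q" | "j = r" | "j = l" | "j \<notin> B" "a x j \<noteq> 0" "f j = 7" "s j = a x j"
      | "j \<notin> B" "a q j \<noteq> 0" "f j = 5" "s j = a q j" | "j \<notin> B" "a l j \<noteq> 0" "f j = 6" "s j = a l j"
      using cls[OF j] unfolding B_def by blast
    then show ?thesis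
    proof cases
      case 1
      show ?thesis using i' unfolding 1 by (elim disjE) (simp_all add: fb S8_star_table pp xp qp lp)
    next
      case 2
      show ?thesis using i' unfolding 2 by (elim disjE) (simp_all add: fb S8_star_table px xx qx rx lx)
    next
      case 3
      show ?thesis using i' unfolding 3 by (elim disjE) (simp_all add: fb S8_star_table pq xq qq rq lq)
    next
      case 4
      show ?thesis using i' unfolding 4 by (elim disjE) (simp_all add: fb S8_star_table pr xr qr0 rr lr)
    next
      case 5
      show ?thesis using i' unfolding 5 by (elim disjE) (simp_all add: fb S8_star_table pl xl ql rl ll)
    next
      case 6
      note k = K1[OF 6(1,2)] pB[OF 6(1)] rB[OF 6(1)]
      show ?thesis using i' k by (elim disjE) (simp_all add: fb 6 S8_star_table)
    next
      case 7
      note k = M1[OF 7(1,2)] pB[OF 7(1)] rB[OF 7(1)]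
      show ?thesis using i' k by (elim disjE) (simp_all add: fb 7 S8_star_table)
    next
      case 8
      note k = H1[OF 8(1,2)] pB[OF 8(1)] rB[OF 8(1)]
      show ?thesis using i' k by (elim disjE) (simp_all add: fb 8 S8_star_table)
    qed
  qed
  show ?thesis
  proof (rule embed_sgn[OF targets_mem(6) cyc_graph_S8_star, of f s])
    show "inj_on f {..<n}"
    proof (rule inj_onI)
      fix i j assume "i \<in> {..<n}" "j \<in> {..<n}" and fe: "f i = f j"
      then have ij: "i < n" "j < n" by auto
      have lowB: "f t \<in> {0,1,2,3,4}" if "t \<in> B" for t using that fb by (auto simp: B_def)
      consider "i \<in> B" "j \<in> B" | "i \<notin> B" "j \<notin> B"
        using cls[OF ij(1)] cls[OF ij(2)] lowB[of i] lowB[of j] fe by auto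
      then show "i = j"
      proof cases
        case 1
        then show ?thesis using fe fb by (auto simp: B_def)
      next
        case 2
        then show ?thesis using cls[OF ij(1)] cls[OF ij(2)] fe by (intro uniq) auto
      qed
    qed
    show "f ` {..<n} \<subseteq> {..<8}" using f8 by auto
    show "s i \<in> {1, -1}" if "i < n" for i using srange[OF that] by auto
    fix i j assume ij: "i < n" "j < n"
    show "a i j = s i * s j * entry S8_star (f i) (f j)"
    proof (cases "i \<in> B")
      case True
      then show ?thesis using eqB ij by blast
    next
      case iB: False
      show ?thesis
      proof (cases "j \<in> B")
        case True
        have "cnj (s i) = s i" "cnj (s j) = s j" using srange[OF ij(1)] srange[OF ij(2)] by auto
        then show ?thesis using eqB[OF True ij(1)] flip[of i j] S.flip[of "f i" "f j"] by simp
      next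
        case jB: False
        have j': "a q j = 0 \<and> a l j = 0 \<and> f j = 7 \<and> s j = a x j \<or>
            a x j = 0 \<and> a l j = 0 \<and> f j = 5 \<and> s j = a q j \<or> a x j = 0 \<and> a q j = 0 \<and> f j = 6 \<and> s j = a l j"
          using cls[OF ij(2)] jB K1[OF jB] M1[OF jB] H1[OF jB] by blast
        consider "a x i \<noteq> 0" "f i = 7" "s i = a x i" | "a q i \<noteq> 0" "f i = 5" "s i = a q i" | "a l i \<noteq> 0" "f i = 6" "s i = a l i"
          using cls[OF ij(1)] iB by blast
        then show ?thesis
        proof cases
          case 1
          then have "a i j = - a x i * a l j" using K[OF iB] jB by blast
          then show ?thesis using j' unfolding 1
            by (elim disjE conjE) (simp_all add: S8_star_table)
        next
          case 2
          then have "a i j = \<omega> * a q i * a l j" using M[OF iB] jB by blast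
          then show ?thesis using j' unfolding 2
            by (elim disjE conjE) (simp_all add: S8_star_table)
        next
          case 3
          then have "a i j = - a l i * (a x j + \<omega> * a q j)" using H[OF iB] jB by blast
          then show ?thesis using j' unfolding 3
            by (elim disjE conjE) (simp_all add: S8_star_table)
        qed
      qed
    qed
  qed
qed

end

context max_graph
begin

text \<open>\<open>x\<close> is one short of saturation and the (x, q) entry of A^2 is -w, of norm
  2, so the minor of \<open>x\<close> and \<open>q\<close> leaves \<open>q\<close> a total weight of
  at most 2. A second nonzero entry in row \<open>q\<close> makes this minor vanish, and
  \<open>null2\<close> then expresses the next row through row \<open>l\<close>. Both values of
  \<open>w\<close> are needed to apply the lemma from either end of the edge.\<close>

lemma path_end:
  assumes w: "w = \<omega> \<or> w = -\<omega>" and px: "a p x = w" and pq: "a p q = 1" and xl: "a x l = 1"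
    and p0: "\<forall>t. t \<notin> {x,q} \<longrightarrow> a p t = 0" and x0: "\<forall>t. t \<notin> {p,l} \<longrightarrow> a x t = 0"
    and ql: "a q l = 0" and ne: "p \<noteq> x" "p \<noteq> q" "p \<noteq> l" "x \<noteq> q" "x \<noteq> l" "q \<noteq> l"
  shows "a q q = 0"
    and "m \<noteq> p \<Longrightarrow> a q m \<noteq> 0 \<Longrightarrow> (a q m = 1 \<or> a q m = -1) \<and> m \<notin> {p,x,q,l} \<and> (\<forall>t. t \<notin> {p,m} \<longrightarrow> a q t = 0) \<and>
      a m m = 0 \<and> (\<forall>t. t \<notin> {x,q} \<longrightarrow> a m t = - w * a q m * a l t)"
proof -
  have nw: "nsq w = 2" using w by auto
  have xp: "a x p = - w" using flip[of x p] px w by auto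
  have lq: "a l q = 0" using flip[of l q] ql by simp
  have qp: "a q p = 1" using flip[of q p] pq by simp
  have xq: "a x q = 0" using x0 ne by auto
  have qx: "a q x = 0" using flip[of q x] xq by simp
  have pp: "a p p = 0" using p0 ne by auto
  have pl: "a p l = 0" using p0 ne by auto
  have lp: "a l p = 0" using flip[of l p] pl by simp
  have n: "x < n" "q < n" using supp[of p x] supp[of p q] px pq w by auto
  have G2: "(\<Sum>t\<in>G. nsq (a q t)) \<le> 2" if "finite G" for G
  proof -
    have "nsq (\<Sum>t\<in>{p,l}. a x t * a t q) \<le> (4 - (\<Sum>t\<in>{p,l}. nsq (a x t))) * (4 - (\<Sum>t\<in>G. nsq (a q t)))"
      by (rule minorF) (use ne x0 that in auto)
    then show ?thesis using ne xp xl pq lq nw by simp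
  qed
  have N: "(a q m = 1 \<or> a q m = -1) \<and> (\<forall>t. t \<notin> {p,m} \<longrightarrow> a q t = 0) \<and>
     (\<forall>t. t \<notin> {x,q} \<longrightarrow> a p t + a q m * a m t = - (w + a q m * a m x) * (- w * a p t + a l t))"
    if m: "m \<noteq> p" "a q m \<noteq> 0" "a m x = 0" for m
  proof -
    have "nsq (a q m) \<le> 1" using G2[of "{p,m}"] m qp by simp
    then have m1: "nsq (a q m) = 1" using nz_ge1[OF m(2)] by simp
    have q0: "a q t = 0" if "t \<notin> {p,m}" for t
    proof -
      have "nsq (a q t) \<le> 0" using G2[of "{t,p,m}"] that m qp m1 by simp
      then have "nsq (a q t) = 0" using nsq_ge0[of "a q t"] by linarith
      then show ?thesis by simp
    qed
    have "a p t + a q m * a m t = - (w + a q m * a m x) * (- w * a p t + a l t)" if t: "t \<notin> {x,q}" for t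
    proof -
      have "(\<Sum>s\<in>{p,m}. a q s * a s t) = - (\<Sum>s\<in>{p,m}. a q s * a s x) * (\<Sum>s\<in>{p,l}. a x s * a s t)"
        by (rule null2) (use x0 q0 ne m qp m1 xp xl nw px t n in auto)
      then show ?thesis using ne m qp xp xl px by simp
    qed
    then show ?thesis using lab_cases(2)[OF m1] q0 by blast
  qed
  \<comment> \<open>A charge of \<open>q\<close> is the case m = q of \<open>N\<close>; at t = p the
    identity becomes a q q = 0.\<close>
  show qq: "a q q = 0"
  proof (rule ccontr)
    assume nz: "a q q \<noteq> 0"
    have "a p p + a q q * a q p = - (w + a q q * a q x) * (- w * a p p + a l p)"
      using N[OF ne(2)[symmetric] nz qx] ne by blast
    then show False using pp lp qp nz by simp
  qed
  assume m: "m \<noteq> p" "a q m \<noteq> 0"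
  have mB: "m \<notin> {p,x,q,l}" using m qq qx ql by auto
  have mx: "a m x = 0" using flip[of m x] x0 mB by auto
  note N1 = N[OF m mx]
  have f: "a q m * (a q m * z) = z" for z using N1 by auto
  have mt: "a m t = - w * a q m * a l t" if t: "t \<notin> {x,q}" for t
  proof -
    have "a q m * a m t = - w * a l t" using N1 t mx p0 by fastforce
    then have "a q m * (a q m * a m t) = a q m * (- w * a l t)" by simp
    then show ?thesis unfolding f by (simp add: mult_ac)
  qed
  have "nsq (a m m) = 2 * nsq (a l m)"
    using arg_cong[OF mt[of m], of nsq] mB N1 nw by (auto simp: nsq_mult)
  moreover have "nsq (a m m) \<le> 1" using diag[of m] by auto
  ultimately have "a m m = 0" using nz_ge1[of l m] by (cases "a l m = 0") auto
  then show "(a q m = 1 \<or> a q m = -1) \<and> m \<notin> {p,x,q,l} \<and> (\<forall>t. t \<notin> {p,m} \<longrightarrow> a q t = 0) \<and>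
      a m m = 0 \<and> (\<forall>t. t \<notin> {x,q} \<longrightarrow> a m t = - w * a q m * a l t)"
    using N1 mB mt by blast
qed

text \<open>\<open>p\<close> is one short of saturation, so the minor with \<open>q\<close> bounds
  the weights at \<open>q\<close>: the edge {x, q} has weight 1, \<open>q\<close> is uncharged, and
  nothing else is attached. What is left is a triangle, a proper part of
  \<open>S4_star\<close>.\<close>

lemma nonfull_triangle:
  assumes un: "uncharged_ends (weights a)" and px: "a p x = \<omega>" and pq: "a p q = 1" and xq: "a x q \<noteq> 0"
    and p0: "\<forall>t. t \<notin> {x,q} \<longrightarrow> a p t = 0" and x0: "\<forall>t. t \<notin> {p,q} \<longrightarrow> a x t = 0"
  shows "listed n a"
proof -
  have xp: "a x p = -\<omega>" using flip[of x p] px by simp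
  have pp: "a p p = 0" and xx: "a x x = 0" using uncharged_endsD[OF un, of p x] uncharged_endsD[OF un, of x p] px xp by auto
  have ne: "p \<noteq> x" "p \<noteq> q" "x \<noteq> q" using pp px pq by auto
  have n: "p < n" "x < n" "q < n" using supp[of p x] supp[of p q] px pq by auto
  have "(\<Sum>t\<in>{p,q}. nsq (a x t)) \<le> 4" by (rule sum_le) simp
  then have "nsq (a x q) \<le> 2" using ne xp by simp
  have mn: "nsq (\<omega> * a x q + a q q) \<le> 4 - (\<Sum>t\<in>G. nsq (a q t))" if "finite G" for G
  proof -
    have "nsq (\<Sum>t\<in>{x,q}. a p t * a t q) \<le> (4 - (\<Sum>t\<in>{x,q}. nsq (a p t))) * (4 - (\<Sum>t\<in>G. nsq (a q t)))"
      by (rule minorF) (use ne p0 that in auto)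
    then show ?thesis using ne px pq by simp
  qed
  have qp: "a q p = 1" using flip[of q p] pq by simp
  have nqx: "nsq (a q x) = nsq (a x q)" by (rule nsq_flip)
  have "nsq (a x q) = 1"
  proof (rule ccontr)
    assume "nsq (a x q) \<noteq> 1"
    then have "nsq (a x q) = 2" using lab_cases(1)[of x q] \<open>nsq (a x q) \<le> 2\<close> nz_ge1[OF xq] by auto
    then have "a x q = \<omega> \<or> a x q = -\<omega>" "a q q = 0"
      using lab_cases(3) uncharged_endsD[OF un, of q x] nqx by auto
    then have "nsq (\<omega> * a x q + a q q) = 4" by (auto simp: nsq_def)
    then show False using mn[of "{p}"] qp by simp
  qed
  then have x1: "a x q = 1 \<or> a x q = -1" by (rule lab_cases(2))
  have qc: "a q q = 0 \<or> a q q = 1 \<or> a q q = -1" using diag[of q] by auto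
  have e: "nsq (\<omega> * a x q + a q q) = 2 + nsq (a q q)"
    using x1 qc by (elim disjE) (simp_all add: nsq_def cmod_def)
  have qq: "a q q = 0"
  proof -
    have "2 * nsq (a q q) \<le> 0" using mn[of "{p,x,q}"] ne qp nqx x1 e by auto
    then have "nsq (a q q) = 0" using nsq_ge0[of "a q q"] by linarith
    then show ?thesis by simp
  qed
  have q0: "a q t = 0" if "t \<notin> {p,x}" for t
  proof -
    have "nsq (a q t) \<le> 0" using mn[of "{t,p,x}"] that ne qp nqx x1 e qq by auto
    then have "nsq (a q t) = 0" using nsq_ge0[of "a q t"] by linarith
    then show ?thesis by simp
  qed
  have U: "{..<n} = {p, x, q}" by (rule closed_eq) (use n p0 x0 q0 in auto)
  from x1 show ?thesis
  proof
    assume "a x q = 1"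
    then show ?thesis
      by (intro embed_list[OF targets_mem(5) cyc_graph_S4_star, of "[(p, 0, 1), (x, 1, 1), (q, 3, 1)]"])
        (use U px pq ne pp xx qq in \<open>simp_all add: S4_star_table\<close>)
  next
    assume "a x q = -1"
    then show ?thesis
      by (intro embed_list[OF targets_mem(5) cyc_graph_S4_star, of "[(p, 0, 1), (x, 1, 1), (q, 2, 1)]"])
        (use U px pq ne pp xx qq in \<open>simp_all add: S4_star_table\<close>)
  qed
qed

lemma nonfull_nbrs:
  assumes "nonfull (weights a)" "nsq (a i j) = 2" "nsq (a i q) = 1"
  shows "\<forall>t. t \<notin> {j,q} \<longrightarrow> a i t = 0"
proof -
  obtain r where r: "r \<noteq> j" "nsq (a i r) = 1" "\<And>t. t \<noteq> j \<Longrightarrow> t \<noteq> r \<Longrightarrow> nsq (a i t) = 0"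
    using assms(1,2) unfolding nonfull_def weights_def by blast
  have "q = r" using r(3)[of q] assms(2,3) by fastforce
  then show ?thesis using r(3) by auto
qed

text \<open>The minor of \<open>p\<close> and \<open>l\<close> leaves only 0 and -\<omega> for a q
  l. In the first case \<open>path_end\<close> bounds the graph at both ends of the path q, p, x, l;
  in the second the path closes to a four-cycle. Either way at most six vertices occur and they span
  part of \<open>S8_star\<close>, so maximality excludes all these graphs.\<close>

lemma nonfull_path:
  assumes tm: "light_matching (weights a)" and un: "uncharged_ends (weights a)" and nf: "nonfull (weights a)"
    and px: "a p x = \<omega>" and pq: "a p q = 1" and xl: "a x l = 1" and ql: "q \<noteq> l"
  shows "listed n a"
proof -
  have xp: "a x p = -\<omega>" using flip[of x p] px by simp
  have pp: "a p p = 0" and xx: "a x x = 0" using uncharged_endsD[OF un, of p x] uncharged_endsD[OF un, of x p] px xp by auto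
  have p0: "\<forall>t. t \<notin> {x,q} \<longrightarrow> a p t = 0" by (rule nonfull_nbrs[OF nf]) (use px pq in auto)
  have x0: "\<forall>t. t \<notin> {p,l} \<longrightarrow> a x t = 0" by (rule nonfull_nbrs[OF nf]) (use xp xl in auto)
  have ne: "p \<noteq> x" "p \<noteq> q" "x \<noteq> q" "x \<noteq> l" "p \<noteq> l" using pp xx px pq xl xp by auto
  have n: "p < n" "x < n" "q < n" "l < n" using supp[of p x] supp[of p q] supp[of x l] px pq xl by auto
  have qp: "a q p = 1" and lx: "a l x = 1" using flip[of q p] flip[of l x] pq xl by auto
  have pl: "a p l = 0" and xq: "a x q = 0" using p0 x0 ne ql by auto
  have mn: "nsq (\<omega> + a q l) \<le> 4 - (\<Sum>t\<in>G. nsq (a l t))" if "finite G" for G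
  proof -
    have "nsq (\<Sum>t\<in>{x,q}. a p t * a t l) \<le> (4 - (\<Sum>t\<in>{x,q}. nsq (a p t))) * (4 - (\<Sum>t\<in>G. nsq (a l t)))"
      by (rule minorF) (use ne p0 that in auto)
    then show ?thesis using ne px pq xl by simp
  qed
  have nlq: "nsq (a l q) = nsq (a q l)" by (rule nsq_flip)
  \<comment> \<open>An edge {q, l} of weight 1 would make the left-hand side 4, and the label
    \<omega> would make it 10.\<close>
  have mn2: "nsq (\<omega> + a q l) + nsq (a q l) \<le> 3" using mn[of "{x,q}"] ne lx nlq by simp
  have "nsq (\<omega> + \<omega>) = 8" by (simp add: nsq_def cmod_def)
  then have "a q l = 0 \<or> a q l = -\<omega>"
    using small_cases[OF tm, of q l] mn2 by auto
  then show ?thesis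
  proof
    assume w: "a q l = -\<omega>"
    then have lq: "a l q = \<omega>" using flip[of l q] by simp
    have q0: "\<forall>t. t \<notin> {l,p} \<longrightarrow> a q t = 0" by (rule nonfull_nbrs[OF nf]) (use w qp in auto)
    have l0: "\<forall>t. t \<notin> {q,x} \<longrightarrow> a l t = 0" by (rule nonfull_nbrs[OF nf]) (use lq lx in auto)
    have U: "{..<n} = {p, x, q, l}" by (rule closed_eq) (use n p0 x0 q0 l0 in auto)
    have "a q q = 0" "a l l = 0" using q0 l0 ne ql by auto
    then show ?thesis
      by (intro embed_list[OF targets_mem(6) cyc_graph_S8_star, of "[(p, 0, 1), (x, 3, 1), (q, 1, 1), (l, 2, 1)]"])
        (use U px pq ne ql pp xx xl pl xq w in \<open>simp_all add: S8_star_table\<close>)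
  next
    assume z: "a q l = 0"
    then have z': "a l q = 0" using flip[of l q] by simp
    have E1: "a q q = 0"
      by (rule path_end(1)[of \<omega> p x q l]) (use px pq xl p0 x0 z ne ql in auto)
    have E2: "a l l = 0"
      by (rule path_end(1)[of "-\<omega>" x p l q]) (use xp pq xl p0 x0 z' ne ql in auto)
    have M: "(a q m = 1 \<or> a q m = -1) \<and> m \<notin> {p,x,q,l} \<and> (\<forall>t. t \<notin> {p,m} \<longrightarrow> a q t = 0) \<and>
      a m m = 0 \<and> (\<forall>t. t \<notin> {x,q} \<longrightarrow> a m t = - \<omega> * a q m * a l t)" if "m \<noteq> p" "a q m \<noteq> 0" for m
      by (rule path_end(2)[of \<omega> p x q l]) (use px pq xl p0 x0 z ne ql that in auto)
    have H: "(a l h = 1 \<or> a l h = -1) \<and> h \<notin> {x,p,l,q} \<and> (\<forall>t. t \<notin> {x,h} \<longrightarrow> a l t = 0) \<and>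
      a h h = 0 \<and> (\<forall>t. t \<notin> {p,l} \<longrightarrow> a h t = - (- \<omega>) * a l h * a q t)" if "h \<noteq> x" "a l h \<noteq> 0" for h
      by (rule path_end(2)[of "-\<omega>" x p l q]) (use xp pq xl p0 x0 z' ne ql that in auto)
    show ?thesis
    proof (cases "\<exists>m. m \<noteq> p \<and> a q m \<noteq> 0")
      case False
      then have q0: "\<forall>t. t \<noteq> p \<longrightarrow> a q t = 0" by blast
      show ?thesis
      proof (cases "\<exists>h. h \<noteq> x \<and> a l h \<noteq> 0")
        case False
        then have l0: "\<forall>t. t \<noteq> x \<longrightarrow> a l t = 0" by blast
        have U: "{..<n} = {p, x, q, l}" by (rule closed_eq) (use n p0 x0 q0 l0 in auto)
        show ?thesis
          by (intro embed_list[OF targets_mem(6) cyc_graph_S8_star, of "[(p, 0, 1), (x, 3, 1), (q, 4, 1), (l, 2, 1)]"])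
            (use U px pq ne ql pp xx xl pl xq z E1 E2 in \<open>simp_all add: S8_star_table\<close>)
      next
        case True
        then obtain h where h: "h \<noteq> x" "a l h \<noteq> 0" by blast
        note H' = H[OF h]
        define g where "g = a l h"
        have g: "g = 1 \<or> g = -1" using H' by (simp add: g_def)
        have hn: "h < n" using supp h by blast
        have hne: "h \<noteq> p" "h \<noteq> x" "h \<noteq> q" "h \<noteq> l" using H' by auto
        have Ht: "a h t = - (- \<omega>) * a l h * a q t" if "t \<notin> {p,l}" for t using H' that by blast
        have l0: "\<forall>t. t \<notin> {x,h} \<longrightarrow> a l t = 0" and hh: "a h h = 0" using H' by blast+
        have ph: "a p h = 0" "a x h = 0" using p0 x0 hne by auto
        have qh: "a q h = 0" using q0 hne by auto
        have h0: "\<forall>t. t \<notin> {l} \<longrightarrow> a h t = 0"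
        proof (intro allI impI)
          fix t assume "t \<notin> {l}"
          then show "a h t = 0"
            using Ht[of t] q0 flip[of h p] ph by (cases "t = p") auto
        qed
        have U: "{..<n} = {p, x, q, l, h}" by (rule closed_eq) (use n hn p0 x0 q0 l0 h0 in auto)
        show ?thesis
          by (intro embed_list[OF targets_mem(6) cyc_graph_S8_star, of "[(p, 0, 1), (x, 3, 1), (q, 4, 1), (l, 2, 1), (h, 6, g)]"])
            (use U px pq ne ql pp xx xl pl xq z E1 E2 hne hh ph qh g g_def[symmetric] in \<open>simp_all add: S8_star_table\<close>)
      qed
    next
      case True
      then obtain m where m: "m \<noteq> p" "a q m \<noteq> 0" by blast
      note M' = M[OF m]
      define f where "f = a q m"
      have f: "f = 1 \<or> f = -1" using M' by (simp add: f_def)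
      have fm: "- f = 1 \<or> - f = -1" using f by auto
      have mn: "m < n" using supp m by blast
      have mne: "m \<noteq> p" "m \<noteq> x" "m \<noteq> q" "m \<noteq> l" using M' by auto
      have q0: "\<forall>t. t \<notin> {p,m} \<longrightarrow> a q t = 0" and mm: "a m m = 0" using M' by blast+
      have pm: "a p m = 0" "a x m = 0" using p0 x0 mne by auto
      have Mt: "a m t = - \<omega> * a q m * a l t" if "t \<notin> {x,q}" for t using M' that by blast
      have "a m l = 0" using Mt[of l] ne ql E2 by simp
      then have lm: "a l m = 0" using flip[of l m] by simp
      \<comment> \<open>The vertices 4 and 5 of \<open>S8_star\<close>, counted from 0, are joined
        by -1, so \<open>m\<close> enters with the sign -f.\<close>
      have qm: "a q m = - (- f)" by (simp add: f_def)
      show ?thesis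
      proof (cases "\<exists>h. h \<noteq> x \<and> a l h \<noteq> 0")
        case False
        then have l0: "\<forall>t. t \<noteq> x \<longrightarrow> a l t = 0" by blast
        have m0: "\<forall>t. t \<notin> {q} \<longrightarrow> a m t = 0"
        proof (intro allI impI)
          fix t assume "t \<notin> {q}"
          then show "a m t = 0"
            using Mt[of t] l0 flip[of m x] pm by (cases "t = x") auto
        qed
        have U: "{..<n} = {p, x, q, l, m}" by (rule closed_eq) (use n mn p0 x0 q0 l0 m0 in auto)
        show ?thesis
          by (intro embed_list[OF targets_mem(6) cyc_graph_S8_star, of "[(p, 0, 1), (x, 3, 1), (q, 4, 1), (l, 2, 1), (m, 5, - f)]"])
            (use U px pq ne ql pp xx xl pl xq z E1 E2 mne mm pm lm fm qm in \<open>simp_all add: S8_star_table\<close>)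
      next
        case True
        then obtain h where h: "h \<noteq> x" "a l h \<noteq> 0" by blast
        note H' = H[OF h]
        define g where "g = a l h"
        have g: "g = 1 \<or> g = -1" using H' by (simp add: g_def)
        have hn: "h < n" using supp h by blast
        have hne: "h \<noteq> p" "h \<noteq> x" "h \<noteq> q" "h \<noteq> l" "h \<noteq> m" using H' lm h by auto
        have l0: "\<forall>t. t \<notin> {x,h} \<longrightarrow> a l t = 0" and hh: "a h h = 0" using H' by blast+
        have ph: "a p h = 0" "a x h = 0" using p0 x0 hne by auto
        have qh: "a q h = 0" using q0 hne by auto
        have mh: "a m h = - (f * g * \<omega>)"
          using Mt[of h] hne by (simp add: f_def g_def)
        have w1: "nsq (a m h) = 2" "nsq (a h m) = 2"
          using f g unfolding nsq_flip[of h m] mh by (auto simp: nsq_mult)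
        have w2: "nsq (a m q) = 1" "nsq (a h l) = 1"
          using f g nsq_flip[of m q] nsq_flip[of h l] by (auto simp: f_def g_def)
        have m0: "\<forall>t. t \<notin> {h,q} \<longrightarrow> a m t = 0" by (rule nonfull_nbrs[OF nf w1(1) w2(1)])
        have h0: "\<forall>t. t \<notin> {m,l} \<longrightarrow> a h t = 0" by (rule nonfull_nbrs[OF nf w1(2) w2(2)])
        have U: "{..<n} = {p, x, q, l, m, h}" by (rule closed_eq) (use n mn hn p0 x0 q0 l0 m0 h0 in auto)
        show ?thesis
          by (intro embed_list[OF targets_mem(6) cyc_graph_S8_star, of "[(p, 0, 1), (x, 3, 1), (q, 4, 1), (l, 2, 1), (m, 5, - f), (h, 6, g)]"])
            (use U px pq ne ql pp xx xl pl xq z E1 E2 mne mm pm lm fm qm hne hh ph qh mh g g_def[symmetric] in \<open>simp_all add: S8_star_table\<close>)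
      qed
    qed
  qed
qed

text \<open>The relation at the saturated vertex \<open>p\<close>, evaluated at \<open>x\<close>,
  gives a x r = - a x q. If these are nonzero, \<open>S4_star\<close> arises. Otherwise
  \<open>x\<close> has another neighbour l, since leaves are excluded, and after a switch at l
  evaluating there forces {q, l} or {r, l} to carry the label -\<omega>; \<open>q\<close> and
  \<open>r\<close> play symmetric roles.\<close>

lemma full_case:
  assumes tm: "light_matching (weights a)" and un: "uncharged_ends (weights a)" and px: "a p x = \<omega>" and pq: "a p q = 1" and pr: "a p r = 1"
    and qr: "q \<noteq> r"
  shows "listed n a"
proof -
  have xp: "a x p = -\<omega>" using flip[of x p] px by simp
  have pp: "a p p = 0" and xx: "a x x = 0" using uncharged_endsD[OF un, of p x] uncharged_endsD[OF un, of x p] px xp by auto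
  have ne: "p \<noteq> x" "p \<noteq> q" "p \<noteq> r" "x \<noteq> q" "x \<noteq> r" using pp px pq pr by auto
  have Fs: "(\<Sum>t\<in>{x,q,r}. nsq (a p t)) \<ge> 4" using ne qr px pq pr by simp
  have row: "\<omega> * a x t + a q t + a r t = 0" if "t \<noteq> p" for t
    using full(2)[OF _ Fs that] ne qr px pq pr by (simp add: add.assoc)
  have "a q x + a r x = 0" using row[of x] ne xx by simp
  then have "a r x = - a q x" by (rule minus_eqI)
  then have xr: "a x r = - a x q" using flip[of x r] flip[of x q] by simp
  have xs: "a x t = 0 \<or> a x t = 1 \<or> a x t = -1" if "t \<noteq> p" for t
    using small_cases[OF tm, of x t] light_matching_eq[OF tm, of x t p] xp that by auto
  consider "a x q = -1" | "a x q = 1" | "a x q = 0" using xs[of q] ne by auto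
  then show ?thesis
  proof cases
    case 1
    then show ?thesis by (rule s4_star_case[OF tm un px pq pr qr])
  next
    case 2
    then have "a x r = -1" using xr by simp
    then show ?thesis by (rule s4_star_case[OF tm un px pr pq qr[symmetric]])
  next
    case 3
    obtain l where l: "l \<noteq> p" "a x l \<noteq> 0" using leaf_false[of x p] xp by auto
    have nl: "l \<noteq> x" "l \<noteq> q" "l \<noteq> r" using l xx 3 xr by auto
    have "nsq (a x l) = 1" using xs[OF l(1)] l(2) by auto
    then show ?thesis
    proof (rule wlog_nsq[OF disjI2])
      show "x \<noteq> l" using nl by auto
      fix b assume b: "max_graph n b" "weights b = weights a" "b x l = (if nsq (a x l) = 2 then \<omega> else 1)"
        and eq: "\<And>i j. i \<noteq> l \<Longrightarrow> j \<noteq> l \<Longrightarrow> b i j = a i j"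
      interpret b: max_graph n b by fact
      have bt: "light_matching (weights b)" "uncharged_ends (weights b)" using tm un b by auto
      have bx: "b p x = \<omega>" "b p q = 1" "b p r = 1" "b x q = 0" "b x r = 0" using eq l nl px pq pr 3 xr by auto
      have bl: "b x l = 1" using b(3) \<open>nsq (a x l) = 1\<close> by simp
      have Fs: "(\<Sum>t\<in>{x,q,r}. nsq (b p t)) \<ge> 4" using ne qr bx by simp
      have "\<omega> + b q l + b r l = 0"
        using b.full(2)[OF _ Fs, of l] l ne qr bx bl by (simp add: add.assoc)
      then have rl: "b r l = - (\<omega> + b q l)" by (rule minus_eqI)
      have "b q l = -\<omega> \<or> b r l = -\<omega>"
      proof -
        have "nsq (\<omega> + \<omega>) = 8" by (simp add: nsq_def cmod_def)
        then show ?thesis using b.small_cases[OF bt(1), of q l] light_matching_le[OF bt(1), of r l] unfolding rl by auto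
      qed
      then show "listed n b"
        using b.s8_case[OF bt bx(1,2,3) qr bx(4) bl] b.s8_case[OF bt bx(1,3,2) qr[symmetric] bx(5) bl] by blast
    qed
  qed
qed

lemma matching_case:
  assumes tm: "light_matching (weights a)" and w: "nsq (a p x) = 2"
  shows "listed n a"
proof (cases "uncharged_ends (weights a)")
  case False
  then obtain i j where "nsq (a i j) = 2" "a i i \<noteq> 0" unfolding uncharged_ends_def weights_def by auto
  then show ?thesis by (rule charged[OF tm])
next
  case un: True
  have one: "nsq (a i t) = 1" if "nsq (a i j) = 2" "t \<noteq> j" "a i t \<noteq> 0" for i j t
    using lab_cases(1)[of i t] light_matching_le[OF tm, of i t] light_matching_eq[OF tm, of i j t] that by auto
  show ?thesis
  proof (cases "nonfull (weights a)")
    case False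
    then obtain p x where px: "nsq (a p x) = 2"
      and no: "\<not> (\<exists>q. q \<noteq> x \<and> nsq (a p q) = 1 \<and> (\<forall>t. t \<noteq> x \<longrightarrow> t \<noteq> q \<longrightarrow> nsq (a p t) = 0))"
      unfolding nonfull_def weights_def by blast
    obtain q where q: "q \<noteq> x" "a p q \<noteq> 0" using leaf_false[OF px] by blast
    then obtain r where r: "r \<noteq> x" "r \<noteq> q" "a p r \<noteq> 0" using no one[OF px q] by auto
    have pp: "a p p = 0" using uncharged_endsD[OF un px] .
    have ne: "p \<noteq> x" "p \<noteq> q" "p \<noteq> r" using pp px q r by auto
    \<comment> \<open>The switches are made at \<open>x\<close>, \<open>q\<close> and
      \<open>r\<close>, distinct vertices other than \<open>p\<close>, so each leaves the labels
      fixed before it.\<close>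
    show ?thesis
    proof (rule wlog_nsq[of p x])
      fix b assume b: "max_graph n b" "weights b = weights a" "b p x = (if nsq (a p x) = 2 then \<omega> else 1)"
      interpret b: max_graph n b by fact
      show "listed n b"
      proof (rule b.wlog_nsq[of p q])
        show "nsq (b p q) = 2 \<or> nsq (b p q) = 1" using one[OF px q] weights_eqD[OF b(2)] by simp
        fix c assume c: "max_graph n c" "weights c = weights b" "c p q = (if nsq (b p q) = 2 then \<omega> else 1)"
          "\<And>i j. i \<noteq> q \<Longrightarrow> j \<noteq> q \<Longrightarrow> c i j = b i j"
        interpret c: max_graph n c by fact
        show "listed n c"
        proof (rule c.wlog_nsq[of p r])
          show "nsq (c p r) = 2 \<or> nsq (c p r) = 1" using one[OF px r(1,3)] weights_eqD[OF b(2)] weights_eqD[OF c(2)] by simp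
          fix d assume d: "max_graph n d" "weights d = weights c" "d p r = (if nsq (c p r) = 2 then \<omega> else 1)"
            "\<And>i j. i \<noteq> r \<Longrightarrow> j \<noteq> r \<Longrightarrow> d i j = c i j"
          show "listed n d"
          proof (rule max_graph.full_case[OF d(1), of p x q r])
            show "light_matching (weights d)" "uncharged_ends (weights d)" using tm un b c d by auto
            have cx: "c p x = b p x" using c(4) ne q by auto
            show "d p x = \<omega>" using d(4)[of p x] ne r cx b(3) px by simp
            show "d p q = 1" using d(4)[of p q] ne r c(3) one[OF px q] weights_eqD[OF b(2)] by simp
            show "d p r = 1" using d(3) one[OF px r(1,3)] weights_eqD[OF b(2)] weights_eqD[OF c(2)] by simp
            show "q \<noteq> r" using r by auto
          qed
        qed fact
      qed fact
    qed (use px ne in auto)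
  next
    case nf: True
    have ne: "p \<noteq> x" using loop_ne[of p x] w by simp
    have wx: "nsq (a x p) = 2" using w nsq_flip[of x p] by simp
    obtain q where q: "q \<noteq> x" "a p q \<noteq> 0" using leaf_false[OF w] by blast
    obtain l where l: "l \<noteq> p" "a x l \<noteq> 0" using leaf_false[OF wx] by blast
    have pp: "a p p = 0" "a x x = 0" using uncharged_endsD[OF un w] uncharged_endsD[OF un wx] by auto
    have pq: "p \<noteq> q" "x \<noteq> l" using pp q l by auto
    show ?thesis
    proof (rule wlog_nsq[of p x])
      fix b assume b: "max_graph n b" "weights b = weights a" "b p x = (if nsq (a p x) = 2 then \<omega> else 1)"
      interpret b: max_graph n b by fact
      show "listed n b"
      proof (rule b.wlog_nsq[of p q])
        show "nsq (b p q) = 2 \<or> nsq (b p q) = 1" using one[OF w q] weights_eqD[OF b(2)] by simp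
        fix c assume c: "max_graph n c" "weights c = weights b" "c p q = (if nsq (b p q) = 2 then \<omega> else 1)"
          "\<And>i j. i \<noteq> q \<Longrightarrow> j \<noteq> q \<Longrightarrow> c i j = b i j"
        interpret c: max_graph n c by fact
        have Wc: "weights c = weights a" using b c by simp
        have cpx: "c p x = \<omega>" using c(4)[of p x] pq q b(3) w by simp
        have cpq: "c p q = 1" using c(3) one[OF w q] weights_eqD[OF b(2)] by simp
        have ct: "light_matching (weights c)" "uncharged_ends (weights c)" "nonfull (weights c)" using tm un nf Wc by auto
        have cxl: "nsq (c x l) = 1" using one[OF wx l] weights_eqD[OF Wc] by simp
        \<comment> \<open>The further neighbours of \<open>p\<close> and \<open>x\<close> either
          coincide, giving a triangle, or extend the edge to a path.\<close>
        show "listed n c"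
        proof (cases "q = l")
          case True
          have cxp: "nsq (c x p) = 2" using weights_eqD[OF Wc] wx by simp
          show ?thesis
            by (rule c.nonfull_triangle[OF ct(2) cpx cpq])
              (use c.nonfull_nbrs[OF ct(3), of p x q] c.nonfull_nbrs[OF ct(3) cxp cxl] True cxl cpx cpq in auto)
        next
          case False
          show ?thesis
          proof (rule c.wlog_nsq[of x l])
            show "nsq (c x l) = 2 \<or> nsq (c x l) = 1" using cxl by simp
            fix d assume d: "max_graph n d" "weights d = weights c" "d x l = (if nsq (c x l) = 2 then \<omega> else 1)"
              "\<And>i j. i \<noteq> l \<Longrightarrow> j \<noteq> l \<Longrightarrow> d i j = c i j"
            show "listed n d"
            proof (rule max_graph.nonfull_path[OF d(1), of p x q l])
              show "light_matching (weights d)" "uncharged_ends (weights d)" "nonfull (weights d)" using ct d by auto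
              show "d p x = \<omega>" using d(4)[of p x] l pq cpx by simp
              show "d p q = 1" using d(4)[of p q] l False cpq by simp
              show "d x l = 1" using d(3) cxl by simp
              show "q \<noteq> l" by fact
            qed
          qed fact
        qed
      qed fact
    qed (use w ne in auto)
  qed
qed

end

section \<open>Ladders\<close>

lemma lookup_Nil: "lookup [] k = 0"
  by (simp add: lookup_def)

lemma lookup_Cons: "lookup ((k', v) # ps) k = (if k = k' then v else lookup ps k)"
  by (simp add: lookup_def)

lemma lookup_append: "lookup (ps @ qs) k = (case map_of ps k of None \<Rightarrow> lookup qs k | Some v \<Rightarrow> v)"
  by (simp add: lookup_def map_add_def split: option.split)

lemma map_of_eqI:
  assumes "(k, v) \<in> set ps" "\<And>w. (k, w) \<in> set ps \<Longrightarrow> w = v"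
  shows "map_of ps k = Some v"
proof (cases "map_of ps k")
  case None
  then show ?thesis using assms(1) by (force simp: map_of_eq_None_iff)
next
  case (Some w)
  then show ?thesis using assms(2)[OF map_of_SomeD] by simp
qed

lemma ladder_mem:
  "((u, v), w) \<in> set (ladder_edges m) \<longleftrightarrow>
    (1 \<le> u \<and> u < m \<and> v = u + 1 \<and> w = 1) \<or> (m < u \<and> u < m + m \<and> v = u + 1 \<and> w = -1) \<or>
    (1 \<le> u \<and> u < m \<and> v = m + u + 1 \<and> w = 1) \<or> (2 \<le> u \<and> u \<le> m \<and> v + 1 = m + u \<and> w = -1)"
    (is "_ \<longleftrightarrow> ?R")
proof -
  have "((u, v), w) \<in> set (ladder_edges m) \<longleftrightarrow> (\<exists>i. 1 \<le> i \<and> i < m \<and>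
     (u = i \<and> v = i + 1 \<and> w = 1 \<or> u = m + i \<and> v = m + i + 1 \<and> w = -1 \<or> u = i \<and> v = m + i + 1 \<and> w = 1 \<or>
      u = i + 1 \<and> v = m + i \<and> w = -1))"
    unfolding ladder_edges_def by auto
  also have "\<dots> \<longleftrightarrow> ?R"
  proof
    assume ?R
    then show "\<exists>i. 1 \<le> i \<and> i < m \<and>
     (u = i \<and> v = i + 1 \<and> w = 1 \<or> u = m + i \<and> v = m + i + 1 \<and> w = -1 \<or> u = i \<and> v = m + i + 1 \<and> w = 1 \<or>
      u = i + 1 \<and> v = m + i \<and> w = -1)"
    proof (elim disjE)
      assume "1 \<le> u \<and> u < m \<and> v = u + 1 \<and> w = 1"
      then show ?thesis by (intro exI[of _ u]) simp
    next
      assume "m < u \<and> u < m + m \<and> v = u + 1 \<and> w = -1"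
      then show ?thesis by (intro exI[of _ "u - m"]) auto
    next
      assume "1 \<le> u \<and> u < m \<and> v = m + u + 1 \<and> w = 1"
      then show ?thesis by (intro exI[of _ u]) simp
    next
      assume "2 \<le> u \<and> u \<le> m \<and> v + 1 = m + u \<and> w = -1"
      then show ?thesis by (intro exI[of _ "u - 1"]) auto
    qed
  qed auto
  finally show ?thesis .
qed

lemma lookup_ladder:
  "lookup (ladder_edges m @ qs) (u, v) =
   (if 1 \<le> u \<and> u < m \<and> (v = u + 1 \<or> v = m + u + 1) then 1
    else if m < u \<and> u < m + m \<and> v = u + 1 \<or> 2 \<le> u \<and> u \<le> m \<and> v + 1 = m + u then -1 else lookup qs (u, v))"
    (is "_ = (if ?P then _ else if ?Q then _ else _)")
proof -
  \<comment> \<open>For m = 2 the equations v = u + 1 and v + 1 = m + u coincide; the ranges u < m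
    and 2 \<le> u keep the two kinds of edges apart.\<close>
  have pq: "\<not> (?P \<and> ?Q)" by linarith
  consider ?P | "\<not> ?P" ?Q | "\<not> ?P" "\<not> ?Q" by blast
  then show ?thesis
  proof cases
    case 1
    then have "map_of (ladder_edges m) (u, v) = Some 1"
      using pq by (intro map_of_eqI) (unfold ladder_mem, blast+)
    then show ?thesis using 1 by (simp add: lookup_append)
  next
    case 2
    then have "map_of (ladder_edges m) (u, v) = Some (-1)"
      by (intro map_of_eqI) (unfold ladder_mem, blast+)
    then show ?thesis using 2 by (simp add: lookup_append)
  next
    case 3
    have "(u, v) \<notin> fst ` set (ladder_edges m)"
    proof
      assume "(u, v) \<in> fst ` set (ladder_edges m)"
      then obtain w where "((u, v), w) \<in> set (ladder_edges m)" by auto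
      then show False using 3 unfolding ladder_mem by blast
    qed
    then have "map_of (ladder_edges m) (u, v) = None" by (simp add: map_of_eq_None_iff)
    then have "lookup (ladder_edges m @ qs) (u, v) = lookup qs (u, v)" by (simp add: lookup_append)
    then show ?thesis unfolding if_not_P[OF 3(1)] if_not_P[OF 3(2)] .
  qed
qed

lemmas lookup_simps = lookup_Cons lookup_Nil lookup_ladder

lemma graph_matrix_diag: "i < n \<Longrightarrow> graph_matrix n cs es $$ (i, i) = lookup cs (i + 1)"
  by (simp add: graph_matrix_def)

lemma graph_matrix_less: "i < j \<Longrightarrow> j < n \<Longrightarrow> graph_matrix n cs es $$ (i, j) = lookup es (i + 1, j + 1)"
  by (simp add: graph_matrix_def)

lemma graph_matrix_greater: "i < j \<Longrightarrow> j < n \<Longrightarrow> graph_matrix n cs es $$ (j, i) = cnj (lookup es (i + 1, j + 1))"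
  by (simp add: graph_matrix_def)

lemma (in cyc_graph) equiv_to_graph_matrix:
  assumes f: "bij_betw f {..<n} {..<n}" and s: "\<And>i. s i \<in> {1, -1}" and e: "e \<in> {1, -1}"
    and d: "\<And>i. i < n \<Longrightarrow> lookup cs (i + 1) = e * a (f i) (f i)"
    and l: "\<And>i j. i < j \<Longrightarrow> j < n \<Longrightarrow> lookup es (i + 1, j + 1) = s i * s j * (e * a (f i) (f j))"
  shows "equiv_to n a (graph_matrix n cs es)"
  unfolding equiv_to_def
proof (intro conjI exI[of _ f] exI[of _ s] bexI[of _ e] allI impI)
  show "graph_matrix n cs es \<in> carrier_mat n n" by (simp add: graph_matrix_def)
  show "bij_betw f {..<n} {..<n}" "e \<in> {1, -1}" "s i \<in> {1, -1}" for i using f e s by auto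
  fix i j assume ij: "i < n" "j < n"
  have ss: "s i * s i = 1" "cnj (s i) = s i" for i using s[of i] by auto
  have ee: "cnj e = e" using e by auto
  consider "i < j" | "i = j" | "j < i" by linarith
  then show "graph_matrix n cs es $$ (i, j) = s i * s j * (e * a (f i) (f j))"
  proof cases
    case 1
    then show ?thesis using graph_matrix_less[OF 1 ij(2)] l[OF 1 ij(2)] by simp
  next
    case 2
    then show ?thesis using graph_matrix_diag[OF ij(1)] d[OF ij(1)] ss by simp
  next
    case 3
    show ?thesis
      unfolding graph_matrix_greater[OF 3 ij(1)] l[OF 3 ij(1)] using flip[of "f i" "f j"] ss ee by simp
  qed
qed

section \<open>Growing a ladder from a saturated vertex\<close>

definition ladder_verts :: "nat \<Rightarrow> nat \<Rightarrow> (nat \<Rightarrow> nat) \<Rightarrow> (nat \<Rightarrow> nat) \<Rightarrow> nat set" where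
  "ladder_verts m p X Y = insert p (X ` {..m} \<union> Y ` {..m})"

text \<open>For \<open>c = 0\<close> the Gram vectors of \<open>A + 2I\<close> are \<open>p = \<omega> e\<^sub>0\<close>, \<open>X i = e\<^sub>i + e\<^sub>i\<^sub>+\<^sub>1\<close> and
  \<open>Y i = e\<^sub>i - e\<^sub>i\<^sub>+\<^sub>1\<close>. Only the last pair may be charged or have neighbours outside.\<close>

definition is_ladder :: "(nat \<Rightarrow> nat \<Rightarrow> complex) \<Rightarrow> nat \<Rightarrow> nat \<Rightarrow> (nat \<Rightarrow> nat) \<Rightarrow> (nat \<Rightarrow> nat) \<Rightarrow> complex \<Rightarrow> bool" where
  "is_ladder a m p X Y c \<longleftrightarrow> a p p = 0 \<and>
    (\<forall>i\<le>m. X i \<noteq> p \<and> Y i \<noteq> p \<and> a p (X i) = (if i = 0 then \<omega> else 0) \<and> a p (Y i) = (if i = 0 then \<omega> else 0)) \<and>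
    (\<forall>i\<le>m. \<forall>j\<le>m. X i \<noteq> Y j \<and> (X i = X j \<longrightarrow> i = j) \<and> (Y i = Y j \<longrightarrow> i = j) \<and>
      a (X i) (X j) = (if j = Suc i \<or> i = Suc j then 1 else if i = j \<and> i = m then c else 0) \<and>
      a (Y i) (Y j) = (if j = Suc i \<or> i = Suc j then -1 else if i = j \<and> i = m then c else 0) \<and>
      a (X i) (Y j) = (if j = Suc i then 1 else if i = Suc j then -1 else if i = j \<and> i = m then - c else 0)) \<and>
    (\<forall>t. t \<notin> ladder_verts m p X Y \<longrightarrow> a p t = 0 \<and> (\<forall>i<m. a (X i) t = 0 \<and> a (Y i) t = 0) \<and> a (Y m) t = - a (X m) t)"

locale ladder = max_graph +
  fixes m p X Y c
  assumes is_ladder: "is_ladder a m p X Y c"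
begin

lemma pp: "a p p = 0"
  and pX: "i \<le> m \<Longrightarrow> a p (X i) = (if i = 0 then \<omega> else 0)" and pY: "i \<le> m \<Longrightarrow> a p (Y i) = (if i = 0 then \<omega> else 0)"
  and pne: "i \<le> m \<Longrightarrow> X i \<noteq> p" "i \<le> m \<Longrightarrow> Y i \<noteq> p"
  using is_ladder unfolding is_ladder_def by auto

lemma XneY: "i \<le> m \<Longrightarrow> j \<le> m \<Longrightarrow> X i \<noteq> Y j" and Xinj: "i \<le> m \<Longrightarrow> j \<le> m \<Longrightarrow> X i = X j \<longleftrightarrow> i = j"
  and Yinj: "i \<le> m \<Longrightarrow> j \<le> m \<Longrightarrow> Y i = Y j \<longleftrightarrow> i = j"
  using is_ladder unfolding is_ladder_def by auto

lemma XX: "i \<le> m \<Longrightarrow> j \<le> m \<Longrightarrow> a (X i) (X j) = (if j = Suc i \<or> i = Suc j then 1 else if i = j \<and> i = m then c else 0)"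
  and YY: "i \<le> m \<Longrightarrow> j \<le> m \<Longrightarrow> a (Y i) (Y j) = (if j = Suc i \<or> i = Suc j then -1 else if i = j \<and> i = m then c else 0)"
  and XY: "i \<le> m \<Longrightarrow> j \<le> m \<Longrightarrow> a (X i) (Y j) = (if j = Suc i then 1 else if i = Suc j then -1 else if i = j \<and> i = m then - c else 0)"
  using is_ladder unfolding is_ladder_def by blast+

lemma out: "t \<notin> ladder_verts m p X Y \<Longrightarrow> a p t = 0" "t \<notin> ladder_verts m p X Y \<Longrightarrow> i < m \<Longrightarrow> a (X i) t = 0"
  "t \<notin> ladder_verts m p X Y \<Longrightarrow> i < m \<Longrightarrow> a (Y i) t = 0" "t \<notin> ladder_verts m p X Y \<Longrightarrow> a (Y m) t = - a (X m) t"
  using is_ladder unfolding is_ladder_def by blast+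

lemma c_cases: "c = 0 \<or> c = 1 \<or> c = -1"
  using diag[of "X m"] XX[of m m] by auto

lemma c_cnj: "cnj c = c"
  using c_cases by auto

lemma YX: "i \<le> m \<Longrightarrow> j \<le> m \<Longrightarrow> a (Y i) (X j) = (if i = Suc j then 1 else if j = Suc i then -1 else if i = j \<and> i = m then - c else 0)"
  using flip[of "Y i" "X j"] XY[of j i] c_cnj by auto

lemma Xp: "i \<le> m \<Longrightarrow> a (X i) p = (if i = 0 then - \<omega> else 0)" and Yp: "i \<le> m \<Longrightarrow> a (Y i) p = (if i = 0 then - \<omega> else 0)"
  using flip[of "X i" p] flip[of "Y i" p] pX[of i] pY[of i] by auto

text \<open>The neighbours of X m and Y m in the earlier part of the ladder. They account for weight
  2, so the last pair has weight 2 left: it may go to a charge and the edge {X m, Y m}, to one outer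
  edge of weight 2, or to two outer edges of weight 1.\<close>

definition prv :: "nat set" where "prv = (if m = 0 then {p} else {X (m - 1), Y (m - 1)})"

lemma prv: "finite prv" "prv \<subseteq> ladder_verts m p X Y" "(\<Sum>t\<in>prv. nsq (a (X m) t)) = 2"
  "t \<notin> ladder_verts m p X Y \<Longrightarrow> (\<Sum>u\<in>prv. a (X m) u * a u t) = 0" "X m \<notin> prv" "Y m \<notin> prv"
proof -
  show "finite prv" by (simp add: prv_def)
  show "prv \<subseteq> ladder_verts m p X Y" by (auto simp: prv_def ladder_verts_def)
  show "(\<Sum>t\<in>prv. nsq (a (X m) t)) = 2"
    unfolding prv_def using XneY[of "m - 1" "m - 1"] XX[of m "m - 1"] XY[of m "m - 1"] Xp[of m]
    by (cases m) simp_all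
  show "t \<notin> ladder_verts m p X Y \<Longrightarrow> (\<Sum>u\<in>prv. a (X m) u * a u t) = 0"
    using out(1)[of t] out(2,3)[of t "m - 1"] XneY[of "m - 1" "m - 1"] by (simp add: prv_def)
  show "X m \<notin> prv" "Y m \<notin> prv"
    unfolding prv_def
    using Xinj[of m "m - 1"] Yinj[of m "m - 1"] XneY[of m "m - 1"] XneY[of "m - 1" m] pne[of m] by (cases m; simp)+
qed

lemma X_lt: "i \<le> m \<Longrightarrow> X i < n" and Y_lt: "i \<le> m \<Longrightarrow> Y i < n" and p_lt: "p < n"
proof -
  show p: "p < n" using supp[of p "X 0"] pX[of 0] by simp
  show "X i < n" if "i \<le> m"
  proof (cases "i = 0")
    case True
    then show ?thesis using supp[of p "X 0"] pX[of 0] by simp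
  next
    case False
    then show ?thesis using supp[of "X i" "X (i - 1)"] XX[of i "i - 1"] that by auto
  qed
  show "Y i < n" if "i \<le> m"
  proof (cases "i = 0")
    case True
    then show ?thesis using supp[of p "Y 0"] pY[of 0] by simp
  next
    case False
    then show ?thesis using supp[of "Y i" "Y (i - 1)"] YY[of i "i - 1"] that by auto
  qed
qed

lemma ladder_verts_sub: "ladder_verts m p X Y \<subseteq> {..<n}"
  using X_lt Y_lt p_lt by (auto simp: ladder_verts_def)

lemma inX: "i \<le> m \<Longrightarrow> X i \<in> ladder_verts m p X Y" and inY: "i \<le> m \<Longrightarrow> Y i \<in> ladder_verts m p X Y" and inp: "p \<in> ladder_verts m p X Y"
  by (auto simp: ladder_verts_def)

lemma card_lvs: "card (ladder_verts m p X Y) = 2 * m + 3"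
proof -
  have "card (X ` {..m}) = Suc m" using Xinj by (subst card_image) (auto simp: inj_on_def)
  moreover have "card (Y ` {..m}) = Suc m" using Yinj by (subst card_image) (auto simp: inj_on_def)
  moreover have "X ` {..m} \<inter> Y ` {..m} = {}" using XneY by auto
  moreover have "p \<notin> X ` {..m} \<union> Y ` {..m}" using pne by auto
  ultimately show ?thesis unfolding ladder_verts_def by (simp add: card_Un_disjoint)
qed

lemma bijI:
  assumes "f ` {..<n} \<subseteq> {..<n}" "{..<n} \<subseteq> f ` {..<n}"
  shows "bij_betw f {..<n} {..<n}"
proof -
  have "f ` {..<n} = {..<n}" using assms by blast
  then show ?thesis unfolding bij_betw_def by (simp add: eq_card_imp_inj_on)
qed

text \<open>A charge c comes with the label -c between X m and Y m, which uses up the remaining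
  weight, so nothing lies outside the ladder. With k = m + 1 pairs this is \<open>C2_plus k\<close>
  or its negative, up to switching.\<close>

lemma finish_C2:
  assumes c: "c \<noteq> 0"
  shows "listed n a"
proof -
  have c1: "c = 1 \<or> c = -1" using c c_cases by auto
  have xy: "X m \<noteq> Y m" using XneY by simp
  have Fs: "(\<Sum>t\<in>insert (X m) (insert (Y m) prv). nsq (a (X m) t)) \<ge> 4"
    using prv xy XX[of m m] XY[of m m] c1 by auto
  have x0: "a (X m) t = 0" if "t \<notin> ladder_verts m p X Y" for t
    by (rule full(1)[OF _ Fs]) (use that prv inX[of m] inY[of m] in auto)
  have U: "{..<n} = ladder_verts m p X Y"
  proof (rule closed_eq[OF ladder_verts_sub])
    show "ladder_verts m p X Y \<noteq> {}" by (simp add: ladder_verts_def)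
    fix i t assume i: "i \<in> ladder_verts m p X Y" and t: "t \<notin> ladder_verts m p X Y"
    consider "i = p" | j where "j < m" "i = X j \<or> i = Y j" | "i = X m \<or> i = Y m"
      using i unfolding ladder_verts_def by (auto simp: le_less)
    then show "a i t = 0" by cases (use out[OF t] x0[OF t] in auto)
  qed
  define k where "k = Suc m"
  have n: "n = 2 * k + 1" using arg_cong[OF U, of card] card_lvs by (simp add: k_def)
  \<comment> \<open>\<open>C2_plus\<close> is numbered from the charged pair, the ladder from
    \<open>p\<close>; hence the reversed indices.\<close>
  define f where "f = (\<lambda>i. if i < k then X (m - i) else if i < 2 * k then Y (m - (i - k)) else p)"
  \<comment> \<open>For \<open>c = -1\<close> the graph is negated, and the powers of \<open>c\<close> undo the sign change along the ladder.\<close>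
  define s where "s = (\<lambda>i. if i < k then c ^ (m - i) else if i < 2 * k then - (c ^ (m - (i - k))) else - c)"
  have cp: "c ^ i = 1 \<or> c ^ i = -1" for i using c1 by (induction i) auto
  have cc: "c * c = 1" "c ^ i * c ^ i = 1" for i using c1 cp[of i] by auto
  have cS: "c ^ i * (c ^ Suc i * c) = 1" "c ^ Suc i * (c ^ i * c) = 1" for i
    using cc(1) cc(2)[of i] by (simp_all add: algebra_simps)
  let ?es = "[((1, k + 1), 1)] @ ladder_edges k @ [((k, 2 * k + 1), \<omega>), ((2 * k, 2 * k + 1), - \<omega>)]"
  have "equiv_to n a (graph_matrix n [(1, 1), (k + 1, 1)] ?es)"
  proof (rule equiv_to_graph_matrix[of f s c])
    show "bij_betw f {..<n} {..<n}"
    proof (rule bijI)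
      show "f ` {..<n} \<subseteq> {..<n}" using X_lt Y_lt p_lt by (auto simp: f_def k_def)
      show "{..<n} \<subseteq> f ` {..<n}"
      proof
        fix v assume "v \<in> {..<n}"
        then consider "v = p" | i where "i \<le> m" "v = X i" | i where "i \<le> m" "v = Y i"
          using U by (auto simp: ladder_verts_def)
        then show "v \<in> f ` {..<n}"
        proof cases
          case 1
          then show ?thesis using n by (intro image_eqI[of _ _ "2 * k"]) (auto simp: f_def)
        next
          case 2
          then show ?thesis using n by (intro image_eqI[of _ _ "m - i"]) (auto simp: f_def k_def)
        next
          case 3
          then show ?thesis using n by (intro image_eqI[of _ _ "k + (m - i)"]) (auto simp: f_def k_def)
        qed
      qed
    qed
    show "s i \<in> {1, -1}" for i using cp[of "m - i"] cp[of "m - (i - k)"] c1 by (auto simp: s_def)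
    show "c \<in> {1, -1}" using c1 by auto
    show "lookup [(1, 1), (k + 1, 1)] (i + 1) = c * a (f i) (f i)" if "i < n" for i
    proof -
      have "i < k \<or> (k \<le> i \<and> i < 2 * k) \<or> i = 2 * k" using that n by linarith
      then consider "i < k" | "k \<le> i" "i < 2 * k" | "i = 2 * k" by blast
      then show ?thesis
      proof cases
        case 1
        have "m - i = m \<longleftrightarrow> i = 0" using 1 by (auto simp: k_def)
        then have "a (f i) (f i) = (if i = 0 then c else 0)" using XX[of "m - i" "m - i"] 1 by (simp add: f_def)
        then show ?thesis using 1 cc(1) by (simp add: lookup_Cons lookup_Nil)
      next
        case 2
        have "m - (i - k) = m \<longleftrightarrow> i = k" using 2 by (auto simp: k_def)
        then have "a (f i) (f i) = (if i = k then c else 0)"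
          using YY[of "m - (i - k)" "m - (i - k)"] 2 by (simp add: f_def)
        then show ?thesis using 2 cc(1) by (simp add: lookup_Cons lookup_Nil k_def)
      next
        case 3
        then show ?thesis using pp by (simp add: lookup_Cons lookup_Nil f_def k_def)
      qed
    qed
    fix i j assume ij: "i < j" "j < n"
    consider (1) "i < k" "j < k" | (2) j' where "i < k" "j = k + j'" "j' < k" | (3) "i < k" "j = 2 * k"
      | (4) i' j' where "i = k + i'" "j = k + j'" "i' < j'" "j' < k" | (5) i' where "i = k + i'" "i' < k" "j = 2 * k"
    proof -
      consider "j < k" | "k \<le> j" "j < 2 * k" "i < k" | "k \<le> i" "j < 2 * k" | "j = 2 * k" "i < k" | "j = 2 * k" "k \<le> i"
        using ij n by linarith
      then show thesis
        by cases (use ij n 1 2[of "j - k"] 3 4[of "i - k" "j - k"] 5[of "i - k"] in auto)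
    qed
    then show "lookup ?es (i + 1, j + 1) =
        s i * s j * (c * a (f i) (f j))"
    proof cases
      case 1
      have "lookup ?es (i + 1, j + 1) =
         (if j = Suc i then 1 else 0)"
        using 1 ij by (simp add: lookup_simps)
      moreover have "s i * s j * (c * a (f i) (f j)) = (if j = Suc i then 1 else 0)"
      proof (cases "j = Suc i")
        case True
        then have "m - i = Suc (m - j)" using 1 by (simp add: k_def)
        then show ?thesis using 1 True cS(2)[of "m - j"] XX[of "m - i" "m - j"] by (simp add: s_def f_def k_def mult_ac)
      next
        case False
        have "m - j \<noteq> Suc (m - i)" "m - i \<noteq> Suc (m - j)" "m - i \<noteq> m - j" using 1 ij False by (auto simp: k_def)
        then have "a (X (m - i)) (X (m - j)) = 0" using XX[of "m - i" "m - j"] by simp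
        then show ?thesis using 1 False by (simp add: f_def)
      qed
      ultimately show ?thesis by simp
    next
      case 2
      have "lookup ?es (i + 1, j + 1) =
         (if i = 0 \<and> j' = 0 then 1 else if j' = Suc i then 1 else if i = Suc j' then -1 else 0)"
        using 2 by (auto simp: lookup_simps)
      moreover have "s i * s j * (c * a (f i) (f j)) =
         (if i = 0 \<and> j' = 0 then 1 else if j' = Suc i then 1 else if i = Suc j' then -1 else 0)"
      proof -
        have e: "s i * s j * (c * a (f i) (f j)) = - (c ^ (m - i) * (c ^ (m - j') * c)) * a (X (m - i)) (Y (m - j'))"
          using 2 by (simp add: s_def f_def mult_ac)
        consider "i = 0" "j' = 0" | "j' = Suc i" | "i = Suc j'" | "\<not> (i = 0 \<and> j' = 0)" "j' \<noteq> Suc i" "i \<noteq> Suc j'" by blast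
        then show ?thesis
        proof cases
          case a: 1
          have "c ^ m * (c ^ m * c) * c = (c ^ m * c ^ m) * (c * c)" by (simp add: mult_ac)
          then show ?thesis unfolding e using a XY[of m m] cc by simp
        next
          case a: 2
          then have "m - i = Suc (m - j')" using 2 by (simp add: k_def)
          then show ?thesis unfolding e using a 2 XY[of "m - i" "m - j'"] cS(2)[of "m - j'"] by simp
        next
          case a: 3
          then have "m - j' = Suc (m - i)" using 2 by (simp add: k_def)
          then show ?thesis unfolding e using a 2 XY[of "m - i" "m - j'"] cS(1)[of "m - i"] by simp
        next
          case a: 4
          have "m - j' \<noteq> Suc (m - i)" "m - i \<noteq> Suc (m - j')" "\<not> (m - i = m - j' \<and> m - i = m)"
            using 2 a by (auto simp: k_def)
          then have "a (X (m - i)) (Y (m - j')) = 0" using XY[of "m - i" "m - j'"] by auto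
          then show ?thesis unfolding e using a by simp
        qed
      qed
      ultimately show ?thesis by simp
    next
      case 3
      have "lookup ?es (i + 1, j + 1) =
         (if i = m then \<omega> else 0)"
        using 3 by (auto simp: lookup_simps k_def)
      moreover have "s i * s j * (c * a (f i) (f j)) = (if i = m then \<omega> else 0)"
        using 3 Xp[of "m - i"] cc(1) by (auto simp: s_def f_def k_def)
      ultimately show ?thesis by simp
    next
      case 4
      have "lookup ?es (i + 1, j + 1) =
         (if j' = Suc i' then -1 else 0)"
        using 4 by (auto simp: lookup_simps)
      moreover have "s i * s j * (c * a (f i) (f j)) = (if j' = Suc i' then -1 else 0)"
      proof (cases "j' = Suc i'")
        case True
        then have "m - i' = Suc (m - j')" using 4 by (simp add: k_def)
        then show ?thesis using 4 True cS(2)[of "m - j'"] YY[of "m - i'" "m - j'"] by (simp add: s_def f_def k_def mult_ac)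
      next
        case False
        have "m - j' \<noteq> Suc (m - i')" "m - i' \<noteq> Suc (m - j')" "m - i' \<noteq> m - j'" using 4 False by (auto simp: k_def)
        then have "a (Y (m - i')) (Y (m - j')) = 0" using YY[of "m - i'" "m - j'"] by simp
        then show ?thesis using 4 False by (simp add: f_def)
      qed
      ultimately show ?thesis by simp
    next
      case 5
      have "lookup ?es (i + 1, j + 1) =
         (if i' = m then - \<omega> else 0)"
        using 5 by (auto simp: lookup_simps k_def)
      moreover have "s i * s j * (c * a (f i) (f j)) = (if i' = m then - \<omega> else 0)"
        using 5 Yp[of "m - i'"] cc(1) by (auto simp: s_def f_def k_def)
      ultimately show ?thesis by simp
    qed
  qed
  then have "equiv_to n a (C2_plus k)" unfolding C2_plus_def n .
  moreover have "C2_plus k \<in> targets" by (auto simp: targets_def k_def)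
  ultimately show ?thesis unfolding listed_def by blast
qed

text \<open>An outer edge of weight 2 saturates X m; the opposite label at Y m then saturates
  \<open>z\<close>, and the ladder is closed at both ends.\<close>

lemma finish_T4:
  assumes c: "c = 0" and z: "z \<notin> ladder_verts m p X Y" and xz: "nsq (a (X m) z) = 2"
  shows "listed n a"
proof -
  define e where "e = (if a (X m) z = \<omega> then 1 else -1 :: complex)"
  have e1: "e = 1 \<or> e = -1" by (simp add: e_def)
  have Xz: "a (X m) z = e * \<omega>" using lab_cases(3)[OF xz] by (auto simp: e_def)
  have Yz: "a (Y m) z = - (e * \<omega>)" using out(4)[OF z] Xz by simp
  have zn: "z < n" using supp_nsq[of "X m" z] xz by simp
  have xy: "X m \<noteq> Y m" using XneY by simp
  have zp: "z \<notin> prv" using prv(2) z by auto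
  have Fs: "(\<Sum>t\<in>insert z prv. nsq (a (X m) t)) \<ge> 4" using prv zp xz by simp
  have x0: "a (X m) t = 0" if "t \<notin> insert z (ladder_verts m p X Y)" for t
    by (rule full(1)[OF _ Fs]) (use that prv in auto)
  have z0: "\<forall>t. t \<notin> {X m, Y m} \<longrightarrow> a z t = 0"
    by (rule row_zero) (use xy e1 Xz Yz nsq_flip[of z "X m"] nsq_flip[of z "Y m"] in \<open>auto simp: nsq_mult\<close>)
  let ?V = "insert z (ladder_verts m p X Y)"
  have U: "{..<n} = ?V"
  proof (rule closed_eq)
    show "?V \<subseteq> {..<n}" using ladder_verts_sub zn by auto
    show "?V \<noteq> {}" by simp
    fix i t assume i: "i \<in> ?V" and t: "t \<notin> ?V"
    have t': "t \<notin> ladder_verts m p X Y" using t by simp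
    consider "i = p" | j where "j < m" "i = X j \<or> i = Y j" | "i = X m \<or> i = Y m" | "i = z"
      using i unfolding ladder_verts_def by (auto simp: le_less)
    then show "a i t = 0"
    proof cases
      case 4
      have "t \<noteq> X m" "t \<noteq> Y m" using t' inX[of m] inY[of m] by blast+
      then show ?thesis using z0 4 by simp
    qed (use out[OF t'] x0[OF t] in auto)
  qed
  define L where "L = Suc m"
  have n: "n = 2 * L + 2" using arg_cong[OF U, of card] card_lvs z finite_subset[OF ladder_verts_sub] by (simp add: L_def)
  define f where "f = (\<lambda>i. if i < L then X i else if i < 2 * L then Y (i - L) else if i = 2 * L then p else z)"
  \<comment> \<open>The sign at \<open>p\<close> is -1 because a (X 0) p = -\<omega>, whereas
    \<open>T4\<close> has the label \<omega> in that direction.\<close>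
  define s where "s = (\<lambda>i. if i < 2 * L then 1 else if i = 2 * L then -1 else e)"
  have "z \<noteq> X m" "z \<noteq> Y m" using z inX[of m] inY[of m] by blast+
  then have zz: "a z z = 0" using z0 by simp
  have zX: "a (X i) z = 0" and zY: "a (Y i) z = 0" if "i < m" for i using out(2,3)[OF z that] by auto
  have zpp: "a p z = 0" by (rule out(1)[OF z])
  let ?es = "ladder_edges L @ [((1, 2 * L + 1), \<omega>), ((L + 1, 2 * L + 1), \<omega>),
       ((L, 2 * L + 2), \<omega>), ((2 * L, 2 * L + 2), -\<omega>)]"
  have "equiv_to n a (graph_matrix n [] ?es)"
  proof (rule equiv_to_graph_matrix[of f s 1])
    show "bij_betw f {..<n} {..<n}"
    proof (rule bijI)
      show "f ` {..<n} \<subseteq> {..<n}" using X_lt Y_lt p_lt zn by (auto simp: f_def L_def)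
      show "{..<n} \<subseteq> f ` {..<n}"
      proof
        fix v assume "v \<in> {..<n}"
        then consider "v = p" | i where "i \<le> m" "v = X i" | i where "i \<le> m" "v = Y i" | "v = z"
          using U by (auto simp: ladder_verts_def)
        then show "v \<in> f ` {..<n}"
        proof cases
          case 1
          then show ?thesis using n by (intro image_eqI[of _ _ "2 * L"]) (auto simp: f_def)
        next
          case 2
          then show ?thesis using n by (intro image_eqI[of _ _ i]) (auto simp: f_def L_def)
        next
          case 3
          then show ?thesis using n by (intro image_eqI[of _ _ "L + i"]) (auto simp: f_def L_def)
        next
          case 4
          then show ?thesis using n by (intro image_eqI[of _ _ "2 * L + 1"]) (auto simp: f_def)
        qed
      qed
    qed
    show "s i \<in> {1, -1}" for i using e1 by (auto simp: s_def)
    show "(1::complex) \<in> {1, -1}" by simp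
    show "lookup [] (i + 1) = 1 * a (f i) (f i)" if "i < n" for i
      using XX[of i i] YY[of "i - L" "i - L"] pp zz c that n by (auto simp: lookup_Nil f_def L_def)
    fix i j assume ij: "i < j" "j < n"
    consider (1) "j < L" | (2) j' where "i < L" "j = L + j'" "j' < L" | (3) "i < L" "j = 2 * L"
      | (4) i' j' where "i = L + i'" "j = L + j'" "i' < j'" "j' < L" | (5) i' where "i = L + i'" "i' < L" "j = 2 * L"
      | (6) "i < L" "j = 2 * L + 1" | (7) i' where "i = L + i'" "i' < L" "j = 2 * L + 1" | (8) "i = 2 * L" "j = 2 * L + 1"
    proof -
      consider "j < L" | "L \<le> j" "j < 2 * L" "i < L" | "L \<le> i" "j < 2 * L" | "j = 2 * L" "i < L" | "j = 2 * L" "L \<le> i"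
        | "j = 2 * L + 1" "i < L" | "j = 2 * L + 1" "L \<le> i" "i < 2 * L" | "j = 2 * L + 1" "i = 2 * L"
        using ij n by linarith
      then show thesis
        by cases (use ij n 1 2[of "j - L"] 3 4[of "i - L" "j - L"] 5[of "i - L"] 6 7[of "i - L"] 8 in auto)
    qed
    then show "lookup ?es (i + 1, j + 1) = s i * s j * (1 * a (f i) (f j))"
    proof cases
      case 1
      then show ?thesis using ij XX[of i j] by (auto simp: lookup_simps s_def f_def L_def)
    next
      case 2
      then show ?thesis using XY[of i j'] c by (auto simp: lookup_simps s_def f_def L_def)
    next
      case 3
      then show ?thesis using Xp[of i] by (auto simp: lookup_simps s_def f_def L_def)
    next
      case 4
      then show ?thesis using YY[of i' j'] by (auto simp: lookup_simps s_def f_def L_def)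
    next
      case 5
      then show ?thesis using Yp[of i'] by (auto simp: lookup_simps s_def f_def L_def)
    next
      case 6
      then show ?thesis using zX[of i] Xz e1
        by (cases "i = m") (auto simp: lookup_simps s_def f_def L_def)
    next
      case 7
      then show ?thesis using zY[of i'] Yz e1
        by (cases "i' = m") (auto simp: lookup_simps s_def f_def L_def)
    next
      case 8
      then show ?thesis using zpp by (auto simp: lookup_simps s_def f_def L_def)
    qed
  qed
  moreover have "graph_matrix n [] ?es = T4 (Suc L)"
    unfolding T4_def n by simp
  moreover have "T4 (Suc L) \<in> targets" unfolding targets_def L_def by auto
  ultimately show ?thesis unfolding listed_def by auto
qed

end

context ladder
begin

text \<open>Inside the ladder X m and Y m have the same neighbours with the same labels, outside it
  their labels are opposite. Hence they are twins up to outer neighbours, which is the situation of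
  \<open>no_ext_cap\<close> and \<open>no_ext_twin\<close>.\<close>

lemma twins:
  assumes t: "t \<noteq> X m" "t \<noteq> Y m" and c: "c = 0" and o: "t \<notin> ladder_verts m p X Y \<Longrightarrow> a (X m) t = 0"
  shows "a (X m) t = a (Y m) t"
proof -
  consider "t = p" | i where "i < m" "t = X i" | i where "i < m" "t = Y i" | "t \<notin> ladder_verts m p X Y"
  proof -
    assume 1: "t = p \<Longrightarrow> thesis" and 2: "\<And>i. i < m \<Longrightarrow> t = X i \<Longrightarrow> thesis"
      and 3: "\<And>i. i < m \<Longrightarrow> t = Y i \<Longrightarrow> thesis" and 4: "t \<notin> ladder_verts m p X Y \<Longrightarrow> thesis"
    show thesis
    proof (cases "t \<in> ladder_verts m p X Y")
      case True
      then consider "t = p" | i where "i \<le> m" "t = X i" | i where "i \<le> m" "t = Y i" unfolding ladder_verts_def by auto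
      then show thesis by cases (use 1 2 3 t in \<open>auto simp: le_less\<close>)
    qed (rule 4)
  qed
  then show ?thesis
  proof cases
    case 1
    then show ?thesis using Xp[of m] Yp[of m] by simp
  next
    case (2 i)
    then show ?thesis using XX[of m i] YX[of m i] by simp
  next
    case (3 i)
    then show ?thesis using XY[of m i] YY[of m i] by simp
  next
    case 4
    then show ?thesis using o out(4) by simp
  qed
qed

lemma diag0: "c = 0 \<Longrightarrow> a (X m) (X m) = 0" "c = 0 \<Longrightarrow> a (Y m) (Y m) = 0" "c = 0 \<Longrightarrow> a (X m) (Y m) = 0"
  using XX[of m m] YY[of m m] XY[of m m] by auto

text \<open>Otherwise the last pair are twins and \<open>no_ext_cap\<close> closes the ladder with
  one more vertex.\<close>

lemma exists_out:
  assumes c: "c = 0"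
  obtains z where "z \<notin> ladder_verts m p X Y" "a (X m) z \<noteq> 0"
proof -
  have False if x0: "\<And>t. t \<notin> ladder_verts m p X Y \<Longrightarrow> a (X m) t = 0"
  proof (rule no_ext_cap[of "X m" "Y m"])
    show "X m \<noteq> Y m" using XneY by simp
    show "X m < n" "Y m < n" using X_lt Y_lt by auto
    show "a (X m) (X m) = 0" "a (Y m) (Y m) = 0" "a (X m) (Y m) = 0" using diag0[OF c] by auto
    show "a (X m) t = a (Y m) t" if "t \<noteq> X m" "t \<noteq> Y m" for t by (rule twins[OF that c x0])
  qed
  then show ?thesis using that by blast
qed

text \<open>If \<open>z\<close> were the only outer neighbour, \<open>no_ext_twin\<close> would
  supply its missing partner.\<close>

lemma exists_second:
  assumes c: "c = 0" and z: "z \<notin> ladder_verts m p X Y" "nsq (a (X m) z) = 1"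
  obtains w where "w \<notin> ladder_verts m p X Y" "w \<noteq> z" "a (X m) w \<noteq> 0"
proof -
  have zne: "z \<noteq> X m" "z \<noteq> Y m" using z(1) inX[of m] inY[of m] by blast+
  have ne: "X m \<noteq> Y m" using XneY by simp
  have Yz: "a (Y m) z = - a (X m) z" by (rule out(4)[OF z(1)])
  have yx: "a (Y m) (X m) = 0" using flip[of "Y m" "X m"] diag0(3)[OF c] by simp
  have False if w0: "\<And>w. w \<notin> ladder_verts m p X Y \<Longrightarrow> w \<noteq> z \<Longrightarrow> a (X m) w = 0"
  proof -
    have s: "a (X m) t = a (Y m) t" if "t \<noteq> z" "t \<noteq> X m" "t \<noteq> Y m" for t
      by (rule twins[OF that(2,3) c w0[OF _ that(1)]])
    from lab_cases(2)[OF z(2)] show False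
    proof
      assume "a (X m) z = 1"
      then show False using no_ext_twin[of "X m" "Y m" z] ne zne diag0[OF c] s Yz by auto
    next
      \<comment> \<open>The labels at X m and Y m are opposite, so exchanging the two restores the
        sign.\<close>
      assume "a (X m) z = -1"
      then show False using no_ext_twin[of "Y m" "X m" z] ne zne diag0[OF c] s Yz yx by auto
    qed
  qed
  then show ?thesis using that by blast
qed

text \<open>\<open>z\<close> and \<open>w\<close> saturate X m, and the resulting relation makes
  rows \<open>z\<close> and \<open>w\<close> opposite outside the old ladder. Evaluated at
  \<open>z\<close> and \<open>w\<close> themselves it gives the pattern of a last pair with charge a
  z z.\<close>

lemma step:
  assumes c: "c = 0" and z: "z \<notin> ladder_verts m p X Y" "a (X m) z = 1" and w: "w \<notin> ladder_verts m p X Y" "a (X m) w = 1" "z \<noteq> w"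
  shows "is_ladder a (Suc m) p (X(Suc m := z)) (Y(Suc m := w)) (a z z)"
proof -
  let ?X = "X(Suc m := z)" and ?Y = "Y(Suc m := w)"
  have zp: "z \<notin> prv" "w \<notin> prv" using prv(2) z w by auto
  have Fs: "(\<Sum>t\<in>insert z (insert w prv). nsq (a (X m) t)) \<ge> 4" using prv(1,3) zp z w by simp
  have x0: "a (X m) t = 0" if "t \<notin> insert z (insert w (ladder_verts m p X Y))" for t
    by (rule full(1)[OF _ Fs]) (use that prv in auto)
  have row: "a z t + a w t = 0" if "t \<notin> ladder_verts m p X Y" for t
  proof -
    have "t \<noteq> X m" using that inX[of m] by blast
    then have "(\<Sum>u\<in>insert z (insert w prv). a (X m) u * a u t) = 0" using prv(1) by (intro full(2)[OF _ Fs]) auto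
    then show ?thesis using prv(1) prv(4)[OF that] zp w z by simp
  qed
  have wz: "a w z = - a z z" using minus_eqI[OF row[OF z(1)]] .
  have czz: "cnj (a z z) = a z z" using diag[of z] by auto
  have zw: "a z w = - a z z" using flip[of z w] wz czz by simp
  have ww: "a w w = a z z" using row[OF w(1)] zw by simp
  have Yz: "a (Y m) z = -1" "a (Y m) w = -1" using out(4)[OF z(1)] out(4)[OF w(1)] z w by auto
  have zneX: "z \<noteq> X i" "z \<noteq> Y i" "w \<noteq> X i" "w \<noteq> Y i" "z \<noteq> p" "w \<noteq> p" if "i \<le> m" for i
    using z(1) w(1) inX[OF that] inY[OF that] inp by blast+
  have Xz: "a (X i) z = (if i = m then 1 else 0)" "a (X i) w = (if i = m then 1 else 0)"
    "a (Y i) z = (if i = m then -1 else 0)" "a (Y i) w = (if i = m then -1 else 0)" if "i \<le> m" for i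
    using that out(2,3)[OF z(1), of i] out(2,3)[OF w(1), of i] z w Yz by (cases "i = m"; simp)+
  have zX: "a z (X i) = (if i = m then 1 else 0)" "a w (X i) = (if i = m then 1 else 0)"
    "a z (Y i) = (if i = m then -1 else 0)" "a w (Y i) = (if i = m then -1 else 0)" if "i \<le> m" for i
    using Xz[OF that] flip[of z "X i"] flip[of w "X i"] flip[of z "Y i"] flip[of w "Y i"] by auto
  have lv: "ladder_verts (Suc m) p ?X ?Y = insert z (insert w (ladder_verts m p X Y))"
  proof -
    have "?X ` {..Suc m} = insert z (X ` {..m})" "?Y ` {..Suc m} = insert w (Y ` {..m})"
      by (auto simp: atMost_Suc)
    then show ?thesis unfolding ladder_verts_def by auto
  qed
  show ?thesis
    unfolding is_ladder_def lv
  proof (intro conjI allI impI)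
    show "a p p = 0" by (rule pp)
    fix i assume i: "i \<le> Suc m"
    show "?X i \<noteq> p" "?Y i \<noteq> p" using i pne[of i] zneX[of 0] by auto
    show "a p (?X i) = (if i = 0 then \<omega> else 0)" "a p (?Y i) = (if i = 0 then \<omega> else 0)"
      using i pX[of i] pY[of i] out(1)[OF z(1)] out(1)[OF w(1)] by auto
    fix j assume j: "j \<le> Suc m"
    have ij: "i = Suc m \<and> j = Suc m \<or> i = Suc m \<and> j \<le> m \<or> i \<le> m \<and> j = Suc m \<or> i \<le> m \<and> j \<le> m" using i j by auto
    show "?X i \<noteq> ?Y j" using ij w(3) zneX[of i] zneX[of j] XneY[of i j] by auto
    show "i = j" if "?X i = ?X j" using ij that zneX[of i] zneX[of j] Xinj[of i j] by auto
    show "i = j" if "?Y i = ?Y j" using ij that zneX[of i] zneX[of j] Yinj[of i j] by auto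
    show "a (?X i) (?X j) = (if j = Suc i \<or> i = Suc j then 1 else if i = j \<and> i = Suc m then a z z else 0)"
      using ij zX[of j] Xz[of i] XX[of i j] c by (elim disjE conjE) auto
    show "a (?Y i) (?Y j) = (if j = Suc i \<or> i = Suc j then -1 else if i = j \<and> i = Suc m then a z z else 0)"
      using ij zX[of j] Xz[of i] YY[of i j] c ww by (elim disjE conjE) auto
    show "a (?X i) (?Y j) = (if j = Suc i then 1 else if i = Suc j then -1 else if i = j \<and> i = Suc m then - a z z else 0)"
      using ij zX[of j] Xz[of i] XY[of i j] c zw by (elim disjE conjE) auto
  next
    fix t assume t: "t \<notin> insert z (insert w (ladder_verts m p X Y))"
    then have t': "t \<notin> ladder_verts m p X Y" by simp
    show "a p t = 0" by (rule out(1)[OF t'])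
    show "a (?X i) t = 0" "a (?Y i) t = 0" if "i < Suc m" for i
      using that out(2,3)[OF t', of i] out(4)[OF t'] x0[OF t] by (cases "i = m"; simp)+
    show "a (?Y (Suc m)) t = - a (?X (Suc m)) t" using minus_eqI[OF row[OF t']] by simp
  qed
qed

end

lemma is_ladder_sw:
  assumes l: "is_ladder a m p X Y c" and s: "\<And>v. v \<in> ladder_verts m p X Y \<Longrightarrow> s v = 1"
  shows "is_ladder (switched s a) m p X Y c"
proof -
  have "s p = 1" "\<And>i. i \<le> m \<Longrightarrow> s (X i) = 1" "\<And>i. i \<le> m \<Longrightarrow> s (Y i) = 1" using s by (auto simp: ladder_verts_def)
  then show ?thesis using l unfolding is_ladder_def switched_def by simp
qed

text \<open>The ladder grows by one pair per step until the last pair is charged or meets an edge of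
  weight 2; this must happen because it has 2 m + 3 distinct vertices.\<close>

lemma is_ladder_listed: "max_graph n a \<Longrightarrow> is_ladder a m p X Y c \<Longrightarrow> listed n a"
proof (induction "n - m" arbitrary: a m X Y c rule: less_induct)
  case less
  interpret ladder n a m p X Y c using less.prems by (simp add: ladder_def ladder_axioms_def)
  show ?case
  proof (cases "c = 0")
    case False
    then show ?thesis by (rule finish_C2)
  next
    case c: True
    obtain z where z: "z \<notin> ladder_verts m p X Y" "a (X m) z \<noteq> 0" using exists_out[OF c] by blast
    have zp: "z \<notin> prv" using prv(2) z by auto
    have "(\<Sum>t\<in>insert z prv. nsq (a (X m) t)) \<le> 4" using prv(1) by (intro sum_le) simp
    then have "nsq (a (X m) z) \<le> 2" using prv(1,3) zp by simp
    then consider "nsq (a (X m) z) = 2" | "nsq (a (X m) z) = 1" using lab_cases(1)[of "X m" z] z by auto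
    then show ?thesis
    proof cases
      case 1
      then show ?thesis by (rule finish_T4[OF c z(1)])
    next
      case z1: 2
      obtain w where w: "w \<notin> ladder_verts m p X Y" "w \<noteq> z" "a (X m) w \<noteq> 0" using exists_second[OF c z(1) z1] by blast
      have wp: "w \<notin> prv" using prv(2) w by auto
      have "(\<Sum>t\<in>insert w (insert z prv). nsq (a (X m) t)) \<le> 4" using prv(1) by (intro sum_le) simp
      then have "nsq (a (X m) w) = 1" using prv(1,3) zp wp w(2) z1 nz_ge1[OF w(3)] by simp
      then have w1: "a (X m) w = 1 \<or> a (X m) w = -1" by (rule lab_cases(2))
      have z1': "a (X m) z = 1 \<or> a (X m) z = -1" using lab_cases(2)[OF z1] .
      \<comment> \<open>Only the new pair is switched, so the ladder built so far is
        untouched.\<close>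
      define s where "s = (\<lambda>v. if v = z \<or> v = w then a (X m) v else 1)"
      have s: "s i \<in> {1, -1}" for i using w1 z1' by (auto simp: s_def)
      have sl: "s v = 1" if "v \<in> ladder_verts m p X Y" for v using that z w by (auto simp: s_def)
      interpret b: max_graph n "switched s a" by (rule max_graph_sw[OF max_graph_axioms s])
      interpret b: ladder n "switched s a" m p X Y c
        by unfold_locales (rule is_ladder_sw[OF is_ladder sl])
      have e: "switched s a (X m) z = 1" "switched s a (X m) w = 1"
        using sl[OF inX[of m]] w1 z1' by (auto simp: switched_def s_def)
      have "is_ladder (switched s a) (Suc m) p (X(Suc m := z)) (Y(Suc m := w)) (switched s a z z)"
        by (rule b.step[OF c z(1) e(1) w(1) e(2)]) (use w in auto)
      moreover have "n - Suc m < n - m"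
        using card_mono[OF _ ladder_verts_sub] card_lvs by simp
      ultimately have "listed n (switched s a)" using less.hyps b.max_graph_axioms by blast
      then show ?thesis by (rule listed_sw[OF _ s])
    qed
  qed
qed

section \<open>Starting a ladder and assembling the cases\<close>

context max_graph
begin

text \<open>Two edges of weight 2 saturate \<open>p\<close>, and once both labels are switched to
  \<omega> the relation at \<open>p\<close> makes rows \<open>x\<close> and \<open>y\<close>
  opposite away from \<open>p\<close>: this is a ladder with m = 0.\<close>

lemma two_omega:
  assumes x: "nsq (a p x) = 2" and y: "nsq (a p y) = 2" and xy: "x \<noteq> y"
  shows "listed n a"
proof -
  have ne: "p \<noteq> x" "p \<noteq> y" using loop_ne[of p x] loop_ne[of p y] x y by auto
  define s where "s = (\<lambda>v. if (v = x \<or> v = y) \<and> a p v = - \<omega> then -1 else 1 :: complex)"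
  have s: "s i \<in> {1, -1}" for i by (simp add: s_def)
  define b where "b = switched s a"
  interpret b: max_graph n b unfolding b_def by (rule max_graph_sw[OF max_graph_axioms s])
  have bx: "b p x = \<omega>" "b p y = \<omega>" using lab_cases(3)[OF x] lab_cases(3)[OF y] ne by (auto simp: b_def switched_def s_def)
  have Fs: "(\<Sum>t\<in>{x,y}. nsq (b p t)) \<ge> 4" using xy bx by simp
  have p0: "\<forall>t. t \<notin> {x,y} \<longrightarrow> b p t = 0" by (rule b.row_zero[OF _ Fs]) simp
  have row: "b y t = - b x t" if "t \<noteq> p" for t
  proof -
    have "\<omega> * (b x t + b y t) = 0" using b.full(2)[OF _ Fs that] xy bx by (simp add: distrib_left)
    then show ?thesis using minus_eqI by simp
  qed
  have cx: "cnj (b x x) = b x x" using b.diag[of x] by auto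
  have yx: "b y x = - b x x" using row[of x] ne by auto
  then have xy': "b x y = - b x x" using b.flip[of x y] cx by simp
  then have yy: "b y y = b x x" using row[of y] ne by simp
  have "is_ladder b 0 p (\<lambda>_. x) (\<lambda>_. y) (b x x)"
    unfolding is_ladder_def ladder_verts_def using p0 ne xy bx row yx xy' yy by auto
  then have "listed n b" using is_ladder_listed b.max_graph_axioms by blast
  then show ?thesis unfolding b_def by (rule listed_sw[OF _ s])
qed

lemma classify:
  assumes "a p x \<notin> {0, 1, -1}"
  shows "listed n a"
proof -
  have w: "nsq (a p x) \<in> {2, 3, 4}" using lab_cases(1,2)[of p x] assms by auto
  consider i j where "nsq (a i j) = 4" | i j where "nsq (a i j) = 3" | "\<forall>i j. nsq (a i j) \<le> 2"
  proof -
    assume 1: "\<And>i j. nsq (a i j) = 4 \<Longrightarrow> thesis" and 2: "\<And>i j. nsq (a i j) = 3 \<Longrightarrow> thesis"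
      and 3: "\<forall>i j. nsq (a i j) \<le> 2 \<Longrightarrow> thesis"
    have "nsq (a i j) \<le> 2 \<or> nsq (a i j) = 3 \<or> nsq (a i j) = 4" for i j using lab_cases(1)[of i j] by auto
    then show thesis using 1 2 3 by blast
  qed
  then show ?thesis
  proof cases
    case 1
    then show ?thesis by (rule weight4)
  next
    case 2
    then show ?thesis by (rule weight3)
  next
    case 3
    then have "nsq (a p x) \<le> 2" by blast
    then have px: "nsq (a p x) = 2" using w by auto
    show ?thesis
    proof (cases "light_matching (weights a)")
      case True
      then show ?thesis by (rule matching_case[OF _ px])
    next
      case False
      then obtain i j k where "nsq (a i j) = 2" "nsq (a i k) = 2" "j \<noteq> k"
        using 3 unfolding light_matching_def weights_def by blast
      then show ?thesis by (rule two_omega)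
    qed
  qed
qed

end

theorem theorem4:
  fixes A :: "complex mat"
  assumes "maximal_connected_cyclotomic (-2) A"
    and "\<not> (\<exists>B. charged_signed_graph (-2) B \<and> equivalent A B)"
  shows "(equivalent A S2 \<or> equivalent A S2') \<or>
         (equivalent A S4' \<or> equivalent A S4 \<or> equivalent A S4_star) \<or>
         equivalent A S8_star \<or>
         (\<exists>k\<ge>2. equivalent A (T4 k)) \<or>
         (\<exists>k\<ge>1. equivalent A (C2_plus k))"
proof -
  define n where "n = dim_row A"
  note A = max_graph_of_maximal[OF assms(1) n_def]
  have "L_graph (-2) A"
    using assms(1) unfolding maximal_connected_cyclotomic_def connected_cyclotomic_def by blast
  then obtain i j where "entry A i j \<notin> {0, 1, -1}"
    using charged_signed_self[OF A(1)] assms(2) by blast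
  then have "listed n (entry A)" by (rule max_graph.classify[OF A(2)])
  then obtain T where T: "T \<in> targets" "equiv_to n (entry A) T" unfolding listed_def by blast
  have "equivalent A T" by (rule equivalentI[OF A(1) T(2)])
  then show ?thesis using T(1) unfolding targets_def by blast
qed

end
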